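(* There is a constant $C=C(n)>0$, depending only on $n$, such that for all $r>0$, $T>0$, $N>0$ and all $u_0\in L^2(\mathbb R^n;\mathbb C)$ with $\operatorname{supp}u_0\subset B_N(0)$, $$\int_{\mathbb R^n}|u_0(x)|^2\,dx\le e^{C\left(1+\frac{rN}{T}\right)}\int_{B_r^c(0)}|u(x,T;u_0)|^2\,dx.$$
   Context: Here $n\in\{1,2,\dots\}$ is fixed. For $u_0\in L^2(\mathbb R^n;\mathbb C)$ and $t\ge 0$, $u(x,t;u_0)=(e^{i\Delta t}u_0)(x)$ denotes the solution of the free Schrödinger equation $i\partial_t u+\Delta u=0$ in $\mathbb R^n\times(0,\infty)$ with $u(x,0)=u_0(x)$. $B_r(x)$ is the closed ball in $\mathbb R^n$ centered at $x$ of radius $r$, and $B_r^c(x)$ is its complement in $\mathbb R^n$. *)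

theory Defs
  imports "HOL-Analysis.Analysis"
begin

text \<open>
  Elements of \<open>L\<^sup>2(\<real>\<^sup>n; \<complex>)\<close> are represented by functions rather than by classes modulo
  null sets; statements about them below do not depend on the representative.
\<close>

definition in_L2 :: "(real ^ 'n \<Rightarrow> complex) \<Rightarrow> bool" where
  "in_L2 f \<longleftrightarrow> f \<in> borel_measurable lebesgue \<and> integrable lebesgue (\<lambda>x. (cmod (f x))\<^sup>2)"

text \<open>
  The support of an \<open>L\<^sup>2\<close> function, i.e.\ of its class modulo null sets: the complement of the
  largest open set on which the function vanishes almost everywhere.
\<close>

definition ess_supp :: "(real ^ 'n \<Rightarrow> complex) \<Rightarrow> (real ^ 'n) set" where
  "ess_supp f = - \<Union>{U. open U \<and> (AE x in lebesgue. x \<in> U \<longrightarrow> f x = 0)}"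

definition partial_deriv :: "'n \<Rightarrow> (real ^ 'n \<Rightarrow> complex) \<Rightarrow> real ^ 'n \<Rightarrow> complex" where
  "partial_deriv j f = (\<lambda>x. frechet_derivative f (at x) (axis j 1))"

definition laplacian :: "(real ^ 'n \<Rightarrow> complex) \<Rightarrow> real ^ 'n \<Rightarrow> complex" where
  "laplacian f = (\<lambda>x. \<Sum>j\<in>UNIV. partial_deriv j (partial_deriv j f) x)"

text \<open>
  \<open>C\<^sup>\<infinity>\<close>: every iterated partial derivative, the function itself included (empty list), is
  Frechet differentiable everywhere.
\<close>

definition smooth_fun :: "(real ^ 'n \<Rightarrow> complex) \<Rightarrow> bool" where
  "smooth_fun f \<longleftrightarrow> (\<forall>js x. foldr partial_deriv js f differentiable (at x))"

definition test_function :: "(real ^ 'n \<Rightarrow> complex) \<Rightarrow> bool" where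
  "test_function f \<longleftrightarrow> smooth_fun f \<and> compact (closure {x. f x \<noteq> 0})"

text \<open>
  \<open>u(\<cdot>,t) = e\<^bsup>i\<Delta>t\<^esup> u\<^sub>0\<close> for \<open>u\<^sub>0 \<in> L\<^sup>2\<close>: the solution \<open>u \<in> C([0,\<infinity>); L\<^sup>2(\<real>\<^sup>n; \<complex>))\<close> of
  \<open>i \<partial>\<^sub>t u + \<Delta> u = 0\<close> in \<open>\<real>\<^sup>n \<times> (0,\<infinity>)\<close> with \<open>u(\<cdot>,0) = u\<^sub>0\<close>. For such data \<open>\<Delta> u(\<cdot>,t)\<close> is only a
  distribution on \<open>\<real>\<^sup>n\<close>, so the equation is tested against \<open>C\<^sub>c\<^sup>\<infinity>(\<real>\<^sup>n)\<close>, without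
  complex conjugation in the pairing. The condition on \<open>D\<close> is
  \<open>i \<partial>\<^sub>t \<langle>u(\<cdot>,t), \<phi>\<rangle> + \<langle>u(\<cdot>,t), \<Delta>\<phi>\<rangle> = 0\<close>.
\<close>

definition schrodinger_solution ::
    "(real ^ 'n \<Rightarrow> complex) \<Rightarrow> (real ^ 'n \<Rightarrow> real \<Rightarrow> complex) \<Rightarrow> bool" where
  "schrodinger_solution u0 u \<longleftrightarrow>
     (\<forall>t\<ge>0. in_L2 (\<lambda>x. u x t)) \<and>
     (\<forall>s\<ge>0. ((\<lambda>t. LINT x|lebesgue. (cmod (u x t - u x s))\<^sup>2) \<longlongrightarrow> 0) (at s within {0..})) \<and>
     (AE x in lebesgue. u x 0 = u0 x) \<and>
     (\<forall>\<phi>. test_function \<phi> \<longrightarrow> (\<forall>t>0. \<exists>D.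
        ((\<lambda>s. LINT x|lebesgue. u x s * \<phi> x) has_vector_derivative D) (at t) \<and>
        \<i> * D + (LINT x|lebesgue. u x t * laplacian \<phi> x) = 0))"

end

theory Submission
  imports Defs
begin

text \<open>
  Let \<open>u\<close> be a solution, \<open>x\<^sub>k\<close> a coordinate, and \<open>s\<close> a real number. By Galilean invariance
  \<open>v(x, t) = e\<^bsup>i (s x\<^sub>k - s\<^sup>2 t)\<^esup> u(x - 2 s t e\<^sub>k, t)\<close> is the solution with initial datum \<open>e\<^bsup>i s x\<^sub>k\<^esup> u\<^sub>0\<close>
  (\<open>weak_solution_galilean_boost\<close>). At time \<open>T\<close> its modulus is that of \<open>u\<close>, translated by
  \<open>2 s T\<close>. If \<open>s T > r\<close>, the translate of the ball of radius \<open>r\<close> is disjoint from the ball, so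
  the mass of \<open>v\<close> in the ball at time \<open>T\<close> is at most the mass of \<open>u\<close> outside it
  (\<open>L2norm_boost_ball_le\<close>).

  It remains to express \<open>u\<close> by boosts with such large \<open>s\<close>. Since \<open>u\<^sub>0\<close> lives on \<open>|x| \<le> N\<close>, it is
  enough to approximate the constant \<open>1\<close> on \<open>[-N, N]\<close> by a sum \<open>\<Sum> c\<^sub>j e\<^bsup>i s\<^sub>j x\<^esup>\<close> with \<open>s\<^sub>j T > r\<close>, up to an
  error \<open>1/2\<close>. With \<open>w = e\<^bsup>i \<delta> x\<^esup>\<close> and \<open>\<delta>\<close> so small that \<open>|1 - w| \<le> 1/8\<close>, the terms of degree at
  least \<open>m\<close> in \<open>w\<close> of the binomial expansion of \<open>(w + (1 - w))\<^bsup>2m\<^esup>\<close> do this, where \<open>m\<close> is of order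
  \<open>r N / T\<close>, and their coefficients sum to at most \<open>9\<^sup>m\<close>
  (\<open>high_frequency_approximation_of_one\<close>). The solution \<open>u - \<Sum> c\<^sub>j v\<^sub>j\<close> then has at most half the
  norm of \<open>u\<^sub>0\<close> initially, hence at time \<open>T\<close>, and the estimate follows from the triangle
  inequality in the ball (\<open>observability_weak_solution\<close>).

  Besides the symmetry this uses only conservation of mass (\<open>mass_conservation\<close>), which for
  solutions in the sense of distributions is a form of uniqueness. Formally
  \<open>\<integral>\<integral> cnj (u(z)) u(y) K(y - z) dy dz\<close> is conserved for every smooth even real kernel \<open>K\<close> with
  compact support, because \<open>\<Delta>\<close> acts in the same way in both variables. The kernel makes the
  formal computation legitimate: for fixed \<open>z\<close> it is a test function in \<open>y\<close>. As \<open>K\<close> shrinks to a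
  point mass, continuity of translations in \<open>L\<^sup>2\<close> yields the mass itself.
\<close>

section \<open>Square-integrable functions\<close>

definition square_integrable :: "'a measure \<Rightarrow> ('a \<Rightarrow> complex) \<Rightarrow> bool" where
  "square_integrable M f \<longleftrightarrow> f \<in> borel_measurable M \<and> integrable M (\<lambda>x. (cmod (f x))\<^sup>2)"

definition L2norm :: "'a measure \<Rightarrow> ('a \<Rightarrow> complex) \<Rightarrow> real" where
  "L2norm M f = sqrt (LINT x|M. (cmod (f x))\<^sup>2)"

lemma square_integrable_integrable:
  "square_integrable M f \<Longrightarrow> integrable M (\<lambda>x. (cmod (f x))\<^sup>2)"
  by (simp add: square_integrable_def)

lemma L2norm_nonneg [simp]: "0 \<le> L2norm M f"
  by (simp add: L2norm_def)

lemma L2norm_power2: "(L2norm M f)\<^sup>2 = (LINT x|M. (cmod (f x))\<^sup>2)"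
  by (simp add: L2norm_def)

lemma L2norm_cong_AE:
  assumes "f \<in> borel_measurable M" "g \<in> borel_measurable M"
    and "AE x in M. cmod (f x) = cmod (g x)"
  shows "L2norm M f = L2norm M g"
proof -
  note [measurable] = assms(1,2)
  have "(LINT x|M. (cmod (f x))\<^sup>2) = (LINT x|M. (cmod (g x))\<^sup>2)"
    by (rule integral_cong_AE) (use assms(3) in \<open>measurable, auto\<close>)
  then show ?thesis by (simp add: L2norm_def)
qed

lemma square_integrable_dominated:
  assumes "square_integrable M f" "g \<in> borel_measurable M"
    and "\<And>x. cmod (g x) \<le> c * cmod (f x)"
  shows "square_integrable M g"
  unfolding square_integrable_def
proof
  have [measurable]: "g \<in> borel_measurable M" by fact
  have "(cmod (g x))\<^sup>2 \<le> c\<^sup>2 * (cmod (f x))\<^sup>2" for x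
    using power_mono[OF assms(3), of x 2] by (simp add: power_mult_distrib)
  then have "norm ((cmod (g x))\<^sup>2) \<le> norm (c\<^sup>2 * (cmod (f x))\<^sup>2)" for x
    by simp
  moreover have "integrable M (\<lambda>x. c\<^sup>2 * (cmod (f x))\<^sup>2)"
    using assms(1) by (intro integrable_mult_right square_integrable_integrable)
  moreover have "(\<lambda>x. (cmod (g x))\<^sup>2) \<in> borel_measurable M" by measurable
  ultimately show "integrable M (\<lambda>x. (cmod (g x))\<^sup>2)"
    by (metis (no_types, lifting) AE_I2 Bochner_Integration.integrable_bound)
qed fact

lemma L2norm_dominated:
  assumes "square_integrable M f" "g \<in> borel_measurable M" "c \<ge> 0"
    and "\<And>x. cmod (g x) \<le> c * cmod (f x)"
  shows "L2norm M g \<le> c * L2norm M f"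
proof -
  have "(LINT x|M. (cmod (g x))\<^sup>2) \<le> (LINT x|M. c\<^sup>2 * (cmod (f x))\<^sup>2)"
  proof (rule integral_mono)
    show "integrable M (\<lambda>x. (cmod (g x))\<^sup>2)" 
      using assms by (intro square_integrable_integrable square_integrable_dominated[OF assms(1)]) auto
    show "integrable M (\<lambda>x. c\<^sup>2 * (cmod (f x))\<^sup>2)"
      using assms(1) by (intro integrable_mult_right square_integrable_integrable)
    show "(cmod (g x))\<^sup>2 \<le> c\<^sup>2 * (cmod (f x))\<^sup>2" for x
      using power_mono[OF assms(4), of x 2] by (simp add: power_mult_distrib)
  qed
  also have "\<dots> = (c * L2norm M f)\<^sup>2"
    by (simp add: power_mult_distrib L2norm_power2)
  finally show ?thesis
    using assms(3) unfolding L2norm_def[of M g]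
    by (intro real_le_lsqrt) auto
qed

lemma integrable_cmod_mult:
  assumes "square_integrable M f" "square_integrable M g"
  shows "integrable M (\<lambda>x. cmod (f x) * cmod (g x))"
proof (rule Bochner_Integration.integrable_bound)
  show "integrable M (\<lambda>x. (cmod (f x))\<^sup>2 + (cmod (g x))\<^sup>2)"
    using assms by (intro Bochner_Integration.integrable_add square_integrable_integrable)
  have [measurable]: "f \<in> borel_measurable M" "g \<in> borel_measurable M"
    using assms by (auto simp: square_integrable_def)
  show "(\<lambda>x. cmod (f x) * cmod (g x)) \<in> borel_measurable M" by measurable
  have "2 * (a * b) \<le> a\<^sup>2 + b\<^sup>2" for a b :: real
    using sum_squares_bound[of a b] by (simp add: mult.assoc)
  then have "a * b \<le> a\<^sup>2 + b\<^sup>2" if "a \<ge> 0" "b \<ge> 0" for a b :: real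
    using that by (smt (verit) mult_nonneg_nonneg)
  then show "AE x in M. norm (cmod (f x) * cmod (g x)) \<le> norm ((cmod (f x))\<^sup>2 + (cmod (g x))\<^sup>2)"
    by auto
qed

lemma integrable_mult_square_integrable:
  assumes "square_integrable M f" "square_integrable M g"
  shows "integrable M (\<lambda>x. f x * g x)"
proof (rule Bochner_Integration.integrable_bound[OF integrable_cmod_mult[OF assms]])
  have [measurable]: "f \<in> borel_measurable M" "g \<in> borel_measurable M"
    using assms by (auto simp: square_integrable_def)
  show "(\<lambda>x. f x * g x) \<in> borel_measurable M" by measurable
qed (simp add: norm_mult)

text \<open>
  The quadratic form \<open>\<integral> (C |f| - B |g|)\<^sup>2 = C (A C - B\<^sup>2)\<close> is nonnegative, where \<open>A\<close>, \<open>C\<close> are the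
  squared norms and \<open>B = \<integral> |f| |g|\<close>. Only the case \<open>C = 0\<close>, in which \<open>g\<close> is null, is separate.
\<close>

lemma Cauchy_Schwarz_cmod:
  assumes f: "square_integrable M f" and g: "square_integrable M g"
  shows "(LINT x|M. cmod (f x) * cmod (g x)) \<le> L2norm M f * L2norm M g"
proof -
  have [measurable]: "f \<in> borel_measurable M" "g \<in> borel_measurable M"
    using assms by (auto simp: square_integrable_def)
  define A B C where "A = (LINT x|M. (cmod (f x))\<^sup>2)"
    and "B = (LINT x|M. cmod (f x) * cmod (g x))" and "C = (LINT x|M. (cmod (g x))\<^sup>2)"
  note I = square_integrable_integrable[OF f] square_integrable_integrable[OF g]
    integrable_cmod_mult[OF f g]
  have nn: "A \<ge> 0" "B \<ge> 0" "C \<ge> 0" by (auto simp: A_def B_def C_def)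
  have "B\<^sup>2 \<le> A * C"
  proof (cases "C = 0")
    case True
    then have "AE x in M. (cmod (g x))\<^sup>2 = 0"
      using I unfolding C_def by (subst (asm) integral_nonneg_eq_0_iff_AE) auto
    then have "B = (LINT x|M. 0)"
      unfolding B_def by (intro integral_cong_AE) auto
    then show ?thesis using nn by simp
  next
    case False
    have "0 \<le> (LINT x|M. (C * cmod (f x) - B * cmod (g x))\<^sup>2)" by simp
    also have "\<dots> = (LINT x|M. C\<^sup>2 * (cmod (f x))\<^sup>2 - 2 * B * C * (cmod (f x) * cmod (g x))
                         + B\<^sup>2 * (cmod (g x))\<^sup>2)"
      by (intro Bochner_Integration.integral_cong) (auto simp: power2_eq_square algebra_simps)
    also have "\<dots> = C\<^sup>2 * A - 2 * B * C * B + B\<^sup>2 * C"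
      using I by (simp add: A_def B_def C_def)
    also have "\<dots> = C * (A * C - B\<^sup>2)" by (simp add: power2_eq_square algebra_simps)
    finally show ?thesis using False nn by (simp add: zero_le_mult_iff)
  qed
  then have "B \<le> sqrt (A * C)" by (rule real_le_rsqrt)
  then show ?thesis by (simp add: A_def B_def C_def L2norm_def real_sqrt_mult)
qed

lemma Cauchy_Schwarz_L2norm:
  assumes f: "square_integrable M f" and g: "square_integrable M g"
  shows "cmod (LINT x|M. f x * g x) \<le> L2norm M f * L2norm M g"
  using integral_norm_bound[of M "\<lambda>x. f x * g x"] Cauchy_Schwarz_cmod[OF f g]
  by (simp add: norm_mult)

lemma square_integrable_add:
  assumes "square_integrable M f" "square_integrable M g"
  shows "square_integrable M (\<lambda>x. f x + g x)"
proof -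
  have [measurable]: "f \<in> borel_measurable M" "g \<in> borel_measurable M"
    using assms by (auto simp: square_integrable_def)
  have "integrable M (\<lambda>x. (cmod (f x))\<^sup>2 + 2 * (cmod (f x) * cmod (g x)) + (cmod (g x))\<^sup>2)"
    using assms by (intro Bochner_Integration.integrable_add integrable_mult_right
        integrable_cmod_mult square_integrable_integrable)
  moreover have "(cmod (f x + g x))\<^sup>2 \<le> (cmod (f x))\<^sup>2 + 2 * (cmod (f x) * cmod (g x)) + (cmod (g x))\<^sup>2" for x
    using power_mono[OF norm_triangle_ineq[of "f x" "g x"], of 2] by (simp add: power2_eq_square algebra_simps)
  ultimately have "integrable M (\<lambda>x. (cmod (f x + g x))\<^sup>2)"
    by (elim Bochner_Integration.integrable_bound) auto
  then show ?thesis by (simp add: square_integrable_def)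
qed

lemma L2norm_triangle:
  assumes f: "square_integrable M f" and g: "square_integrable M g"
  shows "L2norm M (\<lambda>x. f x + g x) \<le> L2norm M f + L2norm M g"
proof -
  note I = square_integrable_integrable[OF f] square_integrable_integrable[OF g]
    integrable_cmod_mult[OF f g] square_integrable_integrable[OF square_integrable_add[OF f g]]
  have "(LINT x|M. (cmod (f x + g x))\<^sup>2)
      \<le> (LINT x|M. (cmod (f x))\<^sup>2 + 2 * (cmod (f x) * cmod (g x)) + (cmod (g x))\<^sup>2)"
  proof (rule integral_mono)
    show "(cmod (f x + g x))\<^sup>2 \<le> (cmod (f x))\<^sup>2 + 2 * (cmod (f x) * cmod (g x)) + (cmod (g x))\<^sup>2" for x
      using power_mono[OF norm_triangle_ineq[of "f x" "g x"], of 2] by (simp add: power2_eq_square algebra_simps)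
  qed (use I in auto)
  also have "\<dots> = (L2norm M f)\<^sup>2 + 2 * (LINT x|M. cmod (f x) * cmod (g x)) + (L2norm M g)\<^sup>2"
    using I by (simp add: L2norm_power2)
  also have "\<dots> \<le> (L2norm M f + L2norm M g)\<^sup>2"
    using Cauchy_Schwarz_cmod[OF f g] by (simp add: power2_eq_square algebra_simps)
  finally show ?thesis
    unfolding L2norm_def[of M "\<lambda>x. f x + g x"] by (intro real_le_lsqrt) auto
qed

lemma square_integrable_mult_left:
  "square_integrable M f \<Longrightarrow> square_integrable M (\<lambda>x. c * f x)"
  by (auto simp: square_integrable_def norm_mult power_mult_distrib)

lemma L2norm_mult_left: "L2norm M (\<lambda>x. c * f x) = cmod c * L2norm M f"
  by (simp add: L2norm_def norm_mult power_mult_distrib real_sqrt_mult)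

lemma square_integrable_diff:
  assumes "square_integrable M f" "square_integrable M g"
  shows "square_integrable M (\<lambda>x. f x - g x)"
  using square_integrable_add[OF assms(1) square_integrable_mult_left[OF assms(2), of "-1"]] by simp

lemma L2norm_diff_triangle:
  assumes "square_integrable M f" "square_integrable M g"
  shows "L2norm M (\<lambda>x. f x - g x) \<le> L2norm M f + L2norm M g"
  using L2norm_triangle[OF assms(1) square_integrable_mult_left[OF assms(2), of "-1"]]
    L2norm_mult_left[of M "-1" g] by simp

lemma L2norm_diff_diff:
  assumes f: "square_integrable M f" and g: "square_integrable M g"
  shows "\<bar>L2norm M f - L2norm M g\<bar> \<le> L2norm M (\<lambda>x. f x - g x)"
proof -
  have "L2norm M f \<le> L2norm M (\<lambda>x. f x - g x) + L2norm M g"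
    using L2norm_triangle[OF square_integrable_diff[OF f g] g] by simp
  moreover have "L2norm M g \<le> L2norm M (\<lambda>x. g x - f x) + L2norm M f"
    using L2norm_triangle[OF square_integrable_diff[OF g f] f] by simp
  moreover have "L2norm M (\<lambda>x. g x - f x) = L2norm M (\<lambda>x. f x - g x)"
    by (simp add: L2norm_def norm_minus_commute)
  ultimately show ?thesis by linarith
qed

lemma square_integrable_zero [simp]: "square_integrable M (\<lambda>x. 0)"
  by (simp add: square_integrable_def)

lemma L2norm_zero [simp]: "L2norm M (\<lambda>x. 0) = 0"
  by (simp add: L2norm_def)

lemma square_integrable_sum:
  assumes "\<And>i. i \<in> I \<Longrightarrow> square_integrable M (f i)"
  shows "square_integrable M (\<lambda>x. \<Sum>i\<in>I. f i x)"
  using assms by (induction I rule: infinite_finite_induct) (auto intro: square_integrable_add)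

lemma L2norm_sum:
  assumes "\<And>i. i \<in> I \<Longrightarrow> square_integrable M (f i)"
  shows "L2norm M (\<lambda>x. \<Sum>i\<in>I. f i x) \<le> (\<Sum>i\<in>I. L2norm M (f i))"
  using assms
proof (induction I rule: infinite_finite_induct)
  case (insert i I)
  then have "L2norm M (\<lambda>x. f i x + (\<Sum>i\<in>I. f i x)) \<le> L2norm M (f i) + L2norm M (\<lambda>x. \<Sum>i\<in>I. f i x)"
    by (intro L2norm_triangle square_integrable_sum) auto
  with insert show ?case by auto
qed auto

lemma square_integrable_cnj: "square_integrable M f \<Longrightarrow> square_integrable M (\<lambda>x. cnj (f x))"
proof -
  assume f: "square_integrable M f"
  have "cnj \<in> borel_measurable borel"
    by (intro borel_measurable_continuous_onI continuous_intros)
  then have "(\<lambda>x. cnj (f x)) \<in> borel_measurable M"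
    using f by (intro measurable_compose[where f=f and g=cnj and N=borel]) (auto simp: square_integrable_def)
  with f show ?thesis by (simp add: square_integrable_def)
qed

lemma L2norm_cnj: "L2norm M (\<lambda>x. cnj (f x)) = L2norm M f"
  by (simp add: L2norm_def)

lemma square_integrable_indicator:
  assumes "square_integrable M f" "A \<in> sets M"
  shows "square_integrable M (\<lambda>x. indicator A x * f x)"
proof (rule square_integrable_dominated[OF assms(1), where c=1])
  have [measurable]: "f \<in> borel_measurable M" "A \<in> sets M"
    using assms by (auto simp: square_integrable_def)
  show "(\<lambda>x. indicator A x * f x) \<in> borel_measurable M" by measurable
qed (auto simp: indicator_def)

lemma L2norm_indicator_split:
  assumes f: "square_integrable M f" and A: "A \<in> sets M"
  shows "(L2norm M f)\<^sup>2 = (L2norm M (\<lambda>x. indicator A x * f x))\<^sup>2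
      + (L2norm M (\<lambda>x. indicator (- A) x * f x))\<^sup>2"
proof -
  have A': "space M - A \<in> sets M" using A by auto
  note I = square_integrable_integrable[OF square_integrable_indicator[OF f A]]
    square_integrable_integrable[OF square_integrable_indicator[OF f A']]
  have eq: "(LINT x|M. (cmod (indicator (- A) x * f x))\<^sup>2)
      = (LINT x|M. (cmod (indicator (space M - A) x * f x))\<^sup>2)"
    by (intro Bochner_Integration.integral_cong) (auto simp: indicator_def)
  have "(LINT x|M. (cmod (f x))\<^sup>2) = (LINT x|M. (cmod (indicator A x * f x))\<^sup>2
      + (cmod (indicator (space M - A) x * f x))\<^sup>2)"
    by (intro Bochner_Integration.integral_cong) (auto simp: indicator_def)
  also have "\<dots> = (LINT x|M. (cmod (indicator A x * f x))\<^sup>2)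
      + (LINT x|M. (cmod (indicator (space M - A) x * f x))\<^sup>2)"
    using I by (intro Bochner_Integration.integral_add)
  finally show ?thesis unfolding L2norm_power2 eq .
qed

lemma square_integrable_translate:
  fixes f :: "'a::euclidean_space \<Rightarrow> complex"
  assumes "square_integrable lborel f"
  shows "square_integrable lborel (\<lambda>x. f (a + x))"
proof -
  have [measurable]: "f \<in> borel_measurable borel"
    using assms by (auto simp: square_integrable_def)
  have "integrable (distr lborel borel ((+) a)) (\<lambda>x. (cmod (f x))\<^sup>2)"
    using square_integrable_integrable[OF assms] by (simp add: lborel_distr_plus)
  then have "integrable lborel (\<lambda>x. (cmod (f (a + x)))\<^sup>2)"
    by (subst (asm) integrable_distr_eq) auto
  then show ?thesis by (simp add: square_integrable_def)
qed

lemma lborel_integral_translate: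
  fixes f :: "'a::euclidean_space \<Rightarrow> 'b::{banach, second_countable_topology}"
  assumes [measurable]: "f \<in> borel_measurable borel"
  shows "(LINT x|lborel. f (a + x)) = (LINT x|lborel. f x)"
proof -
  have "(LINT x|lborel. f x) = (LINT x|distr lborel borel ((+) a). f x)"
    by (simp add: lborel_distr_plus)
  also have "\<dots> = (LINT x|lborel. f (a + x))"
    by (subst integral_distr) auto
  finally show ?thesis by simp
qed

lemma L2norm_translate:
  fixes f :: "'a::euclidean_space \<Rightarrow> complex"
  assumes "f \<in> borel_measurable borel"
  shows "L2norm lborel (\<lambda>x. f (a + x)) = L2norm lborel f"
  using lborel_integral_translate[of "\<lambda>x. (cmod (f x))\<^sup>2" a] assms by (simp add: L2norm_def)

section \<open>Products of smooth functions of one variable\<close>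

lemma continuous_compact_support:
  fixes g :: "'a::euclidean_space \<Rightarrow> complex"
  assumes c: "continuous_on UNIV g" and z: "\<And>x. R < norm x \<Longrightarrow> g x = 0"
  shows "integrable lborel g" "square_integrable lborel g" "\<exists>B. \<forall>x. cmod (g x) \<le> B"
proof -
  have eq: "indicator (cball 0 R) x *\<^sub>R g x = g x"
    "indicator (cball 0 R) x *\<^sub>R (cmod (g x))\<^sup>2 = (cmod (g x))\<^sup>2" for x
    using z[of x] by (auto simp: indicator_def)
  show "integrable lborel g"
    using borel_integrable_compact[of "cball 0 R" g] c continuous_on_subset by (auto simp: eq)
  have "continuous_on (cball 0 R) (\<lambda>x. (cmod (g x))\<^sup>2)"
    using c by (intro continuous_intros) (auto intro: continuous_on_subset)
  then have "integrable lborel (\<lambda>x. (cmod (g x))\<^sup>2)"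
    using borel_integrable_compact[of "cball 0 R" "\<lambda>x. (cmod (g x))\<^sup>2"] by (simp only: eq compact_cball)
  then show "square_integrable lborel g"
    using borel_measurable_continuous_onI[OF c] by (simp add: square_integrable_def)
  have "bounded (g ` cball 0 R)"
    using c by (intro compact_imp_bounded compact_continuous_image)
      (auto intro: continuous_on_subset)
  then obtain B where B: "\<forall>x\<in>cball 0 R. cmod (g x) \<le> B"
    by (auto simp: bounded_iff)
  have "cmod (g x) \<le> max B 0" for x
    using B z[of x] by (cases "norm x \<le> R") (auto simp: max.coboundedI1)
  then show "\<exists>B. \<forall>x. cmod (g x) \<le> B" by blast
qed

text \<open>
  Smooth functions of one real variable are carried around together with all their
  derivatives: \<open>F k\<close> is the \<open>k\<close>-th derivative of \<open>F 0\<close>. Derivatives of products, dilations and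
  modulations are then explicit formulas, and no differentiation operator has to be evaluated.
\<close>

definition derivative_chain :: "(nat \<Rightarrow> real \<Rightarrow> complex) \<Rightarrow> bool" where
  "derivative_chain F \<longleftrightarrow> (\<forall>k x. (F k has_vector_derivative F (Suc k) x) (at x))"

text \<open>
  These are the members of \<open>C\<^sub>c\<^sup>\<infinity>(\<real>; \<complex>)\<close>, in the form of their sequences of derivatives.
\<close>

definition jet :: "(nat \<Rightarrow> real \<Rightarrow> complex) \<Rightarrow> bool" where
  "jet F \<longleftrightarrow> derivative_chain F \<and> (\<exists>R. \<forall>k x. R < \<bar>x\<bar> \<longrightarrow> F k x = 0)"

lemma derivative_chainD:
  "derivative_chain F \<Longrightarrow> (F k has_vector_derivative F (Suc k) x) (at x)"
  by (simp add: derivative_chain_def)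

text \<open>
  Pascal's rule in the form in which it drives the induction step of the Leibniz formula for
  the higher derivatives of a product.
\<close>

lemma sum_choose_Leibniz:
  fixes a :: "nat \<Rightarrow> nat \<Rightarrow> complex"
  shows "(\<Sum>i\<le>k. of_nat (k choose i) * (a (Suc i) (k - i) + a i (Suc (k - i))))
    = (\<Sum>i\<le>Suc k. of_nat (Suc k choose i) * a i (Suc k - i))"
proof -
  have "(\<Sum>i\<le>Suc k. of_nat (Suc k choose i) * a i (Suc k - i))
      = a 0 (Suc k) + (\<Sum>i\<le>k. of_nat ((k choose i) + (k choose Suc i)) * a (Suc i) (k - i))"
    by (subst sum.atMost_Suc_shift) simp
  also have "\<dots> = (\<Sum>i\<le>k. of_nat (k choose i) * a (Suc i) (k - i))
      + (a 0 (Suc k) + (\<Sum>i\<le>k. of_nat (k choose Suc i) * a (Suc i) (k - i)))"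
    by (simp add: algebra_simps sum.distrib)
  also have "a 0 (Suc k) + (\<Sum>i\<le>k. of_nat (k choose Suc i) * a (Suc i) (k - i))
      = (\<Sum>i\<le>Suc k. of_nat (k choose i) * a i (Suc k - i))"
    by (subst sum.atMost_Suc_shift) simp
  also have "\<dots> = (\<Sum>i\<le>k. of_nat (k choose i) * a i (Suc (k - i)))"
    by (simp add: Suc_diff_le)
  finally show ?thesis by (simp add: algebra_simps sum.distrib)
qed

lemma derivative_chain_mult:
  assumes E: "derivative_chain E" and F: "derivative_chain F"
  shows "derivative_chain (\<lambda>k x. \<Sum>i\<le>k. of_nat (k choose i) * (E i x * F (k - i) x))"
  unfolding derivative_chain_def
proof (intro allI)
  fix k and x :: real
  have "((\<lambda>x. \<Sum>i\<le>k. of_nat (k choose i) * (E i x * F (k - i) x)) has_vector_derivative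
      (\<Sum>i\<le>k. of_nat (k choose i) * (E (Suc i) x * F (k - i) x + E i x * F (Suc (k - i)) x))) (at x)"
    by (rule has_vector_derivative_sum, rule has_vector_derivative_mult_right)
       (use has_vector_derivative_mult[OF derivative_chainD[OF E] derivative_chainD[OF F]] in
         \<open>simp add: add.commute\<close>)
  then show "((\<lambda>x. \<Sum>i\<le>k. of_nat (k choose i) * (E i x * F (k - i) x)) has_vector_derivative
      (\<Sum>i\<le>Suc k. of_nat (Suc k choose i) * (E i x * F (Suc k - i) x))) (at x)"
    by (simp only: sum_choose_Leibniz[of k "\<lambda>i j. E i x * F j x"])
qed

lemma derivative_chain_affine:
  assumes F: "derivative_chain F"
  shows "derivative_chain (\<lambda>k x. of_real (a ^ k) * F k (a * x + b))"
  unfolding derivative_chain_def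
proof (intro allI)
  fix k and x :: real
  have "((\<lambda>x. a * x + b) has_vector_derivative a) (at x)"
    by (auto intro!: derivative_eq_intros simp flip: has_real_derivative_iff_has_vector_derivative)
  then have "(F k \<circ> (\<lambda>x. a * x + b) has_vector_derivative a *\<^sub>R F (Suc k) (a * x + b)) (at x)"
    by (rule vector_diff_chain_at) (rule derivative_chainD[OF F])
  from has_vector_derivative_mult_right[OF this, of "of_real (a ^ k)"]
  show "((\<lambda>x. of_real (a ^ k) * F k (a * x + b)) has_vector_derivative
     of_real (a ^ Suc k) * F (Suc k) (a * x + b)) (at x)"
    by (simp add: o_def scaleR_conv_of_real mult_ac)
qed

lemma derivative_chain_cis:
  "derivative_chain (\<lambda>k x. (\<i> * of_real d) ^ k * cis (d * x))"
  unfolding derivative_chain_def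
proof (intro allI)
  fix k and x :: real
  have "((\<lambda>x. cis (d * x)) has_vector_derivative \<i> * of_real d * cis (d * x)) (at x)"
  proof -
    have "((\<lambda>z. exp (\<i> * of_real d * z)) has_field_derivative
        \<i> * of_real d * exp (\<i> * of_real d * of_real x)) (at (of_real x))"
      by (auto intro!: derivative_eq_intros)
    from has_vector_derivative_real_field[OF this] show ?thesis
      by (simp add: cis_conv_exp mult_ac)
  qed
  from has_vector_derivative_mult_right[OF this, of "(\<i> * of_real d) ^ k"]
  show "((\<lambda>x. (\<i> * of_real d) ^ k * cis (d * x)) has_vector_derivative
     (\<i> * of_real d) ^ Suc k * cis (d * x)) (at x)"
    by (simp add: mult_ac)
qed

text \<open>
  The multi-index \<open>a\<close> selects a mixed partial derivative of \<open>x \<mapsto> \<Prod>\<^sub>i F i 0 (x\<^sub>i)\<close>. Products of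
  one-variable functions suffice as test functions: they contain an approximate identity, and
  the class is stable under translations and under multiplication by \<open>e\<^bsup>i d x\<^sub>k\<^esup>\<close>.
\<close>

definition tensor :: "('n::finite \<Rightarrow> nat \<Rightarrow> real \<Rightarrow> complex) \<Rightarrow> ('n \<Rightarrow> nat) \<Rightarrow> real ^ 'n \<Rightarrow> complex" where
  "tensor F a x = (\<Prod>i\<in>UNIV. F i (a i) (x $ i))"

lemma tensor_has_derivative:
  assumes "\<And>i. jet (F i)"
  shows "(tensor F a has_derivative (\<lambda>h. \<Sum>i\<in>UNIV. (h $ i) *\<^sub>R tensor F (a(i := Suc (a i))) x)) (at x)"
proof -
  have d: "((\<lambda>x. F i (a i) (x $ i)) has_derivative (\<lambda>h. (h $ i) *\<^sub>R F i (Suc (a i)) (x $ i))) (at x)" for i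
  proof -
    have "(F i (a i) has_derivative (\<lambda>h. h *\<^sub>R F i (Suc (a i)) (x $ i))) (at (x $ i))"
      using assms[of i] derivative_chainD by (auto simp: jet_def has_vector_derivative_def)
    then show ?thesis
      using has_derivative_compose[OF bounded_linear_imp_has_derivative[OF bounded_linear_vec_nth]]
      by blast
  qed
  have "((\<lambda>x. \<Prod>i\<in>UNIV. F i (a i) (x $ i)) has_derivative
      (\<lambda>h. \<Sum>i\<in>UNIV. (h $ i) *\<^sub>R F i (Suc (a i)) (x $ i) * (\<Prod>j\<in>UNIV - {i}. F j (a j) (x $ j)))) (at x)"
    by (rule has_derivative_prod) (rule d)
  moreover have "tensor F (a(i := Suc (a i))) x
      = F i (Suc (a i)) (x $ i) * (\<Prod>j\<in>UNIV - {i}. F j (a j) (x $ j))" for i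
  proof -
    have "tensor F (a(i := Suc (a i))) x = F i ((a(i := Suc (a i))) i) (x $ i)
        * (\<Prod>j\<in>UNIV - {i}. F j ((a(i := Suc (a i))) j) (x $ j))"
      unfolding tensor_def by (rule prod.remove) auto
    also have "(\<Prod>j\<in>UNIV - {i}. F j ((a(i := Suc (a i))) j) (x $ j)) = (\<Prod>j\<in>UNIV - {i}. F j (a j) (x $ j))"
      by (rule prod.cong) auto
    finally show ?thesis by (simp only: fun_upd_same)
  qed
  ultimately show ?thesis by (simp add: tensor_def[abs_def])
qed

lemma partial_deriv_tensor:
  assumes "\<And>i. jet (F i)"
  shows "partial_deriv j (tensor F a) = tensor F (a(j := Suc (a j)))"
proof
  fix x
  have "frechet_derivative (tensor F a) (at x)
      = (\<lambda>h. \<Sum>i\<in>UNIV. (h $ i) *\<^sub>R tensor F (a(i := Suc (a i))) x)"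
    using frechet_derivative_at[OF tensor_has_derivative[of F a x], OF assms] by simp
  then show "partial_deriv j (tensor F a) x = tensor F (a(j := Suc (a j))) x"
    by (simp add: partial_deriv_def axis_def if_distrib[of "\<lambda>c. c *\<^sub>R _"] cong: if_cong)
qed

lemma laplacian_tensor:
  assumes "\<And>i. jet (F i)"
  shows "laplacian (tensor F a) x = (\<Sum>j\<in>UNIV. tensor F (a(j := a j + 2)) x)"
  by (simp add: laplacian_def partial_deriv_tensor[OF assms])

lemma tensor_continuous:
  assumes "\<And>i. jet (F i)"
  shows "continuous_on A (tensor F a)"
  using tensor_has_derivative[of F, OF assms]
  by (meson continuous_at_imp_continuous_on has_derivative_continuous)

lemma tensor_support:
  assumes "\<And>i. jet (F i)"
  shows "\<exists>R. \<forall>a x. R < norm x \<longrightarrow> tensor F a x = 0"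
proof -
  have "\<forall>i. \<exists>R. \<forall>k x. R < \<bar>x\<bar> \<longrightarrow> F i k x = 0"
    using assms by (auto simp: jet_def)
  then obtain R where R: "\<And>i k x. R i < \<bar>x\<bar> \<Longrightarrow> F i k x = 0"
    by metis
  have "tensor F a x = 0" if "(\<Sum>i\<in>UNIV. R i) < norm x" for a x
  proof -
    have "\<exists>i. R i < \<bar>x $ i\<bar>"
    proof (rule ccontr)
      assume "\<not> ?thesis"
      then have "(\<Sum>i\<in>UNIV. \<bar>x $ i\<bar>) \<le> (\<Sum>i\<in>UNIV. R i)"
        by (intro sum_mono) (auto simp: not_less)
      with norm_le_l1_cart[of x] that show False by linarith
    qed
    then show ?thesis
      using R by (auto simp: tensor_def)
  qed
  then show ?thesis by blast
qed

lemma
  assumes F: "\<And>i. jet (F i)"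
  shows integrable_tensor: "integrable lborel (tensor F a)"
    and square_integrable_tensor: "square_integrable lborel (tensor F a)"
proof -
  obtain R where "\<And>x. R < norm x \<Longrightarrow> tensor F a x = 0"
    using tensor_support[of F] F by blast
  then show "integrable lborel (tensor F a)" "square_integrable lborel (tensor F a)"
    using continuous_compact_support[OF tensor_continuous[of F, OF F], of R a] by blast+
qed

lemma
  assumes F: "\<And>i. jet (F i)"
  shows square_integrable_laplacian_tensor: "square_integrable lborel (laplacian (tensor F a))"
    and integrable_laplacian_tensor: "integrable lborel (laplacian (tensor F a))"
proof -
  have "laplacian (tensor F a) = (\<lambda>x. \<Sum>j\<in>UNIV. tensor F (a(j := a j + 2)) x)"
    by (rule ext) (rule laplacian_tensor[OF F])
  then show "square_integrable lborel (laplacian (tensor F a))" "integrable lborel (laplacian (tensor F a))"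
    by (simp only:, intro square_integrable_sum square_integrable_tensor F)
       (simp only: \<open>laplacian (tensor F a) = _\<close>, intro Bochner_Integration.integrable_sum integrable_tensor F)
qed

lemma square_integrable_indicator_cball:
  "square_integrable lborel (\<lambda>x::'a::euclidean_space. indicator (cball a R) x)"
proof -
  have "integrable lborel (indicator (cball a R) :: 'a \<Rightarrow> real)"
    using emeasure_bounded_finite[OF bounded_cball, of a R]
    by (simp add: integrable_indicator_iff)
  moreover have "(cmod (indicator (cball a R) x))\<^sup>2 = indicator (cball a R) x" for x
    by (auto simp: indicator_def)
  moreover have "(\<lambda>x. indicator (cball a R) x :: complex) \<in> borel_measurable (lborel :: 'a measure)"
    by (intro borel_measurable_indicator) simp
  ultimately show ?thesis unfolding square_integrable_def by simp
qed

lemma test_function_tensor: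
  assumes F: "\<And>i. jet (F i)"
  shows "test_function (tensor F a)"
proof -
  have ex: "\<exists>b. foldr partial_deriv js (tensor F a) = tensor F b" for js
    by (induction js) (use partial_deriv_tensor[OF F] in fastforce)+
  have "smooth_fun (tensor F a)"
    unfolding smooth_fun_def
  proof (intro allI)
    fix js x
    obtain b where "foldr partial_deriv js (tensor F a) = tensor F b" using ex by blast
    then show "foldr partial_deriv js (tensor F a) differentiable (at x)"
      using tensor_has_derivative[of F b x, OF F] unfolding differentiable_def by auto
  qed
  moreover obtain R where "\<And>x. R < norm x \<Longrightarrow> tensor F a x = 0"
    using tensor_support[of F] F by blast
  then have "{x. tensor F a x \<noteq> 0} \<subseteq> cball 0 R"
    by (auto simp: not_less[symmetric])
  then have "bounded {x. tensor F a x \<noteq> 0}"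
    using bounded_subset bounded_cball by blast
  ultimately show ?thesis
    by (simp add: test_function_def compact_closure)
qed

lemma jet_translate:
  assumes "jet F" shows "jet (\<lambda>k x. F k (x + c))"
proof -
  obtain R where R: "\<And>k x. R < \<bar>x\<bar> \<Longrightarrow> F k x = 0" using assms by (auto simp: jet_def)
  have "F k (x + c) = 0" if "R + \<bar>c\<bar> < \<bar>x\<bar>" for k x
    using R[of "x + c" k] that by auto
  moreover have "derivative_chain (\<lambda>k x. F k (x + c))"
    using derivative_chain_affine[of F 1 c] assms by (simp add: jet_def)
  ultimately show ?thesis by (auto simp: jet_def)
qed

text \<open>
  The derivatives of \<open>x \<mapsto> e\<^bsup>i d x\<^esup> F 0 x\<close>.
\<close>

definition modulated :: "real \<Rightarrow> (nat \<Rightarrow> real \<Rightarrow> complex) \<Rightarrow> nat \<Rightarrow> real \<Rightarrow> complex" where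
  "modulated d F = (\<lambda>k x. \<Sum>i\<le>k. of_nat (k choose i) * ((\<i> * of_real d) ^ i * cis (d * x) * F (k - i) x))"

lemma jet_modulated:
  assumes "jet F" shows "jet (modulated d F)"
proof -
  obtain R where R: "\<And>k x. R < \<bar>x\<bar> \<Longrightarrow> F k x = 0" using assms by (auto simp: jet_def)
  have "modulated d F k x = 0" if "R < \<bar>x\<bar>" for k x
    using R that by (simp add: modulated_def)
  moreover have "derivative_chain (modulated d F)"
    using derivative_chain_mult[OF derivative_chain_cis[of d], of F] assms
    by (simp add: modulated_def jet_def)
  ultimately show ?thesis by (auto simp: jet_def)
qed

lemma modulated_0: "modulated d F 0 x = cis (d * x) * F 0 x"
  by (simp add: modulated_def)

lemma modulated_2: "modulated d F 2 x
   = cis (d * x) * (F 2 x + 2 * \<i> * of_real d * F 1 x - of_real (d\<^sup>2) * F 0 x)"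
  by (simp add: modulated_def numeral_2_eq_2 algebra_simps power2_eq_square)

section \<open>Smooth bumps\<close>

text \<open>
  All derivatives of \<open>e\<^bsup>-1/x\<^esup>\<close> on \<open>x > 0\<close> have the form \<open>p(1/x) e\<^bsup>-1/x\<^esup>\<close> with a polynomial \<open>p\<close>.
  Differentiating once more replaces \<open>p(y)\<close> by \<open>y\<^sup>2 (p(y) - p'(y))\<close>.
\<close>

fun flat_poly :: "nat \<Rightarrow> real poly" where
  "flat_poly 0 = 1"
| "flat_poly (Suc k) = monom 1 2 * (flat_poly k - pderiv (flat_poly k))"

text \<open>
  The \<open>k\<close>-th derivative of the smooth function that vanishes on the negative half line and is
  \<open>e\<^bsup>-1/x\<^esup>\<close> on the positive one.
\<close>

definition flat :: "nat \<Rightarrow> real \<Rightarrow> real" where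
  "flat k x = (if x \<le> 0 then 0 else poly (flat_poly k) (1 / x) * exp (- (1 / x)))"

lemma poly_times_power_div_exp_tendsto_0:
  fixes p :: "real poly"
  shows "((\<lambda>y. y ^ k * poly p y * exp (- y)) \<longlongrightarrow> 0) at_top"
proof (induction p arbitrary: k)
  case 0
  then show ?case by simp
next
  case (pCons a p)
  have "((\<lambda>y. a * (y ^ k / exp y) + y ^ Suc k * poly p y * exp (- y)) \<longlongrightarrow> a * 0 + 0) at_top"
    by (intro tendsto_intros tendsto_power_div_exp_0 pCons)
  then show ?case
    by (simp add: algebra_simps exp_minus divide_inverse)
qed

text \<open>
  Away from the origin this is the product rule. At the origin the difference quotient from the
  right is \<open>y p(y) e\<^bsup>-y\<^esup>\<close> with \<open>y = 1/h \<rightarrow> \<infinity>\<close>, and exponential decay beats the polynomial.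
\<close>

lemma flat_has_derivative:
  "(flat k has_field_derivative flat (Suc k) x) (at x)"
proof -
  consider "x < 0" | "x = 0" | "x > 0" by linarith
  then show ?thesis
  proof cases
    case 1
    have "((\<lambda>x. 0) has_field_derivative flat (Suc k) x) (at x)"
      using 1 by (simp add: flat_def)
    then show ?thesis
      by (rule has_field_derivative_transform_within_open[where S="{..<0}"])
         (use 1 in \<open>auto simp: flat_def\<close>)
  next
    case 3
    have "((\<lambda>x. poly (flat_poly k) (1 / x) * exp (- (1 / x))) has_field_derivative flat (Suc k) x) (at x)"
      using 3 by (auto intro!: derivative_eq_intros
          simp: flat_def field_simps power2_eq_square poly_monom)
    then show ?thesis
      by (rule has_field_derivative_transform_within_open[where S="{0<..}"])
         (use 3 in \<open>auto simp: flat_def\<close>)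
  next
    case 2
    have "((\<lambda>y::real. y ^ 1 * poly (flat_poly k) y * exp (- y)) \<longlongrightarrow> 0) at_top"
      by (rule poly_times_power_div_exp_tendsto_0)
    then have "((\<lambda>h. (1 / h) ^ 1 * poly (flat_poly k) (1 / h) * exp (- (1 / h))) \<longlongrightarrow> 0) (at_right 0)"
      by (rule filterlim_compose) (simp add: filterlim_inverse_at_top_right flip: inverse_eq_divide)
    then have "((\<lambda>h. flat k h / h) \<longlongrightarrow> 0) (at_right 0)"
      by (rule Lim_transform_eventually)
         (auto simp: eventually_at_filter flat_def field_simps)
    moreover have "((\<lambda>h. flat k h / h) \<longlongrightarrow> 0) (at_left 0)"
      by (rule Lim_transform_eventually[OF tendsto_const])
         (auto simp: eventually_at_filter flat_def)
    ultimately have "((\<lambda>h. flat k h / h) \<longlongrightarrow> 0) (at 0)"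
      by (simp add: filterlim_split_at)
    then show ?thesis
      using 2 by (simp add: DERIV_def flat_def)
  qed
qed

lemma derivative_chain_flat: "derivative_chain (\<lambda>k x. of_real (flat k x))"
  unfolding derivative_chain_def
  using flat_has_derivative
  by (auto intro!: has_vector_derivative_of_real simp: has_real_derivative_iff_has_vector_derivative)

text \<open>
  The Leibniz formula for \<open>flat 0 (e - x) * flat 0 (e + x)\<close>, an even function that is positive
  exactly on \<open>]-e, e[\<close>. The factors \<open>1 ^ _\<close> and \<open>1 * x\<close> are kept because this is literally what
  \<open>derivative_chain_mult\<close> and \<open>derivative_chain_affine\<close> produce.
\<close>

definition bump :: "real \<Rightarrow> nat \<Rightarrow> real \<Rightarrow> complex" where
  "bump e = (\<lambda>k x. \<Sum>i\<le>k. of_nat (k choose i) *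
     (of_real ((- 1) ^ i) * of_real (flat i (- 1 * x + e)) * (of_real (1 ^ (k - i)) * of_real (flat (k - i) (1 * x + e)))))"

lemma bump_eq_0:
  assumes "e < \<bar>x\<bar>" shows "bump e k x = 0"
proof -
  have "- 1 * x + e \<le> 0 \<or> 1 * x + e \<le> 0" using assms by auto
  then show ?thesis unfolding bump_def by (auto simp: flat_def)
qed

lemma jet_bump: "jet (bump e)"
proof -
  have "derivative_chain (bump e)"
    using derivative_chain_mult[OF derivative_chain_affine[OF derivative_chain_flat, of "- 1" e]
        derivative_chain_affine[OF derivative_chain_flat, of 1 e]]
    by (simp add: bump_def)
  then show ?thesis using bump_eq_0 by (auto simp: jet_def)
qed

lemma cnj_bump [simp]: "cnj (bump e k x) = bump e k x"
  by (simp add: bump_def)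

lemma bump_0: "bump e 0 x = of_real (flat 0 (e - x) * flat 0 (e + x))"
  by (simp add: bump_def add.commute)

text \<open>
  Derivatives of an even function are alternately even and odd, by uniqueness of derivatives.
  Evenness of the second derivative makes the Laplacian of the kernel even, which is what the
  conservation law rests on.
\<close>

lemma bump_even: "bump e k (- x) = (- 1) ^ k * bump e k x"
proof (induction k arbitrary: x)
  case 0
  then show ?case by (simp add: bump_0)
next
  case (Suc k)
  have chain: "derivative_chain (bump e)" using jet_bump by (simp add: jet_def)
  have "(uminus has_vector_derivative - 1) (at x)"
    by (auto intro!: derivative_eq_intros simp flip: has_real_derivative_iff_has_vector_derivative)
  then have "((\<lambda>x. bump e k (- x)) has_vector_derivative - bump e (Suc k) (- x)) (at x)"
    using vector_diff_chain_at[of uminus "- 1" x "bump e k" "bump e (Suc k) (- x)"]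
      derivative_chainD[OF chain, of k "- x"]
    by (simp add: o_def)
  moreover have "((\<lambda>x. bump e k (- x)) has_vector_derivative (- 1) ^ k * bump e (Suc k) x) (at x)"
    unfolding Suc by (intro has_vector_derivative_mult_right derivative_chainD chain)
  ultimately have "- bump e (Suc k) (- x) = (- 1) ^ k * bump e (Suc k) x"
    by (rule vector_derivative_unique_at)
  then have "bump e (Suc k) (- x) = - ((- 1) ^ k * bump e (Suc k) x)"
    by (metis minus_minus)
  then show ?case by simp
qed

text \<open>
  The same bump in every coordinate: the tensor product is a smooth approximate identity, up to
  normalisation, as \<open>e \<rightarrow> 0\<close>.
\<close>

definition bump_kernel :: "real \<Rightarrow> 'n::finite \<Rightarrow> nat \<Rightarrow> real \<Rightarrow> complex" where
  "bump_kernel e = (\<lambda>i. bump e)"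

lemma jet_bump_kernel: "jet (bump_kernel e i)"
  by (simp add: bump_kernel_def jet_bump)

lemma cnj_tensor_bump: "cnj (tensor (bump_kernel e) a x) = tensor (bump_kernel e) a x"
  by (simp add: tensor_def bump_kernel_def)

lemma tensor_bump_even:
  assumes "\<And>i. even (a i)"
  shows "tensor (bump_kernel e) a (- x) = tensor (bump_kernel e) a x"
  using assms by (simp add: tensor_def bump_kernel_def bump_even)

lemma tensor_bump_support:
  fixes x :: "real ^ 'n"
  assumes "real CARD('n) * e < norm x"
  shows "tensor (bump_kernel e) a x = 0"
proof -
  have "\<exists>i. e < \<bar>x $ i\<bar>"
  proof (rule ccontr)
    assume "\<not> ?thesis"
    then have "(\<Sum>i\<in>UNIV. \<bar>x $ i\<bar>) \<le> (\<Sum>i\<in>(UNIV::'n set). e)"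
      by (intro sum_mono) (auto simp: not_less)
    with norm_le_l1_cart[of x] assms show False by simp
  qed
  then show ?thesis
    using bump_eq_0 by (auto simp: tensor_def bump_kernel_def)
qed

lemma tensor_bump_cmod:
  "tensor (bump_kernel e) (\<lambda>_. 0) x = of_real (cmod (tensor (bump_kernel e) (\<lambda>_. 0) x))"
proof -
  have "0 \<le> flat 0 y" for y by (simp add: flat_def)
  then have "cmod (bump e 0 y) = flat 0 (e - y) * flat 0 (e + y)" for y
    by (simp add: bump_0 norm_mult)
  then show ?thesis
    by (simp add: tensor_def bump_kernel_def bump_0 flip: prod_norm)
qed

lemma integral_cmod_tensor_bump_pos:
  assumes "0 < e"
  shows "0 < (LINT x|lborel. cmod (tensor (bump_kernel e) (\<lambda>_. 0) (x :: real ^ 'n)))"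
proof -
  let ?k = "\<lambda>x :: real ^ 'n. cmod (tensor (bump_kernel e) (\<lambda>_. 0) x)"
  have cont: "continuous_on UNIV ?k"
    by (intro continuous_on_norm tensor_continuous jet_bump_kernel)
  have int: "integrable lborel ?k"
    by (intro integrable_norm integrable_tensor jet_bump_kernel)
  have pos: "?k 0 > 0"
    using assms by (simp add: tensor_def bump_kernel_def bump_0 flat_def)
  have "(LINT x|lborel. ?k x) \<noteq> 0"
  proof
    assume "(LINT x|lborel. ?k x) = 0"
    then have "AE x in lborel. ?k x = 0"
      using int by (subst (asm) integral_nonneg_eq_0_iff_AE) auto
    moreover have o: "open {x. ?k x \<noteq> 0}"
      using open_vimage[OF _ cont, of "- {0}"] by (auto simp: vimage_def)
    ultimately have "{x. ?k x \<noteq> 0} \<in> null_sets lborel"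
      using AE_iff_null_sets[of "{x. ?k x \<noteq> 0}" lborel] by simp
    then have "{x. ?k x \<noteq> 0} = {}"
      using o open_not_negligible negligible_iff_null_sets null_sets_completionI by blast
    with pos show False by auto
  qed
  moreover have "0 \<le> (LINT x|lborel. ?k x)" by simp
  ultimately show ?thesis by linarith
qed

section \<open>Correlations averaged over a kernel\<close>

lemma lborel_integral_reflect:
  fixes f :: "'a::euclidean_space \<Rightarrow> 'b::{banach, second_countable_topology}"
  assumes [measurable]: "f \<in> borel_measurable borel"
  shows "(LINT x|lborel. f (- x)) = (LINT x|lborel. f x)"
proof -
  have eq: "(lborel :: 'a measure) = distr lborel borel uminus"
    using lborel_affine[of "- 1" "0 :: 'a"] by (simp add: density_1)
  have "(LINT x|lborel. f x) = (LINT x|distr lborel borel uminus. f x)"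
    using eq by simp
  also have "\<dots> = (LINT x|lborel. f (- x))"
    by (subst integral_distr) auto
  finally show ?thesis by simp
qed

text \<open>
  This is \<open>\<integral>\<integral> f(z) g(y) k(y - z) dy dz\<close>. Writing it as an average over \<open>h = y - z\<close> of the
  correlation \<open>\<integral> f(z) g(z + h) dz\<close> makes the bound by the norms immediate from the
  Cauchy-Schwarz inequality, and exhibits the limit of \<open>k\<close> tending to a point mass as
  continuity of the correlation at \<open>0\<close>.
\<close>

definition pairing :: "('a::euclidean_space \<Rightarrow> complex) \<Rightarrow> ('a \<Rightarrow> complex) \<Rightarrow> ('a \<Rightarrow> complex) \<Rightarrow> complex" where
  "pairing k f g = (LINT h|lborel. k h * (LINT z|lborel. f z * g (h + z)))"

abbreviation L1norm :: "('a::euclidean_space \<Rightarrow> complex) \<Rightarrow> real" where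
  "L1norm k \<equiv> (LINT x|lborel. cmod (k x))"

lemma correlation_bound:
  fixes f g :: "'a::euclidean_space \<Rightarrow> complex"
  assumes "square_integrable lborel f" "square_integrable lborel g"
  shows "cmod (LINT z|lborel. f z * g (h + z)) \<le> L2norm lborel f * L2norm lborel g"
  using Cauchy_Schwarz_L2norm[OF assms(1) square_integrable_translate[OF assms(2), of h]]
    L2norm_translate[of g h] assms(2) by (simp add: square_integrable_def)

lemma correlation_measurable:
  fixes f g :: "'a::euclidean_space \<Rightarrow> complex"
  assumes "square_integrable lborel f" "square_integrable lborel g"
  shows "(\<lambda>h. LINT z|lborel. f z * g (h + z)) \<in> borel_measurable borel"
proof -
  have [measurable]: "f \<in> borel_measurable borel" "g \<in> borel_measurable borel"
    using assms by (auto simp: square_integrable_def)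
  show ?thesis by measurable
qed

lemma pairing_integrand:
  fixes f g k :: "'a::euclidean_space \<Rightarrow> complex"
  assumes f: "square_integrable lborel f" and g: "square_integrable lborel g" and k: "integrable lborel k"
  shows "integrable lborel (\<lambda>h. k h * (LINT z|lborel. f z * g (h + z)))"
proof (rule Bochner_Integration.integrable_bound)
  show "integrable lborel (\<lambda>h. (L2norm lborel f * L2norm lborel g) * cmod (k h))"
    using k by (intro integrable_mult_right integrable_norm)
  note [measurable] = correlation_measurable[OF f g] borel_measurable_integrable[OF k]
  show "(\<lambda>h. k h * (LINT z|lborel. f z * g (h + z))) \<in> borel_measurable lborel"
    by measurable
  show "AE h in lborel. norm (k h * (LINT z|lborel. f z * g (h + z)))
      \<le> norm ((L2norm lborel f * L2norm lborel g) * cmod (k h))"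
    using mult_right_mono[OF correlation_bound[OF f g] norm_ge_zero]
    by (intro AE_I2) (simp add: norm_mult mult.commute)
qed

lemma pairing_bound:
  fixes f g k :: "'a::euclidean_space \<Rightarrow> complex"
  assumes f: "square_integrable lborel f" and g: "square_integrable lborel g" and k: "integrable lborel k"
  shows "cmod (pairing k f g) \<le> L1norm k * (L2norm lborel f * L2norm lborel g)"
proof -
  have "cmod (pairing k f g) \<le> (LINT h|lborel. cmod (k h * (LINT z|lborel. f z * g (h + z))))"
    unfolding pairing_def by (rule integral_norm_bound)
  also have "\<dots> \<le> (LINT h|lborel. cmod (k h) * (L2norm lborel f * L2norm lborel g))"
  proof (rule integral_mono)
    show "integrable lborel (\<lambda>h. cmod (k h * (LINT z|lborel. f z * g (h + z))))"
      by (intro integrable_norm pairing_integrand f g k)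
    show "cmod (k h * (LINT z|lborel. f z * g (h + z))) \<le> cmod (k h) * (L2norm lborel f * L2norm lborel g)" for h
      using mult_left_mono[OF correlation_bound[OF f g] norm_ge_zero] by (simp add: norm_mult)
  qed (use k in auto)
  finally show ?thesis by simp
qed

lemma pairing_diff_right:
  fixes f g k :: "'a::euclidean_space \<Rightarrow> complex"
  assumes f: "square_integrable lborel f" and g: "square_integrable lborel g" "square_integrable lborel g'"
    and k: "integrable lborel k"
  shows "pairing k f (\<lambda>x. g x - g' x) = pairing k f g - pairing k f g'"
proof -
  have "(LINT z|lborel. f z * (g (h + z) - g' (h + z)))
      = (LINT z|lborel. f z * g (h + z)) - (LINT z|lborel. f z * g' (h + z))" for h
    unfolding right_diff_distrib
    by (intro Bochner_Integration.integral_diff integrable_mult_square_integrable f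
        square_integrable_translate g)
  then show ?thesis
    by (simp add: pairing_def right_diff_distrib Bochner_Integration.integral_diff pairing_integrand f g k)
qed

lemma pairing_swap:
  fixes f g k :: "'a::euclidean_space \<Rightarrow> complex"
  assumes f: "square_integrable lborel f" and g: "square_integrable lborel g" and k: "integrable lborel k"
    and even: "\<And>x. k (- x) = k x"
  shows "pairing k f g = pairing k g f"
proof -
  have [measurable]: "f \<in> borel_measurable borel" "g \<in> borel_measurable borel"
    using assms by (auto simp: square_integrable_def)
  have "pairing k f g = (LINT h|lborel. k (- h) * (LINT z|lborel. f z * g (- h + z)))"
    unfolding pairing_def
    by (subst lborel_integral_reflect[of "\<lambda>h. k h * (LINT z|lborel. f z * g (h + z))"])
       (use pairing_integrand[OF f g k] in auto)
  also have "\<dots> = (LINT h|lborel. k h * (LINT z|lborel. g z * f (h + z)))"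
  proof (intro Bochner_Integration.integral_cong refl)
    fix h
    show "k (- h) * (LINT z|lborel. f z * g (- h + z)) = k h * (LINT z|lborel. g z * f (h + z))"
      using lborel_integral_translate[of "\<lambda>z. f z * g (- h + z)" h] by (simp add: even mult.commute)
  qed
  finally show ?thesis by (simp add: pairing_def)
qed

lemma pairing_cnj:
  assumes "\<And>x. cnj (k x) = k x"
  shows "cnj (pairing k f g) = pairing k (\<lambda>x. cnj (f x)) (\<lambda>x. cnj (g x))"
  unfolding pairing_def
  by (simp del: Bochner_Integration.integral_cnj add: Bochner_Integration.integral_cnj[symmetric] assms)

text \<open>
  The other order of integration: for fixed \<open>z\<close> the inner integral tests \<open>g\<close> against the
  translate \<open>k(\<cdot> - z)\<close>, which is how the Schroedinger equation enters.
\<close>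

lemma pairing_Fubini:
  fixes f g k :: "'a::euclidean_space \<Rightarrow> complex"
  assumes f: "square_integrable lborel f" and g: "square_integrable lborel g" and k: "integrable lborel k"
  shows "integrable lborel (\<lambda>z. f z * (LINT y|lborel. g y * k (y - z)))"
    and "pairing k f g = (LINT z|lborel. f z * (LINT y|lborel. g y * k (y - z)))"
proof -
  have [measurable]: "f \<in> borel_measurable borel" "g \<in> borel_measurable borel" "k \<in> borel_measurable borel"
    using assms by (auto simp: square_integrable_def)
  have inner: "integrable lborel (\<lambda>z. f z * g (h + z))" for h
    by (intro integrable_mult_square_integrable f square_integrable_translate g)
  have "integrable lborel (\<lambda>h. complex_of_real (cmod (k h)) * (LINT z|lborel. of_real (cmod (f z)) * of_real (cmod (g (h + z)))))"
    using assms by (intro pairing_integrand) (auto simp: square_integrable_def)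
  then have "integrable lborel (\<lambda>h. cmod (k h) * (LINT z|lborel. cmod (f z) * cmod (g (h + z))))"
    by (simp only: of_real_mult[symmetric] integral_complex_of_real complex_of_real_integrable_eq)
  then have int: "integrable (lborel \<Otimes>\<^sub>M lborel) (\<lambda>(h, z). k h * (f z * g (h + z)))"
    using inner by (intro lborel_pair.Fubini_integrable) (auto simp: norm_mult)
  have eq: "f z * (LINT y|lborel. g y * k (y - z)) = (LINT h|lborel. k h * (f z * g (h + z)))" for z
  proof -
    have "(LINT y|lborel. g y * k (y - z)) = (LINT h|lborel. k h * g (h + z))"
      using lborel_integral_translate[of "\<lambda>y. g y * k (y - z)" z] by (simp add: mult.commute add.commute)
    then show ?thesis by (simp add: mult.left_commute)
  qed
  show "integrable lborel (\<lambda>z. f z * (LINT y|lborel. g y * k (y - z)))"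
    unfolding eq using lborel_pair.integrable_snd[of "\<lambda>h z. k h * (f z * g (h + z))"] int by simp
  show "pairing k f g = (LINT z|lborel. f z * (LINT y|lborel. g y * k (y - z)))"
    unfolding eq pairing_def
    using lborel_pair.Fubini_integral[of "\<lambda>h z. k h * (f z * g (h + z))"] int
    by simp
qed

section \<open>Weak solutions and their smoothed mass\<close>

text \<open>
  Solutions as Borel functions, tested against tensor products only. Here \<open>v t\<close> is the state at
  time \<open>t\<close>, and the time derivative is solved for: \<open>\<partial>\<^sub>t \<langle>v, \<phi>\<rangle> = i \<langle>v, \<Delta>\<phi>\<rangle>\<close>.
\<close>

definition weak_solution :: "(real \<Rightarrow> real ^ 'n \<Rightarrow> complex) \<Rightarrow> bool" where
  "weak_solution v \<longleftrightarrow>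
     (\<forall>t\<ge>0. square_integrable lborel (v t)) \<and>
     (\<forall>s\<ge>0. ((\<lambda>t. L2norm lborel (\<lambda>x. v t x - v s x)) \<longlongrightarrow> 0) (at s within {0..})) \<and>
     (\<forall>F. (\<forall>i. jet (F i)) \<longrightarrow> (\<forall>t>0.
        ((\<lambda>s. LINT x|lborel. v s x * tensor F (\<lambda>_. 0) x) has_vector_derivative
          \<i> * (LINT x|lborel. v t x * laplacian (tensor F (\<lambda>_. 0)) x)) (at t)))"

lemma weak_solution_near:
  assumes v: "weak_solution v" and s: "0 \<le> s" and e: "0 < e"
  obtains d where "0 < d" "\<And>t. 0 \<le> t \<Longrightarrow> \<bar>t - s\<bar> < d \<Longrightarrow> L2norm lborel (\<lambda>x. v t x - v s x) < e"
proof -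
  have "((\<lambda>t. L2norm lborel (\<lambda>x. v t x - v s x)) \<longlongrightarrow> 0) (at s within {0..})"
    using v s by (auto simp: weak_solution_def)
  then obtain d where d: "0 < d"
    "\<And>t. t \<ge> 0 \<Longrightarrow> t \<noteq> s \<Longrightarrow> \<bar>t - s\<bar> < d \<Longrightarrow> L2norm lborel (\<lambda>x. v t x - v s x) < e"
    using e by (auto simp: tendsto_iff eventually_at dist_real_def)
  have "L2norm lborel (\<lambda>x. v t x - v s x) < e" if "0 \<le> t" "\<bar>t - s\<bar> < d" for t
    using d(2)[of t] that e by (cases "t = s") auto
  with d(1) that show ?thesis by blast
qed

lemma real_linearization:
  fixes g :: "real \<Rightarrow> complex"
  assumes d: "\<And>t. \<bar>t - s\<bar> < d \<Longrightarrow> (g has_vector_derivative g' t) (at t)"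
    and B: "\<And>t. \<bar>t - s\<bar> < d \<Longrightarrow> cmod (g' t - g' s) \<le> B" and t: "\<bar>t - s\<bar> < d"
  shows "cmod (g t - g s - (t - s) *\<^sub>R g' s) \<le> \<bar>t - s\<bar> * B"
proof -
  have "norm (g t - g s - (t - s) *\<^sub>R g' s) \<le> norm (t - s) * B"
  proof (rule vector_differentiable_bound_linearization)
    show "closed_segment s t \<subseteq> ball s d"
      using t by (intro closed_segment_subset) (auto simp: dist_real_def)
  qed (use assms in \<open>auto simp: dist_real_def abs_minus_commute intro: has_vector_derivative_at_within\<close>)
  then show ?thesis by simp
qed

text \<open>
  Dominated convergence in the outer integral of the Fubini form. This passes from integrable to
  general square-integrable \<open>f\<close>.
\<close>

lemma pairing_truncation_tendsto:
  fixes f g k :: "real ^ 'n \<Rightarrow> complex"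
  assumes f: "square_integrable lborel f" and g: "square_integrable lborel g" and k: "integrable lborel k"
  shows "(\<lambda>n. pairing k (\<lambda>x. indicator (cball 0 (real n)) x * f x) g) \<longlonglongrightarrow> pairing k f g"
proof -
  define A where "A = (\<lambda>z. LINT y|lborel. g y * k (y - z))"
  have int: "integrable lborel (\<lambda>z. f z * A z)"
    unfolding A_def by (rule pairing_Fubini(1)[OF f g k])
  have m: "(\<lambda>z. f z * A z) \<in> borel_measurable lborel"
    using int by (rule borel_measurable_integrable)
  have "(\<lambda>n. LINT z|lborel. indicator (cball 0 (real n)) z * (f z * A z)) \<longlonglongrightarrow> (LINT z|lborel. f z * A z)"
  proof (rule integral_dominated_convergence[where w="\<lambda>z. cmod (f z * A z)"])
    show "integrable lborel (\<lambda>z. cmod (f z * A z))"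
      using int by (rule integrable_norm)
    show "(\<lambda>z. indicator (cball 0 (real n)) z * (f z * A z)) \<in> borel_measurable lborel" for n
      by (intro borel_measurable_times borel_measurable_indicator m) simp
    show "AE z in lborel. (\<lambda>n. indicator (cball 0 (real n)) z * (f z * A z)) \<longlonglongrightarrow> f z * A z"
    proof (intro AE_I2 tendsto_eventually)
      fix z :: "real ^ 'n"
      obtain N :: nat where "norm z \<le> real N" using real_arch_simple by blast
      then show "\<forall>\<^sub>F n in sequentially. indicator (cball 0 (real n)) z * (f z * A z) = f z * A z"
        by (intro eventually_sequentiallyI[of N]) (auto simp: indicator_def)
    qed
  qed (use m in \<open>auto simp: indicator_def\<close>)
  moreover have "pairing k (\<lambda>x. indicator (cball 0 (real n)) x * f x) g
      = (LINT z|lborel. indicator (cball 0 (real n)) z * (f z * A z))" for n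
    using pairing_Fubini(2)[OF square_integrable_indicator[OF f] g k, of "cball 0 (real n)"]
    by (simp add: A_def mult.assoc)
  ultimately show ?thesis
    using pairing_Fubini(2)[OF f g k] by (simp add: A_def)
qed

text \<open>
  \<open>L\<close> stands for \<open>\<Delta>K\<close>; the two kernels are linked only through the equation that \<open>v\<close> satisfies
  when tested against their translates.
\<close>

locale conserved_kernel =
  fixes v :: "real \<Rightarrow> real ^ 'n \<Rightarrow> complex" and K L :: "real ^ 'n \<Rightarrow> complex"
  assumes v: "weak_solution v"
    and K: "integrable lborel K" "square_integrable lborel K" "\<And>x. K (- x) = K x" "\<And>x. cnj (K x) = K x"
    and L: "integrable lborel L" "square_integrable lborel L" "\<And>x. L (- x) = L x" "\<And>x. cnj (L x) = L x"
    and deriv: "\<And>t z. 0 < t \<Longrightarrow> ((\<lambda>s. LINT y|lborel. v s y * K (y - z)) has_vector_derivative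
        \<i> * (LINT y|lborel. v t y * L (y - z))) (at t)"
begin

lemma square_integrable_at: "0 \<le> t \<Longrightarrow> square_integrable lborel (v t)"
  using v by (simp add: weak_solution_def)

text \<open>
  The error of the first-order expansion in time of \<open>\<langle>v t, K(\<cdot> - z)\<rangle>\<close> is controlled by the
  oscillation of \<open>v\<close> in \<open>L\<^sup>2\<close>, hence uniformly in \<open>z\<close>.
\<close>

lemma pointwise_linearization:
  assumes s: "0 < s" and d: "\<And>t. \<bar>t - s\<bar> < d \<Longrightarrow> 0 < t \<and> L2norm lborel (\<lambda>x. v t x - v s x) \<le> e"
    and t: "\<bar>t - s\<bar> < d"
  shows "cmod ((LINT y|lborel. v t y * K (y - z)) - (LINT y|lborel. v s y * K (y - z))
      - (t - s) *\<^sub>R (\<i> * (LINT y|lborel. v s y * L (y - z)))) \<le> \<bar>t - s\<bar> * (e * L2norm lborel L)"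
proof (rule real_linearization[where d=d and g' = "\<lambda>t. \<i> * (LINT y|lborel. v t y * L (y - z))"])
  fix \<tau> assume \<tau>: "\<bar>\<tau> - s\<bar> < d"
  then show "((\<lambda>t. LINT y|lborel. v t y * K (y - z)) has_vector_derivative
      \<i> * (LINT y|lborel. v \<tau> y * L (y - z))) (at \<tau>)"
    using d deriv by blast
  have \<tau>0: "0 < \<tau>" using d \<tau> by blast
  have Lz: "square_integrable lborel (\<lambda>y. L (y - z))"
    using square_integrable_translate[OF L(2), of "- z"] by simp
  have Lz': "L2norm lborel (\<lambda>y. L (y - z)) = L2norm lborel L"
    using L2norm_translate[of L "- z"] L(2) by (simp add: square_integrable_def)
  have "\<i> * (LINT y|lborel. v \<tau> y * L (y - z)) - \<i> * (LINT y|lborel. v s y * L (y - z))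
      = \<i> * (LINT y|lborel. (v \<tau> y - v s y) * L (y - z))"
    unfolding left_diff_distrib
    by (subst Bochner_Integration.integral_diff)
       (use square_integrable_at[of \<tau>] square_integrable_at[of s] \<tau>0 s Lz in \<open>auto intro!: integrable_mult_square_integrable simp: right_diff_distrib\<close>)
  also have "cmod \<dots> \<le> L2norm lborel (\<lambda>y. v \<tau> y - v s y) * L2norm lborel L"
    using Cauchy_Schwarz_L2norm[OF square_integrable_diff[OF square_integrable_at[of \<tau>] square_integrable_at[of s]] Lz] Lz' \<tau>0 s
    by (simp add: norm_mult)
  also have "\<dots> \<le> e * L2norm lborel L"
    using d[OF \<tau>] by (intro mult_right_mono) auto
  finally show "cmod (\<i> * (LINT y|lborel. v \<tau> y * L (y - z)) - \<i> * (LINT y|lborel. v s y * L (y - z)))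
      \<le> e * L2norm lborel L" .
qed (rule t)

text \<open>
  For integrable \<open>f\<close> the expansion that is uniform in \<open>z\<close> can be integrated against \<open>f\<close>. The
  resulting error bound contains the \<open>L\<^sup>1\<close> norm of \<open>f\<close>, which is useless for the truncations of an
  \<open>L\<^sup>2\<close> function; it serves only to establish differentiability.
\<close>

lemma pairing_has_derivative_integrable:
  assumes s: "0 < s" and f: "square_integrable lborel f" "integrable lborel f"
  shows "((\<lambda>t. pairing K f (v t)) has_vector_derivative \<i> * pairing L f (v s)) (at s)"
  unfolding has_vector_derivative_def has_derivative_at_alt
proof (intro conjI allI impI)
  show "bounded_linear (\<lambda>h. h *\<^sub>R (\<i> * pairing L f (v s)))"
    by (rule bounded_linear_scaleR_left)
  fix e :: real assume e: "0 < e"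
  define c where "c = L2norm lborel L * L1norm f"
  have c: "0 \<le> c" by (simp add: c_def)
  define e' where "e' = e / (c + 1)"
  have e': "0 < e'" "e' * c \<le> e"
    using e c by (auto simp: e'_def field_simps)
  obtain d where d: "0 < d" "\<And>t. 0 \<le> t \<Longrightarrow> \<bar>t - s\<bar> < d \<Longrightarrow> L2norm lborel (\<lambda>x. v t x - v s x) < e'"
    using weak_solution_near[OF v, of s e'] s e' by auto
  define d' where "d' = min d s"
  have d': "0 < d'" "\<And>t. \<bar>t - s\<bar> < d' \<Longrightarrow> 0 < t \<and> L2norm lborel (\<lambda>x. v t x - v s x) \<le> e'"
    using d s by (auto simp: d'_def intro!: less_imp_le[OF d(2)])
  have "norm (pairing K f (v t) - pairing K f (v s) - (t - s) *\<^sub>R (\<i> * pairing L f (v s)))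
      \<le> e * norm (t - s)" if t: "norm (t - s) < d'" for t
  proof -
    have t0: "0 < t" using d'(2)[of t] t by simp
    define A B where "A = (\<lambda>t z. LINT y|lborel. v t y * K (y - z))"
      and "B = (\<lambda>z. LINT y|lborel. v s y * L (y - z))"
    have int: "integrable lborel (\<lambda>z. f z * A t z)" "integrable lborel (\<lambda>z. f z * A s z)"
      "integrable lborel (\<lambda>z. f z * B z)"
      unfolding A_def B_def
      using pairing_Fubini(1)[OF f(1) square_integrable_at[of t] K(1)] pairing_Fubini(1)[OF f(1) square_integrable_at[of s] K(1)]
        pairing_Fubini(1)[OF f(1) square_integrable_at[of s] L(1)] t0 s by auto
    have eqs: "pairing K f (v t) = (LINT z|lborel. f z * A t z)" "pairing K f (v s) = (LINT z|lborel. f z * A s z)"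
      "pairing L f (v s) = (LINT z|lborel. f z * B z)"
      unfolding A_def B_def
      using pairing_Fubini(2)[OF f(1) square_integrable_at[of t] K(1)] pairing_Fubini(2)[OF f(1) square_integrable_at[of s] K(1)]
        pairing_Fubini(2)[OF f(1) square_integrable_at[of s] L(1)] t0 s by auto
    have int': "integrable lborel (\<lambda>z. f z * A t z - f z * A s z - (t - s) *\<^sub>R (\<i> * (f z * B z)))"
      using int by auto
    have "pairing K f (v t) - pairing K f (v s) - (t - s) *\<^sub>R (\<i> * pairing L f (v s))
        = (LINT z|lborel. f z * A t z - f z * A s z - (t - s) *\<^sub>R (\<i> * (f z * B z)))"
      unfolding eqs using int by simp
    also have "cmod \<dots> \<le> (LINT z|lborel. cmod (f z * A t z - f z * A s z - (t - s) *\<^sub>R (\<i> * (f z * B z))))"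
      by (rule integral_norm_bound)
    also have "\<dots> \<le> (LINT z|lborel. cmod (f z) * (\<bar>t - s\<bar> * (e' * L2norm lborel L)))"
    proof (rule integral_mono)
      fix z
      have "f z * A t z - f z * A s z - (t - s) *\<^sub>R (\<i> * (f z * B z))
          = f z * (A t z - A s z - (t - s) *\<^sub>R (\<i> * B z))"
        by (simp add: algebra_simps)
      also have "cmod \<dots> \<le> cmod (f z) * (\<bar>t - s\<bar> * (e' * L2norm lborel L))"
        unfolding norm_mult A_def B_def using t d' s
        by (intro mult_left_mono pointwise_linearization[where d=d']) auto
      finally show "cmod (f z * A t z - f z * A s z - (t - s) *\<^sub>R (\<i> * (f z * B z))) \<le> \<dots>" .
    qed (use int' f(2) in auto)
    also have "\<dots> = \<bar>t - s\<bar> * (e' * c)"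
      by (simp add: c_def)
    also have "\<dots> \<le> \<bar>t - s\<bar> * e"
      using e' by (intro mult_left_mono) auto
    finally show ?thesis by (simp add: mult.commute)
  qed
  with d'(1) show "\<exists>d>0. \<forall>t. norm (t - s) < d \<longrightarrow>
      norm (pairing K f (v t) - pairing K f (v s) - (t - s) *\<^sub>R (\<i> * pairing L f (v s))) \<le> e * norm (t - s)"
    by blast
qed

text \<open>
  Once differentiability is known, the mean value inequality gives an error bound in terms of
  the \<open>L\<^sup>2\<close> norm of \<open>f\<close>, because the derivative \<open>i pairing L f (v t)\<close> depends continuously on
  \<open>v t\<close> with a constant of that kind.
\<close>

lemma pairing_linearization_integrable:
  assumes s: "0 < s" and f: "square_integrable lborel f" "integrable lborel f"
    and d: "\<And>t. \<bar>t - s\<bar> < d \<Longrightarrow> 0 < t \<and> L2norm lborel (\<lambda>x. v t x - v s x) \<le> e"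
    and t: "\<bar>t - s\<bar> < d"
  shows "cmod (pairing K f (v t) - pairing K f (v s) - (t - s) *\<^sub>R (\<i> * pairing L f (v s)))
      \<le> \<bar>t - s\<bar> * (L1norm L * (L2norm lborel f * e))"
proof (rule real_linearization[where d=d and g' = "\<lambda>t. \<i> * pairing L f (v t)"])
  fix \<tau> assume \<tau>: "\<bar>\<tau> - s\<bar> < d"
  then show "((\<lambda>t. pairing K f (v t)) has_vector_derivative \<i> * pairing L f (v \<tau>)) (at \<tau>)"
    using d pairing_has_derivative_integrable f by blast
  have \<tau>0: "0 < \<tau>" using d \<tau> by blast
  have "\<i> * pairing L f (v \<tau>) - \<i> * pairing L f (v s) = \<i> * pairing L f (\<lambda>x. v \<tau> x - v s x)"
    using pairing_diff_right[OF f(1) square_integrable_at[of \<tau>] square_integrable_at[of s] L(1)] \<tau>0 s by (simp add: right_diff_distrib)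
  also have "cmod \<dots> \<le> L1norm L * (L2norm lborel f * L2norm lborel (\<lambda>x. v \<tau> x - v s x))"
    using pairing_bound[OF f(1) square_integrable_diff[OF square_integrable_at[of \<tau>] square_integrable_at[of s]] L(1)] \<tau>0 s
    by (simp add: norm_mult)
  also have "\<dots> \<le> L1norm L * (L2norm lborel f * e)"
    using d[OF \<tau>] by (intro mult_left_mono) auto
  finally show "cmod (\<i> * pairing L f (v \<tau>) - \<i> * pairing L f (v s)) \<le> L1norm L * (L2norm lborel f * e)" .
qed (rule t)

text \<open>
  The bound depends on \<open>f\<close> only through its \<open>L\<^sup>2\<close> norm, so it survives the removal of the
  truncation. It is uniform for \<open>f\<close> in bounded sets, and so \<open>f\<close> may move with time.
\<close>

lemma pairing_linearization:
  assumes s: "0 < s" and f: "square_integrable lborel f"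
    and d: "\<And>t. \<bar>t - s\<bar> < d \<Longrightarrow> 0 < t \<and> L2norm lborel (\<lambda>x. v t x - v s x) \<le> e"
    and t: "\<bar>t - s\<bar> < d"
  shows "cmod (pairing K f (v t) - pairing K f (v s) - (t - s) *\<^sub>R (\<i> * pairing L f (v s)))
      \<le> \<bar>t - s\<bar> * (L1norm L * (L2norm lborel f * e))"
proof -
  have t0: "0 < t" using d t by blast
  have e0: "0 \<le> e" using d[OF t] L2norm_nonneg order_trans by blast
  define fn where "fn = (\<lambda>n x. indicator (cball 0 (real n)) x * f x)"
  have fn: "square_integrable lborel (fn n)" for n
    unfolding fn_def by (intro square_integrable_indicator f) auto
  have fn1: "integrable lborel (fn n)" for n
    unfolding fn_def by (intro integrable_mult_square_integrable f square_integrable_indicator_cball)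
  have "L2norm lborel (fn n) \<le> 1 * L2norm lborel f" for n
    by (rule L2norm_dominated[OF f])
       (use fn[of n] in \<open>auto simp: fn_def square_integrable_def indicator_def\<close>)
  then have "\<bar>t - s\<bar> * (L1norm L * (L2norm lborel (fn n) * e))
      \<le> \<bar>t - s\<bar> * (L1norm L * (L2norm lborel f * e))" for n
    using e0 by (intro mult_left_mono mult_right_mono) auto
  then have le: "cmod (pairing K (fn n) (v t) - pairing K (fn n) (v s) - (t - s) *\<^sub>R (\<i> * pairing L (fn n) (v s)))
      \<le> \<bar>t - s\<bar> * (L1norm L * (L2norm lborel f * e))" for n
    using pairing_linearization_integrable[OF s fn fn1 d t, of n] order_trans by blast
  have "(\<lambda>n. cmod (pairing K (fn n) (v t) - pairing K (fn n) (v s) - (t - s) *\<^sub>R (\<i> * pairing L (fn n) (v s))))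
      \<longlonglongrightarrow> cmod (pairing K f (v t) - pairing K f (v s) - (t - s) *\<^sub>R (\<i> * pairing L f (v s)))"
    unfolding fn_def using t0 s
    by (intro tendsto_intros pairing_truncation_tendsto f square_integrable_at K L) auto
  then show ?thesis
    by (rule LIMSEQ_le_const2) (use le in blast)
qed

lemma pairing_cnj_real:
  assumes "square_integrable lborel f"
  shows "cnj (pairing L (\<lambda>x. cnj (f x)) f) = pairing L (\<lambda>x. cnj (f x)) f"
proof -
  have "cnj (pairing L (\<lambda>x. cnj (f x)) f) = pairing L f (\<lambda>x. cnj (f x))"
    using pairing_cnj[of L "\<lambda>x. cnj (f x)" f, OF L(4)] by simp
  also have "\<dots> = pairing L (\<lambda>x. cnj (f x)) f"
    by (rule pairing_swap[OF assms square_integrable_cnj[OF assms] L(1) L(3)])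
  finally show ?thesis .
qed

lemma pairing_sub_cnj_left:
  assumes f: "square_integrable lborel f" and g: "square_integrable lborel g" and h: "square_integrable lborel h"
    and k: "integrable lborel k" "\<And>x. k (- x) = k x" "\<And>x. cnj (k x) = k x"
  shows "pairing k (\<lambda>x. cnj (f x)) h - pairing k (\<lambda>x. cnj (g x)) h
    = cnj (pairing k (\<lambda>x. cnj (h x)) f - pairing k (\<lambda>x. cnj (h x)) g)"
proof -
  have "pairing k (\<lambda>x. cnj (f x)) h = cnj (pairing k (\<lambda>x. cnj (h x)) f)"
    if "square_integrable lborel f" for f
    using pairing_cnj[of k "\<lambda>x. cnj (h x)" f, OF k(3)]
      pairing_swap[OF h square_integrable_cnj[OF that] k(1) k(2)] by simp
  then show ?thesis using f g by simp
qed

text \<open>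
  Formally \<open>\<integral>\<integral> cnj (v(z)) v(y) K(y - z) dy dz\<close>. It is conserved because \<open>\<Delta>\<^sub>y K(y - z) = \<Delta>\<^sub>z K(y - z)\<close>,
  so that the contributions \<open>i \<Delta>\<^sub>y\<close> of \<open>v\<close> and \<open>- i \<Delta>\<^sub>z\<close> of its conjugate cancel. As \<open>K\<close> tends to
  a point mass it becomes the mass.
\<close>

definition smoothed_mass :: "real \<Rightarrow> complex" where
  "smoothed_mass t = pairing K (\<lambda>x. cnj (v t x)) (v t)"

lemma smoothed_mass_continuous: "continuous_on {0..} smoothed_mass"
  unfolding continuous_on_iff
proof (intro ballI allI impI)
  fix s e :: real assume s: "s \<in> {0..}" and e: "0 < e"
  define c where "c = L1norm K * (2 * L2norm lborel (v s) + 1)"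
  have c: "0 \<le> c" by (simp add: c_def)
  define e' where "e' = min 1 (e / (c + 1))"
  have e': "0 < e'" "e' \<le> 1" "e' * c < e"
  proof -
    show "0 < e'" "e' \<le> 1" using e c by (auto simp: e'_def)
    have "e' * c \<le> e / (c + 1) * c" using c by (intro mult_right_mono) (auto simp: e'_def)
    also have "\<dots> < e" using e c by (simp add: field_simps)
    finally show "e' * c < e" .
  qed
  obtain d where d: "0 < d" "\<And>t. 0 \<le> t \<Longrightarrow> \<bar>t - s\<bar> < d \<Longrightarrow> L2norm lborel (\<lambda>x. v t x - v s x) < e'"
    using weak_solution_near[OF v, of s e'] s e' by auto
  have "cmod (smoothed_mass t - smoothed_mass s) < e" if t: "0 \<le> t" "\<bar>t - s\<bar> < d" for t
  proof -
    note [simp] = square_integrable_at[OF t(1)] square_integrable_at[of s]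
    have s0: "0 \<le> s" using s by simp
    define w where "w = (\<lambda>x. v t x - v s x)"
    have w: "square_integrable lborel w" "L2norm lborel w < e'"
      using d(2)[OF t] s0 by (auto simp: w_def intro: square_integrable_diff)
    have nt: "L2norm lborel (v t) \<le> L2norm lborel (v s) + 1"
      using L2norm_diff_diff[of lborel "v t" "v s"] w(2) e'(2) s0 by (simp add: w_def)
    have "smoothed_mass t - smoothed_mass s = (pairing K (\<lambda>x. cnj (v t x)) (v t) - pairing K (\<lambda>x. cnj (v s x)) (v t))
        + (pairing K (\<lambda>x. cnj (v s x)) (v t) - pairing K (\<lambda>x. cnj (v s x)) (v s))"
      by (simp add: smoothed_mass_def)
    also have "\<dots> = cnj (pairing K (\<lambda>x. cnj (v t x)) w) + pairing K (\<lambda>x. cnj (v s x)) w"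
      unfolding w_def using s0 pairing_sub_cnj_left[OF square_integrable_at[OF t(1)] square_integrable_at[OF s0] square_integrable_at[OF t(1)] K(1,3,4)]
        pairing_diff_right[OF square_integrable_cnj[OF square_integrable_at[OF t(1)]] square_integrable_at[OF t(1)] square_integrable_at[OF s0] K(1)]
        pairing_diff_right[OF square_integrable_cnj[OF square_integrable_at[OF s0]] square_integrable_at[OF t(1)] square_integrable_at[OF s0] K(1)]
      by simp
    also have "cmod \<dots> \<le> L1norm K * (L2norm lborel (v t) * L2norm lborel w)
        + L1norm K * (L2norm lborel (v s) * L2norm lborel w)"
      using pairing_bound[OF square_integrable_cnj[of lborel "v t"] w(1) K(1)]
        pairing_bound[OF square_integrable_cnj[of lborel "v s"] w(1) K(1)] s0
      by (intro norm_triangle_le) (simp add: L2norm_cnj)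
    also have "\<dots> = L1norm K * (L2norm lborel (v t) + L2norm lborel (v s)) * L2norm lborel w"
      by (simp add: algebra_simps)
    also have "\<dots> \<le> c * e'"
      unfolding c_def using nt w(2) by (intro mult_mono mult_left_mono) auto
    also have "\<dots> < e" using e' by (simp add: mult.commute)
    finally show ?thesis .
  qed
  then show "\<exists>d>0. \<forall>t\<in>{0..}. dist t s < d \<longrightarrow> dist (smoothed_mass t) (smoothed_mass s) < e"
    using d(1) by (auto simp: dist_real_def dist_complex_def)
qed

text \<open>
  With \<open>f = cnj (v s)\<close> and \<open>g = cnj (v t)\<close> the increment splits into one in the second argument,
  with \<open>g\<close> fixed, and one in the first, with \<open>v s\<close> fixed. By the symmetry of \<open>K\<close> the latter is the
  conjugate of an increment in the second argument. The two linear terms are \<open>\<plusminus> i\<close> times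
  numbers that agree up to \<open>o(1)\<close>, since \<open>pairing L f (v s)\<close> is real.
\<close>

lemma smoothed_mass_has_derivative_0:
  assumes s: "0 < s"
  shows "(smoothed_mass has_derivative (\<lambda>h. 0)) (at s)"
  unfolding has_derivative_at_alt
proof (intro conjI allI impI)
  show "bounded_linear (\<lambda>h::real. 0 :: complex)" by simp
  fix e :: real assume e: "0 < e"
  define c where "c = L1norm L * (3 * L2norm lborel (v s) + 1)"
  have c: "0 \<le> c" by (simp add: c_def)
  define e' where "e' = min 1 (e / (c + 1))"
  have e': "0 < e'" "e' \<le> 1" "e' * c \<le> e"
  proof -
    show "0 < e'" "e' \<le> 1" using e c by (auto simp: e'_def)
    have "e' * c \<le> e / (c + 1) * c" using c by (intro mult_right_mono) (auto simp: e'_def)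
    also have "\<dots> \<le> e" using e c by (simp add: field_simps)
    finally show "e' * c \<le> e" .
  qed
  obtain d where d: "0 < d" "\<And>t. 0 \<le> t \<Longrightarrow> \<bar>t - s\<bar> < d \<Longrightarrow> L2norm lborel (\<lambda>x. v t x - v s x) < e'"
    using weak_solution_near[OF v, of s e'] s e' by auto
  define d' where "d' = min d s"
  have d': "0 < d'" "\<And>t. \<bar>t - s\<bar> < d' \<Longrightarrow> 0 < t \<and> L2norm lborel (\<lambda>x. v t x - v s x) \<le> e'"
    using d s by (auto simp: d'_def intro!: less_imp_le[OF d(2)])
  have "cmod (smoothed_mass t - smoothed_mass s) \<le> e * \<bar>t - s\<bar>" if t: "\<bar>t - s\<bar> < d'" for t
  proof -
    have t0: "0 \<le> t" and s0: "0 \<le> s" using d'(2)[OF t] s by auto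
    note [simp] = square_integrable_at[OF t0] square_integrable_at[OF s0]
    define w where "w = (\<lambda>x. v t x - v s x)"
    have w: "square_integrable lborel w" "L2norm lborel w \<le> e'"
      using d'(2)[OF t] by (auto simp: w_def intro: square_integrable_diff)
    have nt: "L2norm lborel (v t) \<le> L2norm lborel (v s) + e'"
      using L2norm_diff_diff[of lborel "v t" "v s"] w(2) by (simp add: w_def)
    define f g where "f = (\<lambda>x. cnj (v s x))" and "g = (\<lambda>x. cnj (v t x))"
    have fg: "square_integrable lborel f" "square_integrable lborel g"
      "L2norm lborel f = L2norm lborel (v s)" "L2norm lborel g = L2norm lborel (v t)"
      by (auto simp: f_def g_def square_integrable_cnj L2norm_cnj)
    define h where "h = t - s"
    define R where "R = (\<lambda>f. pairing K f (v t) - pairing K f (v s) - h *\<^sub>R (\<i> * pairing L f (v s)))"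
    have R: "cmod (R f) \<le> \<bar>h\<bar> * (L1norm L * (L2norm lborel f * e'))" if "square_integrable lborel f" for f
      unfolding R_def h_def by (rule pairing_linearization[OF s that d'(2) t])
    have real: "cnj (pairing L f (v s)) = pairing L f (v s)"
      unfolding f_def by (rule pairing_cnj_real) simp
    have "smoothed_mass t - smoothed_mass s = (pairing K g (v t) - pairing K g (v s)) + (pairing K g (v s) - pairing K f (v s))"
      by (simp add: smoothed_mass_def f_def g_def)
    also have "pairing K g (v s) - pairing K f (v s) = cnj (pairing K f (v t) - pairing K f (v s))"
      unfolding f_def g_def by (rule pairing_sub_cnj_left[OF square_integrable_at[OF t0] square_integrable_at[OF s0] square_integrable_at[OF s0] K(1,3,4)])
    also have "\<dots> = cnj (R f) - h *\<^sub>R (\<i> * pairing L f (v s))"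
      by (simp add: R_def real del: complex_cnj_cancel_iff)
    also have "pairing K g (v t) - pairing K g (v s) = R g + h *\<^sub>R (\<i> * pairing L g (v s))"
      by (simp add: R_def)
    also have "R g + h *\<^sub>R (\<i> * pairing L g (v s)) + (cnj (R f) - h *\<^sub>R (\<i> * pairing L f (v s)))
        = R g + cnj (R f) + h *\<^sub>R (\<i> * (pairing L g (v s) - pairing L f (v s)))"
      by (simp add: algebra_simps)
    also have "pairing L g (v s) - pairing L f (v s) = cnj (pairing L f w)"
      unfolding f_def g_def w_def
      using pairing_sub_cnj_left[OF square_integrable_at[OF t0] square_integrable_at[OF s0] square_integrable_at[OF s0] L(1,3,4)]
        pairing_diff_right[OF square_integrable_cnj[OF square_integrable_at[OF s0]] square_integrable_at[OF t0] square_integrable_at[OF s0] L(1)]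
      by simp
    also have "cmod (R g + cnj (R f) + h *\<^sub>R (\<i> * cnj (pairing L f w)))
        \<le> cmod (R g) + cmod (R f) + \<bar>h\<bar> * cmod (pairing L f w)"
      by (intro norm_triangle_le add_mono) (auto simp: norm_mult)
    also have "\<dots> \<le> \<bar>h\<bar> * (L1norm L * (L2norm lborel (v t) * e')) + \<bar>h\<bar> * (L1norm L * (L2norm lborel (v s) * e'))
        + \<bar>h\<bar> * (L1norm L * (L2norm lborel (v s) * L2norm lborel w))"
      using R[OF fg(1)] R[OF fg(2)] pairing_bound[OF fg(1) w(1) L(1)] fg(3,4)
      by (intro add_mono mult_left_mono) auto
    also have "\<dots> \<le> \<bar>h\<bar> * (L1norm L * ((L2norm lborel (v s) + 1) * e')) + \<bar>h\<bar> * (L1norm L * (L2norm lborel (v s) * e'))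
        + \<bar>h\<bar> * (L1norm L * (L2norm lborel (v s) * e'))"
      using nt w(2) e' by (intro add_mono mult_left_mono mult_right_mono) auto
    also have "\<dots> = \<bar>h\<bar> * (e' * c)" by (simp add: c_def algebra_simps)
    also have "\<dots> \<le> \<bar>h\<bar> * e" using e' by (intro mult_left_mono) auto
    finally show ?thesis by (simp add: h_def mult.commute)
  qed
  with d'(1) show "\<exists>d>0. \<forall>t. norm (t - s) < d \<longrightarrow> norm (smoothed_mass t - smoothed_mass s - 0) \<le> e * norm (t - s)"
    by auto
qed

lemma smoothed_mass_constant:
  assumes "0 \<le> t" shows "smoothed_mass t = smoothed_mass 0"
proof -
  have c: "continuous_on {0..t} smoothed_mass"
    by (rule continuous_on_subset[OF smoothed_mass_continuous]) auto
  have d: "(smoothed_mass has_derivative (\<lambda>h. 0)) (at x within {0..t})" if "x \<in> {0..t} - {0}" for x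
    by (rule has_derivative_at_withinI[OF smoothed_mass_has_derivative_0]) (use that in auto)
  have fin: "finite {0::real}" and t: "t \<in> {0..t}" using assms by auto
  from has_derivative_zero_unique_strong_interval[OF fin c refl d t] show ?thesis .
qed

end

section \<open>Continuity of translations\<close>

lemma integrable_translate:
  fixes f :: "'a::euclidean_space \<Rightarrow> complex"
  assumes "integrable lborel f"
  shows "integrable lborel (\<lambda>x. f (a + x))"
proof -
  have [measurable]: "f \<in> borel_measurable borel" using assms by auto
  have "integrable (distr lborel borel ((+) a)) f"
    using assms by (simp add: lborel_distr_plus)
  then show ?thesis by (subst (asm) integrable_distr_eq) auto
qed

text \<open>
  Translations are isometries, so continuity of translations passes to limits in \<open>L\<^sup>1\<close>.
\<close>

lemma L1_translation_approx:
  fixes f :: "'a::euclidean_space \<Rightarrow> complex"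
  assumes f: "integrable lborel f"
    and approx: "\<And>e. 0 < e \<Longrightarrow> \<exists>g. integrable lborel g \<and> L1norm (\<lambda>x. f x - g x) \<le> e
      \<and> (\<lambda>n. L1norm (\<lambda>x. g (X n + x) - g x)) \<longlonglongrightarrow> 0"
  shows "(\<lambda>n. L1norm (\<lambda>x. f (X n + x) - f x)) \<longlonglongrightarrow> 0"
  unfolding lim_sequentially
proof (intro allI impI)
  fix e :: real assume "0 < e"
  then obtain g where g: "integrable lborel g" "L1norm (\<lambda>x. f x - g x) \<le> e / 3"
      "(\<lambda>n. L1norm (\<lambda>x. g (X n + x) - g x)) \<longlonglongrightarrow> 0"
    using approx[of "e / 3"] by auto
  then obtain N where N: "\<And>n. n \<ge> N \<Longrightarrow> L1norm (\<lambda>x. g (X n + x) - g x) < e / 3"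
    using \<open>0 < e\<close> unfolding lim_sequentially by (force simp: dist_real_def dest: spec[of _ "e / 3"])
  have "L1norm (\<lambda>x. f (X n + x) - f x) < e" if "n \<ge> N" for n
  proof -
    note int = integrable_translate[OF f, of "X n"] integrable_translate[OF g(1), of "X n"] f g(1)
    have "L1norm (\<lambda>x. f (X n + x) - f x) \<le> (LINT x|lborel. cmod (f (X n + x) - g (X n + x))
        + cmod (g (X n + x) - g x) + cmod (f x - g x))"
    proof (rule integral_mono)
      show "cmod (f (X n + x) - f x) \<le> cmod (f (X n + x) - g (X n + x))
        + cmod (g (X n + x) - g x) + cmod (f x - g x)" for x
        using norm_triangle_ineq[of "f (X n + x) - g (X n + x) + (g (X n + x) - g x)" "g x - f x"]
          norm_triangle_ineq[of "f (X n + x) - g (X n + x)" "g (X n + x) - g x"]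
        by (simp add: norm_minus_commute[of "g x"])
    qed (use int in auto)
    also have "\<dots> = L1norm (\<lambda>x. f (X n + x) - g (X n + x)) + L1norm (\<lambda>x. g (X n + x) - g x)
        + L1norm (\<lambda>x. f x - g x)"
      using int by simp
    also have "L1norm (\<lambda>x. f (X n + x) - g (X n + x)) = L1norm (\<lambda>x. f x - g x)"
      using lborel_integral_translate[of "\<lambda>x. cmod (f x - g x)" "X n"] f g(1) by simp
    finally show ?thesis using N[OF that] g(2) by linarith
  qed
  then show "\<exists>N. \<forall>n\<ge>N. dist (L1norm (\<lambda>x. f (X n + x) - f x)) 0 < e"
    by (intro exI[of _ N]) (auto simp: dist_real_def)
qed

text \<open>
  For open \<open>U\<close>, every point of \<open>U\<close> stays in \<open>U\<close> under small translations, so dominated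
  convergence applies to \<open>|U \<inter> (U - h)|\<close>. Outer regularity then covers all measurable sets of
  finite measure.
\<close>

lemma L1_translation_indicator_open:
  fixes U :: "'a::euclidean_space set" and c :: complex
  assumes U: "open U" and fin: "emeasure lborel U < \<infinity>" and X: "X \<longlonglongrightarrow> 0"
  shows "(\<lambda>n. L1norm (\<lambda>x. indicator U (X n + x) *\<^sub>R c - indicator U x *\<^sub>R c)) \<longlonglongrightarrow> 0"
proof -
  have [measurable]: "U \<in> sets borel" using U by auto
  have i: "integrable lborel (indicator U :: 'a \<Rightarrow> real)"
    using fin by (simp add: integrable_indicator_iff)
  define J where "J = (\<lambda>n x. indicator U (X n + x) * indicator U x :: real)"
  have J: "integrable lborel (J n)" for n
    by (rule Bochner_Integration.integrable_bound[OF i]) (auto simp: J_def indicator_def)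
  have iX: "integrable lborel (\<lambda>x. indicator U (X n + x) :: real)"
    and eqX: "(LINT x|lborel. indicator U (X n + x) :: real) = (LINT x|lborel. indicator U x)" for n
  proof -
    have "integrable (distr lborel borel ((+) (X n))) (indicator U :: 'a \<Rightarrow> real)"
      using i by (simp add: lborel_distr_plus)
    then show "integrable lborel (\<lambda>x. indicator U (X n + x) :: real)"
      by (subst (asm) integrable_distr_eq) auto
    show "(LINT x|lborel. indicator U (X n + x) :: real) = (LINT x|lborel. indicator U x)"
      by (rule lborel_integral_translate) measurable
  qed
  have "(\<lambda>n. LINT x|lborel. J n x) \<longlonglongrightarrow> (LINT x|lborel. indicator U x)"
  proof (rule integral_dominated_convergence[OF _ _ i])
    show "AE x in lborel. (\<lambda>n. J n x) \<longlonglongrightarrow> indicator U x"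
    proof (intro AE_I2 tendsto_eventually)
      fix x :: 'a
      show "\<forall>\<^sub>F n in sequentially. J n x = indicator U x"
      proof (cases "x \<in> U")
        case True
        have "(\<lambda>n. X n + x) \<longlonglongrightarrow> x"
          using tendsto_add[OF X tendsto_const[of x]] by simp
        then have "\<forall>\<^sub>F n in sequentially. X n + x \<in> U"
          using U True by (rule topological_tendstoD)
        then show ?thesis by eventually_elim (auto simp: J_def True)
      qed (auto simp: J_def)
    qed
  qed (auto simp: J_def indicator_def)
  then have "(\<lambda>n. cmod c * (2 * (LINT x|lborel. indicator U x) - 2 * (LINT x|lborel. J n x)))
      \<longlonglongrightarrow> cmod c * (2 * (LINT x|lborel. indicator U x) - 2 * (LINT x|lborel. indicator U x))"
    by (intro tendsto_intros)
  moreover have "L1norm (\<lambda>x. indicator U (X n + x) *\<^sub>R c - indicator U x *\<^sub>R c)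
      = cmod c * (2 * (LINT x|lborel. indicator U x) - 2 * (LINT x|lborel. J n x))" for n
  proof -
    have "L1norm (\<lambda>x. indicator U (X n + x) *\<^sub>R c - indicator U x *\<^sub>R c)
        = (LINT x|lborel. cmod c * (indicator U (X n + x) + indicator U x - 2 * J n x))"
      by (intro Bochner_Integration.integral_cong) (auto simp: J_def indicator_def)
    also have "\<dots> = cmod c * ((LINT x|lborel. indicator U (X n + x)) + (LINT x|lborel. indicator U x)
        - 2 * (LINT x|lborel. J n x))"
      using i J iX by simp
    finally show ?thesis by (simp add: eqX)
  qed
  ultimately show ?thesis by simp
qed

lemma L1_translation_continuous:
  fixes f :: "'a::euclidean_space \<Rightarrow> complex"
  assumes "integrable lborel f" and X: "X \<longlonglongrightarrow> 0"
  shows "(\<lambda>n. L1norm (\<lambda>x. f (X n + x) - f x)) \<longlonglongrightarrow> 0"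
  using assms(1)
proof (induct rule: integrable_induct)
  case (base A c)
  have [measurable]: "A \<in> sets borel" using base by simp
  have iA: "integrable lborel (\<lambda>x. indicator A x *\<^sub>R c)"
    using base by (intro integrable_scaleR_left) (simp add: integrable_indicator_iff)
  show ?case
  proof (rule L1_translation_approx[OF iA])
    fix e :: real assume e: "0 < e"
    define e' where "e' = e / (cmod c + 1)"
    have e': "0 < e'" "e' * cmod c \<le> e"
    proof -
      have "0 < cmod c + 1" using norm_ge_zero[of c] by linarith
      then show "0 < e'" "e' * cmod c \<le> e" using e by (auto simp: e'_def field_simps)
    qed
    obtain U where U: "open U" "A \<subseteq> U" and d: "emeasure lborel (U - A) < ennreal e'"
      using outer_regular_lborel[of A e'] base e' by auto
    have [measurable]: "U \<in> sets borel" using U by auto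
    have "emeasure lborel U \<le> emeasure lborel A + emeasure lborel (U - A)"
      using U(2) emeasure_subadditive[of A lborel "U - A"] by (simp add: Un_absorb1)
    also have "\<dots> < \<infinity>"
      using base(2) d by (simp add: ennreal_add_less_top less_top[symmetric]) (auto simp: top_unique)
    finally have fin: "emeasure lborel U < \<infinity>" .
    have iU: "integrable lborel (\<lambda>x. indicator U x *\<^sub>R c)"
      using fin by (intro integrable_scaleR_left) (simp add: integrable_indicator_iff)
    have "L1norm (\<lambda>x. indicator A x *\<^sub>R c - indicator U x *\<^sub>R c) = (LINT x|lborel. indicator (U - A) x * cmod c)"
      using U(2) by (intro Bochner_Integration.integral_cong) (auto simp: indicator_def)
    also have "\<dots> = measure lborel (U - A) * cmod c" by simp
    also have "\<dots> \<le> e' * cmod c"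
      using d e' by (intro mult_right_mono) (auto simp: measure_def intro!: enn2real_leI)
    finally have "L1norm (\<lambda>x. indicator A x *\<^sub>R c - indicator U x *\<^sub>R c) \<le> e"
      using e' by simp
    then show "\<exists>g. integrable lborel g \<and> L1norm (\<lambda>x. indicator A x *\<^sub>R c - g x) \<le> e
      \<and> (\<lambda>n. L1norm (\<lambda>x. g (X n + x) - g x)) \<longlonglongrightarrow> 0"
      using iU L1_translation_indicator_open[OF U(1) fin X] by blast
  qed
next
  case (add f g)
  have "(\<lambda>n. L1norm (\<lambda>x. f (X n + x) - f x) + L1norm (\<lambda>x. g (X n + x) - g x)) \<longlonglongrightarrow> 0"
    using tendsto_add[OF add(2,4)] by simp
  then show ?case
  proof (rule Lim_null_comparison[rotated], intro always_eventually allI)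
    fix n
    note int = integrable_translate[OF add(1), of "X n"] integrable_translate[OF add(3), of "X n"] add(1,3)
    have "L1norm (\<lambda>x. f (X n + x) + g (X n + x) - (f x + g x))
        \<le> (LINT x|lborel. cmod (f (X n + x) - f x) + cmod (g (X n + x) - g x))"
    proof (rule integral_mono)
      show "cmod (f (X n + x) + g (X n + x) - (f x + g x)) \<le> cmod (f (X n + x) - f x) + cmod (g (X n + x) - g x)" for x
        by (rule norm_diff_triangle_ineq)
    qed (use int in auto)
    also have "\<dots> = L1norm (\<lambda>x. f (X n + x) - f x) + L1norm (\<lambda>x. g (X n + x) - g x)"
      using int by simp
    finally show "norm (L1norm (\<lambda>x. f (X n + x) + g (X n + x) - (f x + g x)))
        \<le> L1norm (\<lambda>x. f (X n + x) - f x) + L1norm (\<lambda>x. g (X n + x) - g x)" by simp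
  qed
next
  case (lim f s)
  show ?case
  proof (rule L1_translation_approx[OF lim(5)])
    fix e :: real assume e: "0 < e"
    have "(\<lambda>i. LINT x|lborel. cmod (f x - s i x)) \<longlonglongrightarrow> (LINT (x::'a)|lborel. 0 :: real)"
    proof (rule integral_dominated_convergence[where w="\<lambda>x. 3 * cmod (f x)"])
      show "AE x in lborel. (\<lambda>i. cmod (f x - s i x)) \<longlonglongrightarrow> 0"
        using lim(3) by (intro AE_I2) (auto intro!: tendsto_eq_intros)
      show "AE x in lborel. norm (cmod (f x - s i x)) \<le> 3 * cmod (f x)" for i
        using lim(4)[of _ i] norm_triangle_ineq4[of "f _" "s i _"]
        by (intro AE_I2) (smt (verit) norm_triangle_ineq4 UNIV_I norm_ge_zero real_norm_def space_borel space_lborel)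
      show "(\<lambda>x. cmod (f x - s i x)) \<in> borel_measurable lborel" for i
        using borel_measurable_integrable[OF lim(5)] borel_measurable_integrable[OF lim(1)[of i]] by measurable
    qed (use lim(5) in auto)
    then obtain i where "(LINT x|lborel. cmod (f x - s i x)) < e"
      using e order_tendstoD(2)[of _ 0 sequentially e] by (auto simp: eventually_sequentially)
    then show "\<exists>g. integrable lborel g \<and> L1norm (\<lambda>x. f x - g x) \<le> e
      \<and> (\<lambda>n. L1norm (\<lambda>x. g (X n + x) - g x)) \<longlonglongrightarrow> 0"
      using lim(1,2) by (intro exI[of _ "s i"]) auto
  qed
qed

text \<open>
  Truncating both domain and range produces bounded integrable functions, for which
  \<open>L\<^sup>1\<close> continuity of translations implies \<open>L\<^sup>2\<close> continuity.
\<close>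

lemma L2norm_truncation_tendsto:
  fixes f :: "'a::euclidean_space \<Rightarrow> complex"
  assumes f: "square_integrable lborel f"
  defines "g \<equiv> \<lambda>n x. indicator {x. norm x \<le> real n \<and> cmod (f x) \<le> real n} x * f x"
  shows "(\<lambda>n. L2norm lborel (\<lambda>x. f x - g n x)) \<longlonglongrightarrow> 0"
proof -
  have [measurable]: "f \<in> borel_measurable borel" using f by (simp add: square_integrable_def)
  have [measurable]: "g n \<in> borel_measurable borel" for n unfolding g_def by measurable
  have "(\<lambda>n. LINT x|lborel. (cmod (f x - g n x))\<^sup>2) \<longlonglongrightarrow> (LINT (x::'a)|lborel. 0 :: real)"
  proof (rule integral_dominated_convergence[where w="\<lambda>x. (cmod (f x))\<^sup>2"])
    show "AE x in lborel. (\<lambda>n. (cmod (f x - g n x))\<^sup>2) \<longlonglongrightarrow> 0"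
    proof (intro AE_I2 tendsto_eventually)
      fix x :: 'a
      obtain N :: nat where "max (norm x) (cmod (f x)) \<le> real N" using real_arch_simple by blast
      then show "\<forall>\<^sub>F n in sequentially. (cmod (f x - g n x))\<^sup>2 = 0"
        by (intro eventually_sequentiallyI[of N]) (auto simp: g_def indicator_def)
    qed
  qed (use f in \<open>auto simp: g_def indicator_def square_integrable_def\<close>)
  from tendsto_real_sqrt[OF this] show ?thesis by (simp add: L2norm_def)
qed

lemma L2_translation_continuous:
  fixes f :: "'a::euclidean_space \<Rightarrow> complex"
  assumes f: "square_integrable lborel f" and X: "X \<longlonglongrightarrow> 0"
  shows "(\<lambda>n. L2norm lborel (\<lambda>x. f (X n + x) - f x)) \<longlonglongrightarrow> 0"
  unfolding lim_sequentially
proof (intro allI impI)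
  fix e :: real assume e: "0 < e"
  have fm [measurable]: "f \<in> borel_measurable borel" using f by (simp add: square_integrable_def)
  define gn where "gn = (\<lambda>n x. indicator {x. norm x \<le> real n \<and> cmod (f x) \<le> real n} x * f x)"
  obtain m where m: "L2norm lborel (\<lambda>x. f x - gn m x) < e / 3"
    using L2norm_truncation_tendsto[OF f] e order_tendstoD(2)[of _ 0 sequentially "e / 3"]
    by (force simp: eventually_sequentially gn_def)
  define g where "g = gn m"
  have gm [measurable]: "g \<in> borel_measurable borel" unfolding g_def gn_def by measurable
  have gb: "cmod (g x) \<le> real m" for x by (auto simp: g_def gn_def indicator_def)
  have "cmod (g x) \<le> real m * indicator (cball 0 (real m)) x" for x
    by (auto simp: g_def gn_def indicator_def)
  moreover have "integrable lborel (\<lambda>x::'a. real m * indicator (cball 0 (real m)) x)"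
    using emeasure_bounded_finite[OF bounded_cball, of "0 :: 'a" "real m"]
    by (intro integrable_mult_right) (simp add: integrable_indicator_iff)
  ultimately have g1: "integrable lborel g"
    using Bochner_Integration.integrable_bound[of lborel "\<lambda>x. real m * indicator (cball 0 (real m)) x" g]
    by simp
  have g2: "square_integrable lborel g"
    by (rule square_integrable_dominated[OF f, where c=1]) (auto simp: g_def gn_def indicator_def fm)
  have "(\<lambda>n. sqrt (2 * real m * L1norm (\<lambda>x. g (X n + x) - g x))) \<longlonglongrightarrow> sqrt (2 * real m * 0)"
    by (intro tendsto_intros L1_translation_continuous g1 X)
  then obtain N where N: "\<And>n. n \<ge> N \<Longrightarrow> sqrt (2 * real m * L1norm (\<lambda>x. g (X n + x) - g x)) < e / 3"
    using e order_tendstoD(2)[of _ 0 sequentially "e / 3"] by (force simp: eventually_sequentially)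
  have "L2norm lborel (\<lambda>x. f (X n + x) - f x) < e" if n: "n \<ge> N" for n
  proof -
    note sq = f g2 square_integrable_translate[OF f, of "X n"] square_integrable_translate[OF g2, of "X n"]
    have "(LINT x|lborel. (cmod (g (X n + x) - g x))\<^sup>2) \<le> (LINT x|lborel. 2 * real m * cmod (g (X n + x) - g x))"
    proof (rule integral_mono)
      show "(cmod (g (X n + x) - g x))\<^sup>2 \<le> 2 * real m * cmod (g (X n + x) - g x)" for x
        using norm_triangle_ineq4[of "g (X n + x)" "g x"] gb[of x] gb[of "X n + x"]
        unfolding power2_eq_square by (intro mult_right_mono) auto
      show "integrable lborel (\<lambda>x. (cmod (g (X n + x) - g x))\<^sup>2)"
        by (intro square_integrable_integrable square_integrable_diff sq)
    qed (use g1 integrable_translate[OF g1, of "X n"] in auto)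
    also have "\<dots> = 2 * real m * L1norm (\<lambda>x. g (X n + x) - g x)"
      using g1 integrable_translate[OF g1, of "X n"] by simp
    finally have "L2norm lborel (\<lambda>x. g (X n + x) - g x) \<le> sqrt (2 * real m * L1norm (\<lambda>x. g (X n + x) - g x))"
      unfolding L2norm_def by (rule real_sqrt_le_mono)
    with N[OF n] have mid: "L2norm lborel (\<lambda>x. g (X n + x) - g x) < e / 3" by linarith
    have "L2norm lborel (\<lambda>x. f (X n + x) - f x)
        = L2norm lborel (\<lambda>x. ((f (X n + x) - g (X n + x)) + (g (X n + x) - g x)) - (f x - g x))"
      by (simp add: algebra_simps)
    also have "\<dots> \<le> L2norm lborel (\<lambda>x. (f (X n + x) - g (X n + x)) + (g (X n + x) - g x)) + L2norm lborel (\<lambda>x. f x - g x)"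
      by (intro L2norm_diff_triangle square_integrable_add square_integrable_diff sq)
    also have "\<dots> \<le> L2norm lborel (\<lambda>x. f (X n + x) - g (X n + x)) + L2norm lborel (\<lambda>x. g (X n + x) - g x)
        + L2norm lborel (\<lambda>x. f x - g x)"
      by (intro add_right_mono L2norm_triangle square_integrable_diff sq)
    also have "L2norm lborel (\<lambda>x. f (X n + x) - g (X n + x)) = L2norm lborel (\<lambda>x. f x - g x)"
      by (rule L2norm_translate) measurable
    finally show ?thesis using mid m by (simp add: g_def)
  qed
  then show "\<exists>N. \<forall>n\<ge>N. dist (L2norm lborel (\<lambda>x. f (X n + x) - f x)) 0 < e"
    by (intro exI[of _ N]) (auto simp: dist_real_def)
qed

lemma L2_translation_tendsto:
  fixes f :: "'a::euclidean_space \<Rightarrow> complex"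
  assumes f: "square_integrable lborel f"
  shows "((\<lambda>h. L2norm lborel (\<lambda>x. f (h + x) - f x)) \<longlongrightarrow> 0) (at 0)"
  unfolding tendsto_at_iff_sequentially comp_def using L2_translation_continuous[OF f] by blast

lemma L2_translation_near:
  fixes f :: "'a::euclidean_space \<Rightarrow> complex"
  assumes f: "square_integrable lborel f" and e: "0 < e"
  obtains d where "0 < d" "\<And>h. norm h < d \<Longrightarrow> L2norm lborel (\<lambda>x. f (h + x) - f x) < e"
proof -
  obtain d where d: "0 < d" "\<And>h. h \<noteq> 0 \<Longrightarrow> norm h < d \<Longrightarrow> L2norm lborel (\<lambda>x. f (h + x) - f x) < e"
    using L2_translation_tendsto[OF f] e by (force simp: tendsto_iff eventually_at)
  have "L2norm lborel (\<lambda>x. f (h + x) - f x) < e" if "norm h < d" for h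
    using d(2)[of h] that e by (cases "h = 0") auto
  with d(1) that show ?thesis by blast
qed

section \<open>Conservation of mass\<close>

text \<open>
  The correlation \<open>\<integral> cnj (f z) f (h + z) dz\<close> differs from its value at \<open>h = 0\<close>, the mass, by at
  most \<open>\<parallel>f\<parallel> \<parallel>f(h + \<cdot>) - f\<parallel>\<close>. The pairing averages it over the support of \<open>K\<close>.
\<close>

lemma pairing_approximates_norm:
  fixes f K :: "'a::euclidean_space \<Rightarrow> complex"
  assumes f: "square_integrable lborel f" and K: "integrable lborel K"
    and pos: "\<And>x. K x = of_real (cmod (K x))"
    and near: "\<And>h. norm h \<le> d \<Longrightarrow> L2norm lborel (\<lambda>x. f (h + x) - f x) \<le> e"
    and supp: "\<And>h. d < norm h \<Longrightarrow> K h = 0"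
  shows "cmod (pairing K (\<lambda>x. cnj (f x)) f - of_real (L1norm K * (L2norm lborel f)\<^sup>2))
      \<le> L1norm K * (L2norm lborel f * e)"
proof -
  note cf = square_integrable_cnj[OF f]
  define c where "c = (\<lambda>h. LINT z|lborel. cnj (f z) * f (h + z))"
  have int: "integrable lborel (\<lambda>h. K h * c h)"
    unfolding c_def by (rule pairing_integrand[OF cf f K])
  have c_near: "cmod (c h - of_real ((L2norm lborel f)\<^sup>2)) \<le> L2norm lborel f * L2norm lborel (\<lambda>x. f (h + x) - f x)" for h
  proof -
    have "of_real ((L2norm lborel f)\<^sup>2) = (LINT z|lborel. cnj (f z) * f z)"
      unfolding L2norm_power2 integral_complex_of_real[symmetric]
      by (intro Bochner_Integration.integral_cong refl)
        (simp add: complex_norm_square mult.commute del: of_real_power)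
    then have "c h - of_real ((L2norm lborel f)\<^sup>2) = (LINT z|lborel. cnj (f z) * (f (h + z) - f z))"
      unfolding c_def right_diff_distrib
      by (simp add: Bochner_Integration.integral_diff integrable_mult_square_integrable cf f square_integrable_translate)
    also have "cmod \<dots> \<le> L2norm lborel (\<lambda>x. cnj (f x)) * L2norm lborel (\<lambda>x. f (h + x) - f x)"
      by (intro Cauchy_Schwarz_L2norm cf square_integrable_diff square_integrable_translate f)
    finally show ?thesis by (simp add: L2norm_cnj)
  qed
  have "of_real (L1norm K) = (LINT h|lborel. K h)"
    unfolding integral_complex_of_real[symmetric] by (subst pos) simp
  then have "pairing K (\<lambda>x. cnj (f x)) f - of_real (L1norm K * (L2norm lborel f)\<^sup>2)
      = (LINT h|lborel. K h * (c h - of_real ((L2norm lborel f)\<^sup>2)))"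
    using int K by (simp add: pairing_def c_def right_diff_distrib)
  also have "cmod \<dots> \<le> (LINT h|lborel. cmod (K h * (c h - of_real ((L2norm lborel f)\<^sup>2))))"
    by (rule integral_norm_bound)
  also have "\<dots> \<le> (LINT h|lborel. cmod (K h) * (L2norm lborel f * e))"
  proof (rule integral_mono)
    show "integrable lborel (\<lambda>h. cmod (K h * (c h - of_real ((L2norm lborel f)\<^sup>2))))"
      using int K by (intro integrable_norm) (simp add: right_diff_distrib)
    show "cmod (K h * (c h - of_real ((L2norm lborel f)\<^sup>2))) \<le> cmod (K h) * (L2norm lborel f * e)" for h
    proof (cases "norm h \<le> d")
      case True
      have "cmod (c h - of_real ((L2norm lborel f)\<^sup>2)) \<le> L2norm lborel f * e"
        using c_near[of h] mult_left_mono[OF near[OF True], of "L2norm lborel f"] by simp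
      then show ?thesis by (simp add: norm_mult mult_left_mono)
    qed (use supp[of h] in simp)
  qed (use K in simp)
  finally show ?thesis by simp
qed

lemma laplacian_tensor_translate:
  assumes F: "\<And>i. jet (F i)"
  shows "laplacian (tensor (\<lambda>i k x. F i k (x + - z $ i)) (\<lambda>_. 0)) y = laplacian (tensor F (\<lambda>_. 0)) (y - z)"
proof -
  have "jet (\<lambda>k x. F i k (x + - z $ i))" for i
    by (rule jet_translate[OF F])
  then show ?thesis
    using F by (simp add: laplacian_tensor tensor_def)
qed

lemma conserved_kernel_bump:
  assumes v: "weak_solution v"
  shows "conserved_kernel v (tensor (bump_kernel e) (\<lambda>_. 0)) (laplacian (tensor (bump_kernel e) (\<lambda>_. 0)))"
proof
  let ?K = "tensor (bump_kernel e) (\<lambda>_. 0)"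
  have j: "jet (bump_kernel e i)" for i by (rule jet_bump_kernel)
  note L = laplacian_tensor[of "bump_kernel e", OF j]
  show "integrable lborel ?K" "square_integrable lborel ?K"
    by (rule integrable_tensor square_integrable_tensor, rule j)+
  show "?K (- x) = ?K x" "cnj (?K x) = ?K x" for x
    by (simp_all add: tensor_bump_even cnj_tensor_bump)
  show "integrable lborel (laplacian ?K)" "square_integrable lborel (laplacian ?K)"
    by (rule integrable_laplacian_tensor square_integrable_laplacian_tensor, rule j)+
  show "laplacian ?K (- x) = laplacian ?K x" "cnj (laplacian ?K x) = laplacian ?K x" for x
    unfolding L by (simp_all add: cnj_tensor_bump tensor_bump_even)
  fix t :: real and z :: "real ^ 'a" assume t: "0 < t"
  define F where "F = (\<lambda>i k x. bump_kernel e i k (x + - z $ i))"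
  have "\<forall>i. jet (F i)" unfolding F_def using jet_translate[OF j] by blast
  then have "((\<lambda>s. LINT x|lborel. v s x * tensor F (\<lambda>_. 0) x) has_vector_derivative
          \<i> * (LINT x|lborel. v t x * laplacian (tensor F (\<lambda>_. 0)) x)) (at t)"
    using v t unfolding weak_solution_def by blast
  moreover have "tensor F (\<lambda>_. 0) y = ?K (y - z)" for y
    by (simp add: tensor_def F_def)
  moreover have "laplacian (tensor F (\<lambda>_. 0)) y = laplacian ?K (y - z)" for y
    unfolding F_def by (rule laplacian_tensor_translate[OF j])
  ultimately show "((\<lambda>s. LINT y|lborel. v s y * ?K (y - z)) has_vector_derivative
        \<i> * (LINT y|lborel. v t y * laplacian ?K (y - z))) (at t)"
    by simp
qed (rule v)

text \<open>
  Equality of the smoothed masses at times \<open>T\<close> and \<open>0\<close>, for kernels concentrated so close to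
  the origin that neither state moves by more than \<open>q\<close> in norm under translations from
  their support.
\<close>

theorem mass_conservation:
  fixes v :: "real \<Rightarrow> real ^ 'n \<Rightarrow> complex"
  assumes v: "weak_solution v" and T: "0 \<le> T"
  shows "L2norm lborel (v T) = L2norm lborel (v 0)"
proof -
  have "square_integrable lborel (v t)" if "0 \<le> t" for t
    using v that by (simp add: weak_solution_def)
  from this[OF T] this[OF order_refl]
  have L2: "square_integrable lborel (v T)" "square_integrable lborel (v 0)" .
  let ?A = "L2norm lborel (v T)" and ?B = "L2norm lborel (v 0)"
  have close: "\<bar>?A\<^sup>2 - ?B\<^sup>2\<bar> \<le> 0 + \<eta>" if \<eta>: "0 < \<eta>" for \<eta>
  proof -
    define q where "q = \<eta> / (?A + ?B + 1)"
    have AB: "0 < ?A + ?B + 1" using L2norm_nonneg[of lborel "v T"] L2norm_nonneg[of lborel "v 0"] by linarith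
    have q: "0 < q" using \<eta> AB by (simp add: q_def)
    have "q * (?A + ?B) \<le> q * (?A + ?B + 1)" using q by (intro mult_left_mono) auto
    also have "\<dots> = \<eta>" using AB by (simp add: q_def)
    finally have q_le: "q * (?A + ?B) \<le> \<eta>" .
    obtain d1 where d1: "0 < d1" "\<And>h. norm h < d1 \<Longrightarrow> L2norm lborel (\<lambda>x. v T (h + x) - v T x) < q"
      using L2_translation_near[OF L2(1) q] by blast
    obtain d2 where d2: "0 < d2" "\<And>h. norm h < d2 \<Longrightarrow> L2norm lborel (\<lambda>x. v 0 (h + x) - v 0 x) < q"
      using L2_translation_near[OF L2(2) q] by blast
    define d where "d = min d1 d2 / 2"
    have d: "0 < d" "d < d1" "d < d2" using d1 d2 by (auto simp: d_def)
    define e where "e = d / real CARD('n)"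
    have e: "0 < e" "real CARD('n) * e = d" using d by (auto simp: e_def)
    define K :: "real ^ 'n \<Rightarrow> complex" where "K = tensor (bump_kernel e) (\<lambda>_. 0)"
    have Kpos: "0 < L1norm K"
      unfolding K_def by (rule integral_cmod_tensor_bump_pos[OF e(1)])
    have Kabs: "K x = of_real (cmod (K x))" for x
      unfolding K_def by (rule tensor_bump_cmod)
    have Ksupp: "K h = 0" if "d < norm h" for h
      unfolding K_def by (rule tensor_bump_support) (use that e in simp)
    have "conserved_kernel v K (laplacian K)"
      unfolding K_def by (rule conserved_kernel_bump[OF v])
    then interpret conserved_kernel v K "laplacian K" .
    have approx: "cmod (smoothed_mass t - of_real (L1norm K * (L2norm lborel (v t))\<^sup>2)) \<le> L1norm K * (L2norm lborel (v t) * q)"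
      if "t \<in> {T, 0}" for t
      unfolding smoothed_mass_def
    proof (rule pairing_approximates_norm[where d=d])
      show "square_integrable lborel (v t)" using L2 that by auto
      show "K x = of_real (cmod (K x))" for x by (rule Kabs)
      show "L2norm lborel (\<lambda>x. v t (h + x) - v t x) \<le> q" if "norm h \<le> d" for h
      proof -
        have "norm h < d1" "norm h < d2" using that d by simp_all
        from d1(2)[OF this(1)] d2(2)[OF this(2)] \<open>t \<in> {T, 0}\<close> show ?thesis
          by (auto intro: less_imp_le)
      qed
      show "K h = 0" if "d < norm h" for h
        using that by (rule Ksupp)
    qed (rule K)
    have "L1norm K * \<bar>?A\<^sup>2 - ?B\<^sup>2\<bar> = \<bar>L1norm K * ?A\<^sup>2 - L1norm K * ?B\<^sup>2\<bar>"
      using Kpos by (simp only: right_diff_distrib[symmetric] abs_mult abs_of_pos)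
    also have "\<dots> = cmod (of_real (L1norm K * ?A\<^sup>2) - of_real (L1norm K * ?B\<^sup>2))"
      by (simp only: of_real_diff[symmetric] norm_of_real)
    also have "\<dots> \<le> cmod (smoothed_mass 0 - of_real (L1norm K * ?B\<^sup>2)) + cmod (smoothed_mass T - of_real (L1norm K * ?A\<^sup>2))"
      unfolding smoothed_mass_constant[OF T]
      using norm_triangle_ineq[of "of_real (L1norm K * ?A\<^sup>2) - smoothed_mass 0" "smoothed_mass 0 - of_real (L1norm K * ?B\<^sup>2)"]
        norm_minus_commute[of "smoothed_mass 0" "of_real (L1norm K * ?A\<^sup>2)"]
      by (simp only: diff_add_cancel add_diff_eq)
    also have "\<dots> \<le> L1norm K * (?B * q) + L1norm K * (?A * q)"
      by (intro add_mono approx) auto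
    also have "\<dots> = L1norm K * (q * (?A + ?B))" by (simp add: algebra_simps)
    also have "\<dots> \<le> L1norm K * \<eta>" using q_le Kpos by (intro mult_left_mono) auto
    finally show ?thesis using Kpos by simp
  qed
  have "\<bar>?A\<^sup>2 - ?B\<^sup>2\<bar> \<le> 0"
    by (rule field_le_epsilon) (rule close)
  then have "?A\<^sup>2 = ?B\<^sup>2" by simp
  then show ?thesis by (rule power2_eq_imp_eq) (rule L2norm_nonneg)+
qed

section \<open>Galilean boosts\<close>

lemma has_vector_derivative_null_comparison:
  fixes Q :: "real \<Rightarrow> complex"
  assumes "\<forall>\<^sub>F s in at t. norm (Q s - Q t - (s - t) *\<^sub>R D) \<le> \<bar>s - t\<bar> * \<rho> s"
    and "(\<rho> \<longlongrightarrow> 0) (at t)"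
  shows "(Q has_vector_derivative D) (at t)"
  unfolding has_vector_derivative_def has_derivative_iff_norm
proof
  show "bounded_linear (\<lambda>h. h *\<^sub>R D)" by (rule bounded_linear_scaleR_left)
  show "((\<lambda>s. norm (Q s - Q t - (s - t) *\<^sub>R D) / norm (s - t)) \<longlongrightarrow> 0) (at t)"
  proof (rule Lim_null_comparison[OF _ assms(2)])
    show "\<forall>\<^sub>F s in at t. norm (norm (Q s - Q t - (s - t) *\<^sub>R D) / norm (s - t)) \<le> \<rho> s"
      using assms(1) eventually_neq_at_within[of t t UNIV]
    proof eventually_elim
      case (elim s)
      then have "0 < \<bar>s - t\<bar>" by simp
      with elim(1) show ?case
        by (simp add: divide_le_eq mult.commute)
    qed
  qed
qed

lemma tensor_line_derivative:
  fixes F :: "'n::finite \<Rightarrow> nat \<Rightarrow> real \<Rightarrow> complex"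
  assumes F: "\<And>i. jet (F i)"
  shows "((\<lambda>c. tensor F a (x + axis k c)) has_vector_derivative tensor F (a(k := Suc (a k))) (x + axis k c)) (at c)"
proof -
  have "((\<lambda>c. x + axis k c) has_derivative (\<lambda>h. axis k h)) (at c)"
  proof -
    have eq: "c *\<^sub>R axis k 1 = (axis k c :: real ^ 'n)" for c :: real
      by (simp add: axis_def vec_eq_iff)
    have "((\<lambda>c. x + c *\<^sub>R axis k 1) has_derivative (\<lambda>h. h *\<^sub>R axis k 1)) (at c)"
      by (auto intro!: derivative_eq_intros)
    then show ?thesis by (simp only: eq)
  qed
  from has_derivative_compose[OF this tensor_has_derivative[of F a, OF F]]
  have "((\<lambda>c. tensor F a (x + axis k c)) has_derivative
      (\<lambda>h. \<Sum>i\<in>UNIV. (axis k h $ i) *\<^sub>R tensor F (a(i := Suc (a i))) (x + axis k c))) (at c)" .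
  then show ?thesis
    by (simp add: has_vector_derivative_def axis_def if_distrib[of "\<lambda>c. c *\<^sub>R _"] cong: if_cong)
qed

text \<open>
  Second-order remainder of a translation in direction \<open>k\<close>: it is bounded pointwise by a
  multiple of \<open>c\<^sup>2\<close> and lives on a fixed ball, which gives the \<open>L\<^sup>2\<close> bound.
\<close>

lemma tensor_taylor_L2:
  fixes F :: "'n::finite \<Rightarrow> nat \<Rightarrow> real \<Rightarrow> complex"
  assumes F: "\<And>i. jet (F i)"
  obtains C where "\<And>c. \<bar>c\<bar> \<le> 1 \<Longrightarrow> L2norm lborel (\<lambda>x. tensor F (\<lambda>_. 0) (x + axis k c) - tensor F (\<lambda>_. 0) x
      - c *\<^sub>R tensor F ((\<lambda>_. 0)(k := 1)) x) \<le> c\<^sup>2 * C"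
proof -
  define T0 T1 T2 where "T0 = tensor F (\<lambda>_. 0)" and "T1 = tensor F ((\<lambda>_. 0)(k := 1))"
    and "T2 = tensor F ((\<lambda>_. 0)(k := 2))"
  have d0: "((\<lambda>c. T0 (x + axis k c)) has_vector_derivative T1 (x + axis k c)) (at c)" for x c
    using tensor_line_derivative[of F "\<lambda>_. 0" x k c, OF F] by (simp add: T0_def T1_def)
  have d1: "((\<lambda>c. T1 (x + axis k c)) has_vector_derivative T2 (x + axis k c)) (at c)" for x c
    using tensor_line_derivative[of F "(\<lambda>_. 0)(k := 1)" x k c, OF F] by (simp add: T1_def T2_def numeral_2_eq_2)
  obtain R where R: "\<And>a x. R < norm x \<Longrightarrow> tensor F a x = 0"
    using tensor_support[of F] F by blast
  have cont: "continuous_on UNIV T0" "continuous_on UNIV T1" "continuous_on UNIV T2"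
    unfolding T0_def T1_def T2_def by (intro tensor_continuous F)+
  obtain B where B: "\<And>x. cmod (T2 x) \<le> B"
    using continuous_compact_support(3)[OF cont(3), of R] R by (auto simp: T2_def)
  have ax0: "x + axis k 0 = x" for x :: "real ^ 'n"
    by (simp add: axis_def vec_eq_iff)
  have lip: "cmod (T1 (x + axis k c) - T1 x) \<le> B * \<bar>c\<bar>" for x c
  proof -
    have "norm (T1 (x + axis k c) - T1 (x + axis k 0)) \<le> B * norm (c - 0)"
    proof (rule differentiable_bound[OF convex_UNIV])
      show "((\<lambda>c. T1 (x + axis k c)) has_derivative (\<lambda>h. h *\<^sub>R T2 (x + axis k c))) (at c within UNIV)" for c
        using d1 by (simp add: has_vector_derivative_def)
      show "onorm (\<lambda>h. h *\<^sub>R T2 (x + axis k c)) \<le> B" for c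
        using mult_left_mono[OF B abs_ge_zero] by (intro onorm_le) (simp add: mult.commute[of B])
    qed auto
    then show ?thesis by (simp add: ax0)
  qed
  \<comment> \<open>\<open>R + 1\<close>: the translation by \<open>|c| \<le> 1\<close> enlarges the support by at most \<open>1\<close>.\<close>
  define S where "S = cball (0 :: real ^ 'n) (R + 1)"
  have ind: "square_integrable lborel (\<lambda>x::real^'n. indicator S x :: complex)"
    unfolding S_def by (rule square_integrable_indicator_cball)
  have B0: "0 \<le> B" using B[of 0] norm_ge_zero order_trans by blast
  have "L2norm lborel (\<lambda>x. T0 (x + axis k c) - T0 x - c *\<^sub>R T1 x) \<le> c\<^sup>2 * (2 * B * L2norm lborel (\<lambda>x::real^'n. indicator S x))"
    if c: "\<bar>c\<bar> \<le> 1" for c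
  proof -
    have "L2norm lborel (\<lambda>x. T0 (x + axis k c) - T0 x - c *\<^sub>R T1 x)
        \<le> (2 * B * c\<^sup>2) * L2norm lborel (\<lambda>x::real^'n. indicator S x)"
    proof (rule L2norm_dominated[OF ind])
      have [measurable]: "T0 \<in> borel_measurable borel" "T1 \<in> borel_measurable borel"
        using cont by (auto intro: borel_measurable_continuous_onI)
      show "(\<lambda>x. T0 (x + axis k c) - T0 x - c *\<^sub>R T1 x) \<in> borel_measurable lborel" by measurable
      show "0 \<le> 2 * B * c\<^sup>2" using B0 by simp
      fix x :: "real ^ 'n"
      show "cmod (T0 (x + axis k c) - T0 x - c *\<^sub>R T1 x) \<le> 2 * B * c\<^sup>2 * cmod (indicator S x)"
      proof (cases "x \<in> S")
        case True
        show ?thesis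
        proof (cases "c = 0")
          case False
          have "cmod (T0 (x + axis k c) - T0 (x + axis k 0) - (c - 0) *\<^sub>R T1 (x + axis k 0)) \<le> \<bar>c - 0\<bar> * (B * (2 * \<bar>c\<bar>))"
          \<comment> \<open>The neighbourhood must contain \<open>c\<close> in its interior, hence the factor \<open>2\<close>.\<close>
          proof (rule real_linearization[where d="2 * \<bar>c\<bar>" and g="\<lambda>c. T0 (x + axis k c)"])
            show "cmod (T1 (x + axis k t) - T1 (x + axis k 0)) \<le> B * (2 * \<bar>c\<bar>)" if "\<bar>t - 0\<bar> < 2 * \<bar>c\<bar>" for t
              using order_trans[OF lip[of x t] mult_left_mono[of "\<bar>t\<bar>" "2 * \<bar>c\<bar>" B]] that B0 by (simp add: ax0)
          qed (use d0 False in auto)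
          also have "\<dots> = 2 * B * c\<^sup>2" by (simp add: power2_eq_square abs_mult[symmetric])
          finally show ?thesis using True by (simp add: ax0)
        qed (simp add: ax0)
      next
        case False
        then have n: "R + 1 < norm x" by (simp add: S_def)
        have "norm (axis k c :: real ^ 'n) \<le> 1" using c by (simp add: norm_eq_sqrt_inner inner_axis_axis)
        then have "R < norm (x + axis k c)"
          using n norm_triangle_ineq2[of x "- axis k c"] by simp
        then show ?thesis using n B0 by (simp add: T0_def T1_def R)
      qed
    qed
    then show ?thesis by (simp add: algebra_simps)
  qed
  then show ?thesis using that unfolding T0_def T1_def by blast
qed

text \<open>
  The Galilean symmetry of the free Schroedinger equation: the initial datum is multiplied by
  \<open>e\<^bsup>i d x\<^sub>k\<^esup>\<close>, and the solution travels with velocity \<open>2 d\<close> in direction \<open>k\<close>.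
\<close>

definition galilean_boost :: "real \<Rightarrow> 'n \<Rightarrow> (real \<Rightarrow> real ^ 'n \<Rightarrow> complex) \<Rightarrow> real \<Rightarrow> real ^ 'n \<Rightarrow> complex" where
  "galilean_boost d k v = (\<lambda>t x. cis (d * x $ k - d\<^sup>2 * t) * v t (axis k (- (2 * d * t)) + x))"

lemma cis_measurable [measurable]:
  "(\<lambda>x :: real ^ 'n. cis (a * x $ k + b)) \<in> borel_measurable borel"
  "(\<lambda>x :: real ^ 'n. cis (a * x $ k - b)) \<in> borel_measurable borel"
  "(\<lambda>x :: real ^ 'n. cis (a * x $ k)) \<in> borel_measurable borel"
  by (intro borel_measurable_continuous_onI continuous_intros)+

lemma square_integrable_galilean_boost:
  assumes "square_integrable lborel (v t)"
  shows "square_integrable lborel (galilean_boost d k v t)"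
proof -
  have [measurable]: "v t \<in> borel_measurable borel" using assms by (simp add: square_integrable_def)
  show ?thesis
    by (rule square_integrable_dominated[OF square_integrable_translate[OF assms], where c=1])
       (auto simp: galilean_boost_def norm_mult)
qed

text \<open>
  Up to the unimodular factor \<open>e\<^bsup>i d x\<^sub>k\<^esup>\<close> a boost is a translate by \<open>a t\<close> times a phase \<open>p t\<close>. The
  three error terms come from the change of the state, of the translation and of the phase.
\<close>

lemma galilean_boost_continuous:
  fixes v :: "real \<Rightarrow> real ^ 'n \<Rightarrow> complex"
  assumes sq: "\<And>t. 0 \<le> t \<Longrightarrow> square_integrable lborel (v t)"
    and cont: "((\<lambda>t. L2norm lborel (\<lambda>x. v t x - v s x)) \<longlongrightarrow> 0) (at s within {0..})" and s: "0 \<le> s"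
  shows "((\<lambda>t. L2norm lborel (\<lambda>x. galilean_boost d k v t x - galilean_boost d k v s x)) \<longlongrightarrow> 0) (at s within {0..})"
proof -
  define a where "a = (\<lambda>t. axis k (- (2 * d * t)) :: real ^ 'n)"
  define p where "p = (\<lambda>t. cis (- (d\<^sup>2 * t)))"
  define \<omega> where "\<omega> = (\<lambda>h. L2norm lborel (\<lambda>x. v s (h + x) - v s x))"
  have [measurable]: "v s \<in> borel_measurable borel" using sq[OF s] by (simp add: square_integrable_def)
  have bound: "L2norm lborel (\<lambda>x. galilean_boost d k v t x - galilean_boost d k v s x)
      \<le> L2norm lborel (\<lambda>x. v t x - v s x) + \<omega> (a t - a s) + cmod (p t - p s) * L2norm lborel (v s)" if t: "0 \<le> t" for t
  proof -
    have [measurable]: "v t \<in> borel_measurable borel" using sq[OF t] by (simp add: square_integrable_def)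
    note sqs = square_integrable_translate[OF sq[OF t], of "a t"] square_integrable_translate[OF sq[OF s], of "a t"]
      square_integrable_translate[OF sq[OF s], of "a s"]
    define A B C where "A = (\<lambda>x. v t (a t + x) - v s (a t + x))"
      and "B = (\<lambda>x. v s (a t + x) - v s (a s + x))" and "C = (\<lambda>x. (p t - p s) * v s (a s + x))"
    have ABC: "square_integrable lborel A" "square_integrable lborel B" "square_integrable lborel C"
      unfolding A_def B_def C_def by (intro square_integrable_diff square_integrable_mult_left sqs)+
    have "galilean_boost d k v t x - galilean_boost d k v s x = cis (d * x $ k) * (p t * A x + p t * B x + C x)" for x
    proof -
      have "cis (d * x $ k - d\<^sup>2 * t) = cis (d * x $ k) * p t" for t
        by (simp add: p_def cis_mult)
      then show ?thesis by (simp add: galilean_boost_def A_def B_def C_def a_def algebra_simps)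
    qed
    then have "L2norm lborel (\<lambda>x. galilean_boost d k v t x - galilean_boost d k v s x)
        = L2norm lborel (\<lambda>x. p t * A x + p t * B x + C x)"
      by (simp add: L2norm_def norm_mult)
    also have "\<dots> \<le> L2norm lborel (\<lambda>x. p t * A x + p t * B x) + L2norm lborel C"
      by (intro L2norm_triangle square_integrable_add square_integrable_mult_left ABC)
    also have "\<dots> \<le> L2norm lborel (\<lambda>x. p t * A x) + L2norm lborel (\<lambda>x. p t * B x) + L2norm lborel C"
      by (intro add_right_mono L2norm_triangle square_integrable_mult_left ABC)
    also have "\<dots> = L2norm lborel A + L2norm lborel B + L2norm lborel C"
      by (simp add: L2norm_mult_left p_def)
    also have "L2norm lborel A = L2norm lborel (\<lambda>x. v t x - v s x)"
      unfolding A_def by (rule L2norm_translate) measurable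
    also have "L2norm lborel B = \<omega> (a t - a s)"
      using L2norm_translate[of "\<lambda>x. v s (a t - a s + x) - v s x" "a s"]
      by (simp add: B_def \<omega>_def add.assoc[symmetric])
    also have "L2norm lborel C = cmod (p t - p s) * L2norm lborel (v s)"
      using L2norm_translate[of "v s" "a s"] by (simp add: C_def L2norm_mult_left)
    finally show ?thesis .
  qed
  have "isCont \<omega> 0"
    unfolding isCont_def using L2_translation_tendsto[OF sq[OF s]] by (simp add: \<omega>_def)
  moreover have "((\<lambda>t. a t - a s) \<longlongrightarrow> 0) (at s within {0..})"
  proof -
    have "a t - a s = (s - t) *\<^sub>R axis k (2 * d)" for t
      by (simp add: a_def axis_def vec_eq_iff algebra_simps)
    moreover have "((\<lambda>t. (s - t) *\<^sub>R axis k (2 * d)) \<longlongrightarrow> (s - s) *\<^sub>R (axis k (2 * d) :: real ^ 'n)) (at s within {0..})"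
      by (intro tendsto_intros)
    ultimately show ?thesis by simp
  qed
  ultimately have "((\<lambda>t. \<omega> (a t - a s)) \<longlongrightarrow> \<omega> 0) (at s within {0..})"
    by (rule isCont_tendsto_compose)
  moreover have "\<omega> 0 = 0" by (simp add: \<omega>_def)
  moreover have "((\<lambda>t. cmod (p t - p s) * L2norm lborel (v s)) \<longlongrightarrow> cmod (p s - p s) * L2norm lborel (v s)) (at s within {0..})"
    unfolding p_def by (intro tendsto_intros)
  ultimately have "((\<lambda>t. L2norm lborel (\<lambda>x. v t x - v s x) + \<omega> (a t - a s) + cmod (p t - p s) * L2norm lborel (v s))
      \<longlongrightarrow> 0) (at s within {0..})"
    using tendsto_add[OF tendsto_add[OF cont]] by fastforce
  then show ?thesis
    by (rule Lim_null_comparison[rotated]) (use bound in \<open>auto simp: eventually_at_filter\<close>)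
qed

lemma tensor_split:
  "tensor H a x = H k (a k) (x $ k) * (\<Prod>i\<in>UNIV - {k}. H i (a i) (x $ i))"
  unfolding tensor_def by (rule prod.remove) auto

text \<open>
  The factors of \<open>x \<mapsto> e\<^bsup>i d x\<^sub>k\<^esup> \<phi>(x + c e\<^sub>k)\<close> for \<open>\<phi> = tensor F (\<lambda>_. 0)\<close>. Transposing a boost moves
  it from the solution to the test function, where it takes this form.
\<close>

definition boosted_factors :: "real \<Rightarrow> 'n::finite \<Rightarrow> ('n \<Rightarrow> nat \<Rightarrow> real \<Rightarrow> complex) \<Rightarrow> real \<Rightarrow> 'n \<Rightarrow> nat \<Rightarrow> real \<Rightarrow> complex" where
  "boosted_factors d k F c i = (if i = k then modulated d (\<lambda>j x. F k j (x + c)) else F i)"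

lemma jet_boosted_factors:
  assumes "\<And>i. jet (F i)" shows "jet (boosted_factors d k F c i)"
  using assms by (simp add: boosted_factors_def jet_modulated jet_translate)

lemma tensor_boosted_factors:
  assumes "a k = 0"
  shows "tensor (boosted_factors d k F c) a x = cis (d * x $ k) * tensor F a (x + axis k c)"
proof -
  have "(\<Prod>i\<in>UNIV - {k}. boosted_factors d k F c i (a i) (x $ i))
      = (\<Prod>i\<in>UNIV - {k}. F i (a i) ((x + axis k c) $ i))"
    by (intro prod.cong) (auto simp: boosted_factors_def axis_def)
  then show ?thesis
    unfolding tensor_split[of _ _ _ k] by (simp add: assms boosted_factors_def modulated_0 axis_def)
qed

lemma tensor_boosted_factors_2:
  "tensor (boosted_factors d k F c) ((\<lambda>_. 0)(k := 2)) x = cis (d * x $ k) *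
     (tensor F ((\<lambda>_. 0)(k := 2)) (x + axis k c)
      + 2 * \<i> * of_real d * tensor F ((\<lambda>_. 0)(k := 1)) (x + axis k c)
      - of_real (d\<^sup>2) * tensor F (\<lambda>_. 0) (x + axis k c))"
proof -
  define p where "p = (\<Prod>i\<in>UNIV - {k}. F i 0 ((x + axis k c) $ i))"
  have "(\<Prod>i\<in>UNIV - {k}. boosted_factors d k F c i (((\<lambda>_. 0)(k := 2)) i) (x $ i)) = p"
    unfolding p_def by (intro prod.cong) (auto simp: boosted_factors_def axis_def)
  moreover have "(\<Prod>i\<in>UNIV - {k}. F i (((\<lambda>_. 0)(k := m)) i) ((x + axis k c) $ i)) = p" for m
    unfolding p_def by (intro prod.cong) auto
  ultimately show ?thesis
    unfolding tensor_split[of _ _ _ k]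
    by (simp add: boosted_factors_def modulated_2 axis_def p_def[symmetric] algebra_simps)
qed

lemma laplacian_boosted_factors:
  fixes F :: "'n::finite \<Rightarrow> nat \<Rightarrow> real \<Rightarrow> complex"
  assumes F: "\<And>i. jet (F i)"
  shows "laplacian (tensor (boosted_factors d k F c) (\<lambda>_. 0)) x = cis (d * x $ k) *
     (laplacian (tensor F (\<lambda>_. 0)) (x + axis k c)
      + 2 * \<i> * of_real d * tensor F ((\<lambda>_. 0)(k := 1)) (x + axis k c)
      - of_real (d\<^sup>2) * tensor F (\<lambda>_. 0) (x + axis k c))"
proof -
  define y where "y = x + axis k c"
  define E where "E = cis (d * x $ k) * (2 * \<i> * of_real d * tensor F ((\<lambda>_. 0)(k := 1)) y
      - of_real (d\<^sup>2) * tensor F (\<lambda>_. 0) y)"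
  have "tensor (boosted_factors d k F c) ((\<lambda>_. 0)(j := 0 + 2)) x
      = cis (d * x $ k) * tensor F ((\<lambda>_. 0)(j := 0 + 2)) y + (if j = k then E else 0)" for j
  proof (cases "j = k")
    case True
    then show ?thesis
      using tensor_boosted_factors_2[of d k F c x] by (simp add: E_def y_def algebra_simps numeral_2_eq_2)
  next
    case False
    then show ?thesis
      using tensor_boosted_factors[of "(\<lambda>_. 0)(j := 0 + 2)" k d F c x] by (simp add: y_def)
  qed
  then have "laplacian (tensor (boosted_factors d k F c) (\<lambda>_. 0)) x
      = (\<Sum>j\<in>UNIV. cis (d * x $ k) * tensor F ((\<lambda>_. 0)(j := 0 + 2)) y + (if j = k then E else 0))"
    using laplacian_tensor[of "boosted_factors d k F c", OF jet_boosted_factors[of F, OF F]] by simp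
  also have "\<dots> = cis (d * x $ k) * laplacian (tensor F (\<lambda>_. 0)) y + E"
    using laplacian_tensor[of F "\<lambda>_. 0" y, OF F] by (simp add: sum.distrib sum_distrib_left)
  finally show ?thesis by (simp add: E_def y_def algebra_simps)
qed

text \<open>
  The derivative of \<open>\<langle>v s, \<Phi>(2 d s)\<rangle>\<close> has two parts. The equation gives \<open>i \<langle>v, \<Delta>\<Phi>\<rangle>\<close>, with
  \<open>\<Delta>\<Phi> = \<Lambda> + 2 i d \<Psi> - d\<^sup>2 \<Phi>\<close> and \<open>\<Psi>\<close> the modulated first derivative; the motion of the test
  function gives \<open>2 d \<langle>v, \<Psi>\<rangle>\<close>. The terms with \<open>\<Psi>\<close> cancel. That is why the velocity is \<open>2 d\<close>.
\<close>

lemma moving_test_function_derivative: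
  fixes F :: "'n::finite \<Rightarrow> nat \<Rightarrow> real \<Rightarrow> complex" and d :: real and k :: 'n
  assumes v: "weak_solution v" and F: "\<And>i. jet (F i)" and t: "0 < t"
  defines "\<Phi> \<equiv> \<lambda>c x. cis (d * x $ k) * tensor F (\<lambda>_. 0) (x + axis k c)"
    and "\<Lambda> \<equiv> \<lambda>c x. cis (d * x $ k) * laplacian (tensor F (\<lambda>_. 0)) (x + axis k c)"
  shows "((\<lambda>s. LINT x|lborel. v s x * \<Phi> (2 * d * s) x) has_vector_derivative
     \<i> * (LINT x|lborel. v t x * \<Lambda> (2 * d * t) x) - \<i> * of_real (d\<^sup>2) * (LINT x|lborel. v t x * \<Phi> (2 * d * t) x)) (at t)"
proof -
  define T1 where "T1 = tensor F ((\<lambda>_. 0)(k := 1))"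
  define \<Psi> where "\<Psi> = (\<lambda>c x. cis (d * x $ k) * T1 (x + axis k c))"
  define c where "c = 2 * d * t"
  have sq: "square_integrable lborel (v s)" if "0 \<le> s" for s
    using v that by (simp add: weak_solution_def)
  have mod_sq: "square_integrable lborel (\<lambda>x. cis (d * x $ k) * g (x + axis k c))"
    and mod_norm: "L2norm lborel (\<lambda>x. cis (d * x $ k) * g (x + axis k c)) = L2norm lborel g"
    if g: "square_integrable lborel g" for g :: "real ^ 'n \<Rightarrow> complex" and c
  proof -
    have [measurable]: "g \<in> borel_measurable borel" using g by (simp add: square_integrable_def)
    show "square_integrable lborel (\<lambda>x. cis (d * x $ k) * g (x + axis k c))"
      by (rule square_integrable_dominated[OF square_integrable_translate[OF g, of "axis k c"], where c=1])
         (auto simp: norm_mult add.commute)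
    show "L2norm lborel (\<lambda>x. cis (d * x $ k) * g (x + axis k c)) = L2norm lborel g"
      using L2norm_translate[of g "axis k c"] by (simp add: L2norm_def norm_mult add.commute)
  qed
  have T0sq: "square_integrable lborel (tensor F (\<lambda>_. 0))" and T1sq: "square_integrable lborel T1"
    and Lsq: "square_integrable lborel (laplacian (tensor F (\<lambda>_. 0)))"
  proof -
    show "square_integrable lborel (tensor F (\<lambda>_. 0))" "square_integrable lborel T1"
      unfolding T1_def by (intro square_integrable_tensor F)+
    show "square_integrable lborel (laplacian (tensor F (\<lambda>_. 0)))"
      by (rule square_integrable_laplacian_tensor[OF F])
  qed
  have \<Phi>sq: "square_integrable lborel (\<Phi> c)" and \<Psi>sq: "square_integrable lborel (\<Psi> c)"
    and \<Lambda>sq: "square_integrable lborel (\<Lambda> c)" for c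
    unfolding \<Phi>_def \<Psi>_def \<Lambda>_def by (intro mod_sq T0sq T1sq Lsq)+
  note int = integrable_mult_square_integrable

  have P: "((\<lambda>s. LINT x|lborel. v s x * \<Phi> c x) has_vector_derivative
      \<i> * (LINT x|lborel. v t x * (\<Lambda> c x + 2 * \<i> * of_real d * \<Psi> c x - of_real (d\<^sup>2) * \<Phi> c x))) (at t)"
  proof -
    have "\<forall>i. jet (boosted_factors d k F c i)" using jet_boosted_factors[of F, OF F] by blast
    then have "((\<lambda>s. LINT x|lborel. v s x * tensor (boosted_factors d k F c) (\<lambda>_. 0) x) has_vector_derivative
          \<i> * (LINT x|lborel. v t x * laplacian (tensor (boosted_factors d k F c) (\<lambda>_. 0)) x)) (at t)"
      using v t unfolding weak_solution_def by blast
    moreover have "tensor (boosted_factors d k F c) (\<lambda>_. 0) = \<Phi> c"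
      unfolding \<Phi>_def by (rule ext) (rule tensor_boosted_factors, simp)
    moreover have "laplacian (\<Phi> c) x = \<Lambda> c x + 2 * \<i> * of_real d * \<Psi> c x - of_real (d\<^sup>2) * \<Phi> c x" for x
      using laplacian_boosted_factors[of F d k c x, OF F] calculation(2)
      by (simp add: \<Lambda>_def \<Psi>_def \<Phi>_def T1_def algebra_simps)
    ultimately show ?thesis by simp
  qed

  obtain C where C: "\<And>c. \<bar>c\<bar> \<le> 1 \<Longrightarrow> L2norm lborel (\<lambda>x. tensor F (\<lambda>_. 0) (x + axis k c) - tensor F (\<lambda>_. 0) x
      - c *\<^sub>R T1 x) \<le> c\<^sup>2 * C"
    unfolding T1_def using tensor_taylor_L2[of F k, OF F] by blast
  have C0: "0 \<le> C" using C[of 1] order_trans[OF L2norm_nonneg] by auto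
  define N where "N = (\<lambda>s. L2norm lborel (\<lambda>x. v s x - v t x))"
  have N0: "(N \<longlongrightarrow> 0) (at t)"
  proof -
    have "(N \<longlongrightarrow> 0) (at t within {0..})"
      unfolding N_def using v t by (simp add: weak_solution_def)
    moreover have "at t within {0..} = at t"
      using t by (intro at_within_interior) simp
    ultimately show ?thesis by simp
  qed
  have Q: "((\<lambda>s. LINT x|lborel. v s x * (\<Phi> (2 * d * s) x - \<Phi> c x)) has_vector_derivative
      of_real (2 * d) * (LINT x|lborel. v t x * \<Psi> c x)) (at t)"
  proof (rule has_vector_derivative_null_comparison)
    let ?\<rho> = "\<lambda>s. 2 * \<bar>d\<bar> * (N s * L2norm lborel (\<Psi> c)) + (L2norm lborel (v t) + N s) * (4 * d\<^sup>2 * \<bar>s - t\<bar> * C)"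
    have "(?\<rho> \<longlongrightarrow> 2 * \<bar>d\<bar> * (0 * L2norm lborel (\<Psi> c)) + (L2norm lborel (v t) + 0) * (4 * d\<^sup>2 * \<bar>t - t\<bar> * C)) (at t)"
      by (intro tendsto_intros N0)
    then show "(?\<rho> \<longlongrightarrow> 0) (at t)" by simp
    have "((\<lambda>s. \<bar>2 * d * (s - t)\<bar>) \<longlongrightarrow> \<bar>2 * d * (t - t)\<bar>) (at t)" by (intro tendsto_intros)
    then have "\<forall>\<^sub>F s in at t. \<bar>2 * d * (s - t)\<bar> < 1" by (rule order_tendstoD) simp
    moreover have "\<forall>\<^sub>F s in at t. 0 < s"
      using order_tendstoD(1)[OF tendsto_ident_at t] by simp
    ultimately show "\<forall>\<^sub>F s in at t. norm ((LINT x|lborel. v s x * (\<Phi> (2 * d * s) x - \<Phi> c x))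
        - (LINT x|lborel. v t x * (\<Phi> (2 * d * t) x - \<Phi> c x))
        - (s - t) *\<^sub>R (of_real (2 * d) * (LINT x|lborel. v t x * \<Psi> c x))) \<le> \<bar>s - t\<bar> * ?\<rho> s"
    proof eventually_elim
      case (elim s)
      define \<delta> where "\<delta> = 2 * d * (s - t)"
      define Rm where "Rm = (\<lambda>x. tensor F (\<lambda>_. 0) (x + axis k \<delta>) - tensor F (\<lambda>_. 0) x - \<delta> *\<^sub>R T1 x)"
      have s0: "0 \<le> s" and t0: "0 \<le> t" using elim t by auto
      have Rm: "square_integrable lborel Rm" "L2norm lborel Rm \<le> \<delta>\<^sup>2 * C"
      proof -
        have "square_integrable lborel (\<lambda>x. tensor F (\<lambda>_. 0) (x + axis k \<delta>))"
          using square_integrable_translate[OF T0sq, of "axis k \<delta>"] by (simp add: add.commute)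
        then show "square_integrable lborel Rm"
          unfolding Rm_def scaleR_conv_of_real
          by (intro square_integrable_diff square_integrable_mult_left T0sq T1sq)
        show "L2norm lborel Rm \<le> \<delta>\<^sup>2 * C"
          unfolding Rm_def using elim by (intro C) (simp add: \<delta>_def)
      qed
      define S where "S = (\<lambda>x. cis (d * x $ k) * Rm (x + axis k c))"
      have S: "square_integrable lborel S" "L2norm lborel S \<le> \<delta>\<^sup>2 * C"
        unfolding S_def using mod_sq[OF Rm(1), of c] mod_norm[OF Rm(1), of c] Rm(2) by auto
      have split: "\<Phi> (2 * d * s) x - \<Phi> c x = of_real \<delta> * \<Psi> c x + S x" for x
      proof -
        have "x + axis k (2 * d * s) = x + axis k c + axis k \<delta>"
          by (simp add: c_def \<delta>_def axis_def vec_eq_iff algebra_simps)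
        then show ?thesis
          by (simp add: \<Phi>_def \<Psi>_def S_def Rm_def scaleR_conv_of_real algebra_simps)
      qed
      have "(LINT x|lborel. v s x * (\<Phi> (2 * d * s) x - \<Phi> c x))
          = (LINT x|lborel. of_real \<delta> * (v s x * \<Psi> c x) + v s x * S x)"
        unfolding split by (simp add: algebra_simps)
      also have "\<dots> = of_real \<delta> * (LINT x|lborel. v s x * \<Psi> c x) + (LINT x|lborel. v s x * S x)"
        using int[OF sq[OF s0] \<Psi>sq[of c]] int[OF sq[OF s0] S(1)] by simp
      finally have 1: "(LINT x|lborel. v s x * (\<Phi> (2 * d * s) x - \<Phi> c x))
          = of_real \<delta> * (LINT x|lborel. v s x * \<Psi> c x) + (LINT x|lborel. v s x * S x)" .
      have 2: "(LINT x|lborel. v s x * \<Psi> c x) - (LINT x|lborel. v t x * \<Psi> c x)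
          = (LINT x|lborel. (v s x - v t x) * \<Psi> c x)"
        using int[OF sq[OF s0] \<Psi>sq[of c]] int[OF sq[OF t0] \<Psi>sq[of c]] by (simp add: left_diff_distrib)
      have 4: "(LINT x|lborel. v t x * (\<Phi> (2 * d * t) x - \<Phi> c x)) = 0"
        by (simp add: c_def)
      have 3: "(s - t) *\<^sub>R (of_real (2 * d) * z) = of_real \<delta> * z" for z :: complex
        by (simp add: \<delta>_def scaleR_conv_of_real mult_ac)
      have "norm ((LINT x|lborel. v s x * (\<Phi> (2 * d * s) x - \<Phi> c x))
        - (LINT x|lborel. v t x * (\<Phi> (2 * d * t) x - \<Phi> c x))
        - (s - t) *\<^sub>R (of_real (2 * d) * (LINT x|lborel. v t x * \<Psi> c x)))
        = norm (of_real \<delta> * (LINT x|lborel. (v s x - v t x) * \<Psi> c x) + (LINT x|lborel. v s x * S x))"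
        unfolding 1 3 4 2[symmetric] by (simp add: algebra_simps)
      also have "\<dots> \<le> \<bar>\<delta>\<bar> * (N s * L2norm lborel (\<Psi> c)) + L2norm lborel (v s) * L2norm lborel S"
        using Cauchy_Schwarz_L2norm[OF square_integrable_diff[OF sq[OF s0] sq[OF t0]] \<Psi>sq[of c]]
          Cauchy_Schwarz_L2norm[OF sq[OF s0] S(1)]
        by (intro norm_triangle_le add_mono) (auto simp: norm_mult N_def intro!: mult_left_mono)
      also have "\<dots> \<le> \<bar>\<delta>\<bar> * (N s * L2norm lborel (\<Psi> c)) + (L2norm lborel (v t) + N s) * (\<delta>\<^sup>2 * C)"
        using L2norm_diff_diff[OF sq[OF s0] sq[OF t0]] S(2)
        by (intro add_left_mono mult_mono) (auto simp: N_def)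
      also have "\<dots> = \<bar>s - t\<bar> * ?\<rho> s"
      proof -
        have "\<bar>\<delta>\<bar> = 2 * \<bar>d\<bar> * \<bar>s - t\<bar>" by (simp add: \<delta>_def abs_mult)
        moreover have "\<delta>\<^sup>2 = 4 * d\<^sup>2 * \<bar>s - t\<bar> * \<bar>s - t\<bar>"
          by (simp add: \<delta>_def power2_eq_square)
        ultimately show ?thesis by (simp only: distrib_left mult_ac)
      qed
      finally show ?case .
    qed
  qed
  have "((\<lambda>s. (LINT x|lborel. v s x * \<Phi> c x) + (LINT x|lborel. v s x * (\<Phi> (2 * d * s) x - \<Phi> c x))) has_vector_derivative
      \<i> * (LINT x|lborel. v t x * (\<Lambda> c x + 2 * \<i> * of_real d * \<Psi> c x - of_real (d\<^sup>2) * \<Phi> c x))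
      + of_real (2 * d) * (LINT x|lborel. v t x * \<Psi> c x)) (at t)"
    by (rule has_vector_derivative_add[OF P Q])
  then have D: "((\<lambda>s. LINT x|lborel. v s x * \<Phi> (2 * d * s) x) has_vector_derivative
      \<i> * (LINT x|lborel. v t x * (\<Lambda> c x + 2 * \<i> * of_real d * \<Psi> c x - of_real (d\<^sup>2) * \<Phi> c x))
      + of_real (2 * d) * (LINT x|lborel. v t x * \<Psi> c x)) (at t)"
  proof (rule has_vector_derivative_transform_within_open[where S="{0<..}"])
    show "(LINT x|lborel. v s x * \<Phi> c x) + (LINT x|lborel. v s x * (\<Phi> (2 * d * s) x - \<Phi> c x))
        = (LINT x|lborel. v s x * \<Phi> (2 * d * s) x)" if "s \<in> {0<..}" for s
      using int[OF sq \<Phi>sq[of c], of s] int[OF sq \<Phi>sq[of "2 * d * s"], of s] that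
      by (simp add: right_diff_distrib)
  qed (use t in auto)
  have E: "(LINT x|lborel. v t x * (\<Lambda> c x + 2 * \<i> * of_real d * \<Psi> c x - of_real (d\<^sup>2) * \<Phi> c x))
      = (LINT x|lborel. v t x * \<Lambda> c x) + 2 * \<i> * of_real d * (LINT x|lborel. v t x * \<Psi> c x)
        - of_real (d\<^sup>2) * (LINT x|lborel. v t x * \<Phi> c x)"
  proof -
    have t0: "0 \<le> t" using t by simp
    have "(LINT x|lborel. v t x * (\<Lambda> c x + 2 * \<i> * of_real d * \<Psi> c x - of_real (d\<^sup>2) * \<Phi> c x))
      = (LINT x|lborel. v t x * \<Lambda> c x + 2 * \<i> * of_real d * (v t x * \<Psi> c x) - of_real (d\<^sup>2) * (v t x * \<Phi> c x))"
      by (simp add: algebra_simps)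
    then show ?thesis
      using int[OF sq[OF t0] \<Phi>sq[of c]] int[OF sq[OF t0] \<Psi>sq[of c]] int[OF sq[OF t0] \<Lambda>sq[of c]] by simp
  qed
  show ?thesis
    unfolding c_def[symmetric]
    by (rule has_vector_derivative_eq_rhs[OF D]) (simp only: E, simp add: algebra_simps)
qed

lemma integral_galilean_boost:
  fixes g :: "real ^ 'n \<Rightarrow> complex"
  assumes [measurable]: "v t \<in> borel_measurable borel" "g \<in> borel_measurable borel"
  shows "(LINT x|lborel. galilean_boost d k v t x * g x)
    = cis (d\<^sup>2 * t) * (LINT x|lborel. v t x * (cis (d * x $ k) * g (x + axis k (2 * d * t))))"
proof -
  have ax: "axis k (- (2 * d * t)) + (axis k (2 * d * t) + x) = x" for x :: "real ^ 'n"
    by (simp add: axis_def vec_eq_iff)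
  have ph: "cis (d * (axis k (2 * d * t) + x) $ k - d\<^sup>2 * t) = cis (d\<^sup>2 * t) * cis (d * x $ k)" for x :: "real ^ 'n"
    by (simp add: cis_mult axis_def power2_eq_square algebra_simps)
  have "(LINT x|lborel. galilean_boost d k v t x * g x)
      = (LINT x|lborel. galilean_boost d k v t (axis k (2 * d * t) + x) * g (axis k (2 * d * t) + x))"
    by (subst lborel_integral_translate) (auto simp: galilean_boost_def)
  also have "\<dots> = (LINT x|lborel. cis (d\<^sup>2 * t) * (v t x * (cis (d * x $ k) * g (x + axis k (2 * d * t)))))"
    unfolding galilean_boost_def ax ph by (simp only: add.commute mult_ac)
  finally show ?thesis by simp
qed

text \<open>
  The phase \<open>e\<^bsup>i d\<^sup>2 s\<^esup>\<close>, which appears when the boost is transposed, removes the remaining term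
  \<open>- i d\<^sup>2 \<langle>v, \<Phi>\<rangle>\<close>.
\<close>

lemma weak_solution_galilean_boost:
  fixes v :: "real \<Rightarrow> real ^ 'n \<Rightarrow> complex"
  assumes v: "weak_solution v"
  shows "weak_solution (galilean_boost d k v)"
  unfolding weak_solution_def
proof (intro conjI allI impI)
  have sq: "square_integrable lborel (v s)" if "0 \<le> s" for s
    using v that by (simp add: weak_solution_def)
  show "square_integrable lborel (galilean_boost d k v t)" if "0 \<le> t" for t
    by (rule square_integrable_galilean_boost[of v t, OF sq[OF that]])
  show "((\<lambda>t. L2norm lborel (\<lambda>x. galilean_boost d k v t x - galilean_boost d k v s x)) \<longlongrightarrow> 0) (at s within {0..})"
    if "0 \<le> s" for s
    using v that by (intro galilean_boost_continuous sq) (auto simp: weak_solution_def)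
  fix F :: "'n \<Rightarrow> nat \<Rightarrow> real \<Rightarrow> complex" and t :: real
  assume "\<forall>i. jet (F i)" and t: "0 < t"
  then have F: "jet (F i)" for i by blast
  define \<Phi> where "\<Phi> = (\<lambda>c x. cis (d * x $ k) * tensor F (\<lambda>_. 0) (x + axis k c))"
  define \<Lambda> where "\<Lambda> = (\<lambda>c x. cis (d * x $ k) * laplacian (tensor F (\<lambda>_. 0)) (x + axis k c))"
  define A B where "A = (LINT x|lborel. v t x * \<Phi> (2 * d * t) x)" and "B = (LINT x|lborel. v t x * \<Lambda> (2 * d * t) x)"
  have vm: "v s \<in> borel_measurable borel" if "0 < s" for s
    using sq[of s] that by (simp add: square_integrable_def)
  have Tm: "tensor F (\<lambda>_. 0) \<in> borel_measurable borel"
    by (intro borel_measurable_continuous_onI tensor_continuous F)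
  have Lm: "laplacian (tensor F (\<lambda>_. 0)) \<in> borel_measurable borel"
    using square_integrable_laplacian_tensor[of F "\<lambda>_. 0", OF F] by (simp add: square_integrable_def)
  have cis_deriv: "((\<lambda>s. cis (d\<^sup>2 * s)) has_vector_derivative \<i> * of_real (d\<^sup>2) * cis (d\<^sup>2 * t)) (at t)"
    using derivative_chainD[OF derivative_chain_cis[of "d\<^sup>2"], of 0 t] by simp
  have "((\<lambda>s. LINT x|lborel. v s x * \<Phi> (2 * d * s) x) has_vector_derivative
     \<i> * B - \<i> * of_real (d\<^sup>2) * A) (at t)"
    unfolding A_def B_def \<Phi>_def \<Lambda>_def by (rule moving_test_function_derivative[OF v F t])
  from has_vector_derivative_mult[OF cis_deriv this, folded A_def]
  have "((\<lambda>s. cis (d\<^sup>2 * s) * (LINT x|lborel. v s x * \<Phi> (2 * d * s) x)) has_vector_derivative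
      \<i> * (cis (d\<^sup>2 * t) * B)) (at t)"
  proof (rule has_vector_derivative_eq_rhs)
    show "cis (d\<^sup>2 * t) * (\<i> * B - \<i> * of_real (d\<^sup>2) * A) + \<i> * of_real (d\<^sup>2) * cis (d\<^sup>2 * t) * A
        = \<i> * (cis (d\<^sup>2 * t) * B)"
      by (simp add: algebra_simps)
  qed
  then have "((\<lambda>s. LINT x|lborel. galilean_boost d k v s x * tensor F (\<lambda>_. 0) x) has_vector_derivative
      \<i> * (cis (d\<^sup>2 * t) * B)) (at t)"
  proof (rule has_vector_derivative_transform_within_open[where S="{0<..}"])
    show "cis (d\<^sup>2 * s) * (LINT x|lborel. v s x * \<Phi> (2 * d * s) x)
        = (LINT x|lborel. galilean_boost d k v s x * tensor F (\<lambda>_. 0) x)" if "s \<in> {0<..}" for s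
      using integral_galilean_boost[of v s, OF vm Tm] that by (simp add: \<Phi>_def)
  qed (use t in auto)
  moreover have "cis (d\<^sup>2 * t) * B = (LINT x|lborel. galilean_boost d k v t x * laplacian (tensor F (\<lambda>_. 0)) x)"
    using integral_galilean_boost[of v t, OF vm[OF t] Lm] by (simp add: B_def \<Lambda>_def)
  ultimately show "((\<lambda>s. LINT x|lborel. galilean_boost d k v s x * tensor F (\<lambda>_. 0) x) has_vector_derivative
      \<i> * (LINT x|lborel. galilean_boost d k v t x * laplacian (tensor F (\<lambda>_. 0)) x)) (at t)"
    by simp
qed

lemma weak_solution_diff_sum:
  fixes v :: "real \<Rightarrow> real ^ 'n \<Rightarrow> complex"
  assumes v: "weak_solution v" and w: "\<And>j. j \<in> I \<Longrightarrow> weak_solution (w j)"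
  shows "weak_solution (\<lambda>t x. v t x - (\<Sum>j\<in>I. c j * w j t x))"
  unfolding weak_solution_def
proof (intro conjI allI impI)
  have sq: "square_integrable lborel (v s)" if "0 \<le> s" for s
    using v that by (simp add: weak_solution_def)
  have wsq: "square_integrable lborel (w j s)" if "0 \<le> s" "j \<in> I" for s j
    using w[OF that(2)] that(1) by (simp add: weak_solution_def)
  note sqI = square_integrable_diff square_integrable_sum square_integrable_mult_left sq wsq
  show "square_integrable lborel (\<lambda>x. v t x - (\<Sum>j\<in>I. c j * w j t x))" if "0 \<le> t" for t
    using that by (intro sqI)
  show "((\<lambda>t. L2norm lborel (\<lambda>x. v t x - (\<Sum>j\<in>I. c j * w j t x) - (v s x - (\<Sum>j\<in>I. c j * w j s x)))) \<longlongrightarrow> 0)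
      (at s within {0..})" if s: "0 \<le> s" for s
  proof (rule Lim_null_comparison)
    let ?b = "\<lambda>t. L2norm lborel (\<lambda>x. v t x - v s x) + (\<Sum>j\<in>I. cmod (c j) * L2norm lborel (\<lambda>x. w j t x - w j s x))"
    have "(?b \<longlongrightarrow> 0 + (\<Sum>j\<in>I. cmod (c j) * 0)) (at s within {0..})"
      using v w s by (intro tendsto_intros) (auto simp: weak_solution_def)
    then show "(?b \<longlongrightarrow> 0) (at s within {0..})" by simp
    have "L2norm lborel (\<lambda>x. v t x - (\<Sum>j\<in>I. c j * w j t x) - (v s x - (\<Sum>j\<in>I. c j * w j s x))) \<le> ?b t"
      if t: "0 \<le> t" for t
    proof -
      have "L2norm lborel (\<lambda>x. v t x - (\<Sum>j\<in>I. c j * w j t x) - (v s x - (\<Sum>j\<in>I. c j * w j s x)))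
          = L2norm lborel (\<lambda>x. (v t x - v s x) - (\<Sum>j\<in>I. c j * (w j t x - w j s x)))"
        by (simp add: right_diff_distrib sum_subtractf algebra_simps)
      also have "\<dots> \<le> L2norm lborel (\<lambda>x. v t x - v s x) + L2norm lborel (\<lambda>x. \<Sum>j\<in>I. c j * (w j t x - w j s x))"
        using s t by (intro L2norm_diff_triangle sqI)
      also have "L2norm lborel (\<lambda>x. \<Sum>j\<in>I. c j * (w j t x - w j s x))
          \<le> (\<Sum>j\<in>I. L2norm lborel (\<lambda>x. c j * (w j t x - w j s x)))"
        using s t by (intro L2norm_sum sqI)
      finally show ?thesis by (simp add: L2norm_mult_left)
    qed
    then show "\<forall>\<^sub>F t in at s within {0..}. norm (L2norm lborel (\<lambda>x. v t x - (\<Sum>j\<in>I. c j * w j t x)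
        - (v s x - (\<Sum>j\<in>I. c j * w j s x)))) \<le> ?b t"
      by (simp add: eventually_at_filter)
  qed
  fix F :: "'n \<Rightarrow> nat \<Rightarrow> real \<Rightarrow> complex" and t :: real
  assume "\<forall>i. jet (F i)" and t: "0 < t"
  then have F: "jet (F i)" for i by blast
  have Lsq: "square_integrable lborel (laplacian (tensor F (\<lambda>_. 0)))"
    by (rule square_integrable_laplacian_tensor[OF F])
  have lin: "(LINT x|lborel. (v s x - (\<Sum>j\<in>I. c j * w j s x)) * g x)
      = (LINT x|lborel. v s x * g x) - (\<Sum>j\<in>I. c j * (LINT x|lborel. w j s x * g x))"
    if s: "0 < s" and g: "square_integrable lborel g" for s g
  proof -
    have "(LINT x|lborel. (v s x - (\<Sum>j\<in>I. c j * w j s x)) * g x)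
        = (LINT x|lborel. v s x * g x - (\<Sum>j\<in>I. c j * (w j s x * g x)))"
      by (simp add: left_diff_distrib sum_distrib_right mult.assoc)
    then show ?thesis
      using integrable_mult_square_integrable[OF sq g, of s] integrable_mult_square_integrable[OF wsq g, of s] s
      by simp
  qed
  have "((\<lambda>s. (LINT x|lborel. v s x * tensor F (\<lambda>_. 0) x)
        - (\<Sum>j\<in>I. c j * (LINT x|lborel. w j s x * tensor F (\<lambda>_. 0) x))) has_vector_derivative
      \<i> * (LINT x|lborel. v t x * laplacian (tensor F (\<lambda>_. 0)) x)
        - (\<Sum>j\<in>I. c j * (\<i> * (LINT x|lborel. w j t x * laplacian (tensor F (\<lambda>_. 0)) x)))) (at t)"
    using v w t F
    by (intro has_vector_derivative_diff has_vector_derivative_sum has_vector_derivative_mult_right)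
       (auto simp: weak_solution_def)
  then have "((\<lambda>s. LINT x|lborel. (v s x - (\<Sum>j\<in>I. c j * w j s x)) * tensor F (\<lambda>_. 0) x) has_vector_derivative
      \<i> * (LINT x|lborel. v t x * laplacian (tensor F (\<lambda>_. 0)) x)
        - (\<Sum>j\<in>I. c j * (\<i> * (LINT x|lborel. w j t x * laplacian (tensor F (\<lambda>_. 0)) x)))) (at t)"
    by (rule has_vector_derivative_transform_within_open[where S="{0<..}"])
       (use t in \<open>auto simp: lin[OF _ square_integrable_tensor[of F, OF F]]\<close>)
  moreover have "\<i> * (LINT x|lborel. v t x * laplacian (tensor F (\<lambda>_. 0)) x)
        - (\<Sum>j\<in>I. c j * (\<i> * (LINT x|lborel. w j t x * laplacian (tensor F (\<lambda>_. 0)) x)))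
      = \<i> * (LINT x|lborel. (v t x - (\<Sum>j\<in>I. c j * w j t x)) * laplacian (tensor F (\<lambda>_. 0)) x)"
    by (simp add: lin[OF t Lsq] right_diff_distrib sum_distrib_left mult.left_commute)
  ultimately show "((\<lambda>s. LINT x|lborel. (v s x - (\<Sum>j\<in>I. c j * w j s x)) * tensor F (\<lambda>_. 0) x) has_vector_derivative
      \<i> * (LINT x|lborel. (v t x - (\<Sum>j\<in>I. c j * w j t x)) * laplacian (tensor F (\<lambda>_. 0)) x)) (at t)"
    by simp
qed

section \<open>Approximating one by high frequencies\<close>

text \<open>
  Expand \<open>1 = (w + (1 - w))\<^bsup>2m\<^esup>\<close>. In the terms with \<open>j < m\<close> the small number \<open>1 - w\<close> occurs to a
  power of at least \<open>m\<close>, so together they are at most \<open>4\<^sup>m 8\<^bsup>-m\<^esup>\<close>. What remains approximates \<open>1\<close>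
  and is divisible by \<open>w\<^sup>m\<close>.
\<close>

lemma binomial_tail_small:
  fixes w :: complex
  assumes m: "1 \<le> m" and w: "cmod w \<le> 1" "cmod (1 - w) \<le> 1 / 8"
  shows "cmod (1 - (\<Sum>j=m..2*m. of_nat (2 * m choose j) * w ^ j * (1 - w) ^ (2 * m - j))) \<le> 1 / 2"
proof -
  define b where "b = (\<lambda>j. of_nat (2 * m choose j) * w ^ j * (1 - w) ^ (2 * m - j))"
  have "1 = (\<Sum>j\<le>2*m. b j)"
    using binomial_ring[of w "1 - w" "2 * m"] by (simp add: b_def)
  also have "{..2*m} = {..<m} \<union> {m..2*m}" by auto
  also have "sum b ({..<m} \<union> {m..2*m}) = sum b {..<m} + sum b {m..2*m}"
    by (rule sum.union_disjoint) auto
  finally have "1 - sum b {m..2*m} = sum b {..<m}" by (simp add: algebra_simps)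
  then have "cmod (1 - sum b {m..2*m}) \<le> (\<Sum>j<m. cmod (b j))"
    by (simp add: norm_sum)
  also have "\<dots> \<le> (\<Sum>j<m. real (2 * m choose j) * (1 / 8) ^ m)"
  proof (rule sum_mono)
    fix j assume "j \<in> {..<m}"
    then have j: "m \<le> 2 * m - j" by auto
    have "cmod (b j) = real (2 * m choose j) * (cmod w ^ j * cmod (1 - w) ^ (2 * m - j))"
      by (simp add: b_def norm_mult norm_power)
    also have "cmod w ^ j * cmod (1 - w) ^ (2 * m - j) \<le> 1 * (1 / 8) ^ (2 * m - j)"
      using w by (intro mult_mono power_mono power_le_one) auto
    also have "1 * (1 / 8 :: real) ^ (2 * m - j) \<le> (1 / 8) ^ m"
      using j by (simp add: power_decreasing)
    finally show "cmod (b j) \<le> real (2 * m choose j) * (1 / 8) ^ m"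
      by (simp add: mult_left_mono)
  qed
  also have "\<dots> = real (\<Sum>j<m. 2 * m choose j) * (1 / 8) ^ m"
    by (simp add: sum_distrib_right)
  also have "\<dots> \<le> 2 ^ (2 * m) * (1 / 8) ^ m"
  proof -
    have "(\<Sum>j<m. 2 * m choose j) \<le> (\<Sum>j\<le>2*m. 2 * m choose j)"
      by (rule sum_mono2) auto
    then have "real (\<Sum>j<m. 2 * m choose j) \<le> 2 ^ (2 * m)"
      by (metis choose_row_sum of_nat_le_iff of_nat_numeral of_nat_power)
    then show ?thesis by (intro mult_right_mono) auto
  qed
  also have "\<dots> = (1 / 2) ^ m"
    unfolding power_mult power_mult_distrib[symmetric] by simp
  also have "\<dots> \<le> (1 / 2) ^ 1" using m by (intro power_decreasing) auto
  finally show ?thesis by (simp add: b_def)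
qed

lemma sum_Sigma_pairs:
  assumes "finite A" "\<And>x. x \<in> A \<Longrightarrow> finite (B x)"
  shows "sum g (Sigma A B) = (\<Sum>x\<in>A. \<Sum>y\<in>B x. g (x, y))"
  using assms by (simp add: sum.Sigma split_def)

text \<open>
  Expanding the powers of \<open>1 - w\<close> as well turns the remaining terms into a polynomial in \<open>w\<close>
  whose exponents \<open>j + l\<close> are at least \<open>m\<close>; its coefficients sum in modulus to at most
  \<open>(1 + 2)\<^bsup>2m\<^esup>\<close>. Monomials of equal degree are not collected.
\<close>

lemma binomial_tail_coefficients:
  fixes m :: nat
  defines "I \<equiv> Sigma {m..2*m} (\<lambda>j. {..2*m - j})"
    and "c \<equiv> \<lambda>(j, l). of_nat (2 * m choose j) * (of_nat (2 * m - j choose l) * (- 1) ^ l) :: complex"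
  shows "(\<Sum>i\<in>I. c i * w ^ (fst i + snd i)) = (\<Sum>j=m..2*m. of_nat (2 * m choose j) * w ^ j * (1 - w) ^ (2 * m - j))"
    and "(\<Sum>i\<in>I. cmod (c i)) \<le> 9 ^ m"
proof -
  have e: "(1 - w) ^ n = (\<Sum>l\<le>n. of_nat (n choose l) * (- 1) ^ l * w ^ l)" for n
    using binomial_ring[of "- w" 1 n] by (simp add: power_minus[of w] mult.assoc)
  show "(\<Sum>i\<in>I. c i * w ^ (fst i + snd i)) = (\<Sum>j=m..2*m. of_nat (2 * m choose j) * w ^ j * (1 - w) ^ (2 * m - j))"
    unfolding I_def e by (subst sum_Sigma_pairs)
      (auto simp: c_def sum_distrib_left power_add mult_ac intro!: sum.cong)
  have "(\<Sum>i\<in>I. cmod (c i)) = (\<Sum>j=m..2*m. \<Sum>l\<le>2*m - j. real (2 * m choose j) * real (2 * m - j choose l))"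
    unfolding I_def by (subst sum_Sigma_pairs)
      (auto simp: c_def norm_mult norm_power intro!: sum.cong)
  also have "\<dots> = (\<Sum>j=m..2*m. real (2 * m choose j) * 2 ^ (2 * m - j))"
  proof (rule sum.cong)
    fix j
    have "(\<Sum>l\<le>2*m - j. real (2 * m - j choose l)) = real (2 ^ (2 * m - j))"
      by (simp only: choose_row_sum[symmetric] of_nat_sum)
    then show "(\<Sum>l\<le>2*m - j. real (2 * m choose j) * real (2 * m - j choose l)) = real (2 * m choose j) * 2 ^ (2 * m - j)"
      by (simp add: sum_distrib_left[symmetric])
  qed simp
  also have "\<dots> \<le> (\<Sum>j\<le>2*m. real (2 * m choose j) * 2 ^ (2 * m - j))"
    by (rule sum_mono2) auto
  also have "\<dots> = (1 + 2) ^ (2 * m)"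
    using binomial_ring[of 1 "2 :: real" "2 * m"] by simp
  also have "\<dots> = 9 ^ m" by (simp add: power_mult)
  finally show "(\<Sum>i\<in>I. cmod (c i)) \<le> 9 ^ m" .
qed

lemma cmod_1_minus_cis_le: "cmod (1 - cis t) \<le> \<bar>t\<bar>"
proof -
  have "cmod (1 - cis t) = 2 * \<bar>sin (t / 2)\<bar>"
    using dist_exp_i_1[of t] by (simp add: cis_conv_exp norm_minus_commute)
  also have "\<dots> \<le> \<bar>t\<bar>" using abs_sin_x_le_abs_x[of "t / 2"] by simp
  finally show ?thesis .
qed

text \<open>
  On \<open>[-N, N]\<close> the constant \<open>1\<close> is, up to an error \<open>1/2\<close>, a combination of exponentials whose
  frequencies all exceed \<open>r / T\<close>. The point is the size of the coefficients: they grow only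
  exponentially in \<open>r N / T\<close>.
\<close>

lemma high_frequency_approximation_of_one:
  fixes r T N :: real
  assumes r: "0 < r" and T: "0 < T" and N: "0 < N"
  defines "m \<equiv> nat \<lceil>16 * (r * N / T)\<rceil>"
  obtains I :: "(nat \<times> nat) set" and c s where "finite I" "\<And>i. i \<in> I \<Longrightarrow> r < s i * T"
    "(\<Sum>i\<in>I. cmod (c i)) \<le> 9 ^ m"
    "\<And>x. \<bar>x\<bar> \<le> N \<Longrightarrow> cmod (1 - (\<Sum>i\<in>I. c i * cis (s i * x))) \<le> 1 / 2"
proof -
  have \<rho>: "0 < r * N / T" using assms by simp
  have m1: "1 \<le> m" and m16: "16 * (r * N / T) \<le> real m"
    using \<rho> by (auto simp: m_def) linarith+
  \<comment> \<open>Chosen so that \<open>m \<delta> = 2 r / T\<close>; then \<open>\<delta> N \<le> 1/8\<close> is the condition \<open>m \<ge> 16 r N / T\<close>.\<close>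
  define \<delta> where "\<delta> = 2 * r / (real m * T)"
  have \<delta>: "0 < \<delta>" using r T m1 by (simp add: \<delta>_def)
  define I where "I = Sigma {m..2*m} (\<lambda>j. {..2*m - j})"
  define c where "c = (\<lambda>(j, l). of_nat (2 * m choose j) * (of_nat (2 * m - j choose l) * (- 1) ^ l) :: complex)"
  define s where "s = (\<lambda>i. real (fst i + snd i) * \<delta>)"
  show ?thesis
  proof
    show "finite I" by (simp add: I_def)
    show "r < s i * T" if "i \<in> I" for i
    proof -
      have "real m \<le> real (fst i + snd i)" using that by (auto simp: I_def)
      then have "real m * \<delta> \<le> s i" unfolding s_def using \<delta> by (intro mult_right_mono) auto
      then have "real m * \<delta> * T \<le> s i * T" using T by (intro mult_right_mono) auto
      moreover have "real m * \<delta> * T = 2 * r" using m1 T by (simp add: \<delta>_def)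
      ultimately show ?thesis using r by linarith
    qed
    show "(\<Sum>i\<in>I. cmod (c i)) \<le> 9 ^ m"
      unfolding I_def c_def by (rule binomial_tail_coefficients(2))
    show "cmod (1 - (\<Sum>i\<in>I. c i * cis (s i * x))) \<le> 1 / 2" if x: "\<bar>x\<bar> \<le> N" for x
    proof -
      define w where "w = cis (\<delta> * x)"
      have "cis (s i * x) = w ^ (fst i + snd i)" for i
        by (simp only: w_def s_def Complex.DeMoivre mult.assoc)
      then have "(\<Sum>i\<in>I. c i * cis (s i * x)) = (\<Sum>j=m..2*m. of_nat (2 * m choose j) * w ^ j * (1 - w) ^ (2 * m - j))"
        using binomial_tail_coefficients(1)[of m w] by (simp add: I_def c_def)
      moreover have "cmod (1 - w) \<le> 1 / 8"
      proof -
        have "cmod (1 - w) \<le> \<delta> * \<bar>x\<bar>"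
          using cmod_1_minus_cis_le[of "\<delta> * x"] \<delta> by (simp add: w_def abs_mult)
        also have "\<dots> \<le> \<delta> * N" using x \<delta> by (intro mult_left_mono) auto
        also have "\<delta> * N = 2 * (r * N / T) / real m" by (simp add: \<delta>_def mult_ac)
        also have "2 * x / real m \<le> 1 / 8" if "16 * x \<le> real m" for x
          using that m1 by (simp add: field_simps)
        note this[OF m16]
        finally show ?thesis .
      qed
      ultimately show ?thesis
        using binomial_tail_small[OF m1, of w] by (simp add: w_def)
    qed
  qed
qed

section \<open>Observability from outside a ball\<close>

text \<open>
  At time \<open>T\<close> the modulus of the boost is that of \<open>v T\<close> translated by more than the diameter of
  the ball, so its mass in the ball comes from outside the ball.
\<close>

lemma L2norm_boost_ball_le:
  fixes v :: "real \<Rightarrow> real ^ 'n \<Rightarrow> complex"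
  assumes v: "square_integrable lborel (v T)" and s: "r < s * T"
  shows "L2norm lborel (\<lambda>x. indicator (cball 0 r) x * galilean_boost s k v T x)
    \<le> L2norm lborel (\<lambda>x. indicator (- cball 0 r) x * v T x)"
proof -
  define a :: "real ^ 'n" where "a = axis k (2 * s * T)"
  have [measurable]: "v T \<in> borel_measurable borel" using v by (simp add: square_integrable_def)
  have [measurable]: "cball (0::real^'n) r \<in> sets borel" by simp
  have na: "axis k (- (2 * s * T)) = - a" by (simp add: a_def axis_def vec_eq_iff)
  have m: "(\<lambda>x. indicator (cball 0 r) x * v T (- a + x)) \<in> borel_measurable borel"
    by measurable
  have "L2norm lborel (\<lambda>x. indicator (cball 0 r) x * galilean_boost s k v T x)
      = L2norm lborel (\<lambda>x. indicator (cball 0 r) x * v T (- a + x))"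
    by (simp add: L2norm_def galilean_boost_def norm_mult na)
  also have "\<dots> = L2norm lborel (\<lambda>x. indicator (cball 0 r) (a + x) * v T x)"
    using L2norm_translate[OF m, of a] by simp
  also have "\<dots> \<le> 1 * L2norm lborel (\<lambda>x. indicator (- cball 0 r) x * v T x)"
  proof (rule L2norm_dominated)
    show "square_integrable lborel (\<lambda>x. indicator (- cball 0 r) x * v T x)"
      by (rule square_integrable_indicator[OF v]) auto
    show "(\<lambda>x. indicator (cball 0 r) (a + x) * v T x) \<in> borel_measurable lborel" by measurable
    have "\<not> (norm (a + x) \<le> r \<and> norm x \<le> r)" for x
    proof
      assume "norm (a + x) \<le> r \<and> norm x \<le> r"
      then have "norm a \<le> 2 * r" using norm_triangle_ineq4[of "a + x" x] by simp
      moreover have "norm a = \<bar>2 * s * T\<bar>"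
        by (simp only: a_def norm_eq_sqrt_inner inner_axis_axis inner_real_def real_sqrt_abs2 simp_thms if_True)
      ultimately show False using s by linarith
    qed
    then show "cmod (indicator (cball 0 r) (a + x) * v T x) \<le> 1 * cmod (indicator (- cball 0 r) x * v T x)" for x
      by (auto simp: indicator_def)
  qed simp
  finally show ?thesis by simp
qed

text \<open>
  Let \<open>q = \<parallel>u 0\<parallel>\<close>, let \<open>a\<close> and \<open>b\<close> be the norms of \<open>u T\<close> inside and outside the ball, and let \<open>S\<close>
  be the sum of the moduli of the coefficients. The combination \<open>w\<close> of \<open>u\<close> with its boosts starts
  from \<open>(1 - \<Sum> c\<^sub>j e\<^bsup>i s\<^sub>j x\<^sub>k\<^esup>) u 0\<close>, whose norm is at most \<open>q / 2\<close>, and this norm is conserved. Hence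
  \<open>a \<le> q / 2 + S b\<close>, while \<open>q \<le> a + b\<close>; so \<open>q \<le> 2 (S + 1) b\<close>.
\<close>

lemma observability_weak_solution:
  fixes u :: "real \<Rightarrow> real ^ 'n \<Rightarrow> complex"
  assumes u: "weak_solution u" and pos: "0 < r" "0 < T" "0 < N"
    and supp: "AE x in lborel. x \<notin> cball 0 N \<longrightarrow> u 0 x = 0"
  shows "(L2norm lborel (u 0))\<^sup>2 \<le> exp (112 * (1 + r * N / T)) * (L2norm lborel (\<lambda>x. indicator (- cball 0 r) x * u T x))\<^sup>2"
proof -
  define m where "m = nat \<lceil>16 * (r * N / T)\<rceil>"
  obtain I :: "(nat \<times> nat) set" and c s where I: "finite I" and s: "\<And>i. i \<in> I \<Longrightarrow> r < s i * T"
    and c: "(\<Sum>i\<in>I. cmod (c i)) \<le> 9 ^ m"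
    and one: "\<And>x. \<bar>x\<bar> \<le> N \<Longrightarrow> cmod (1 - (\<Sum>i\<in>I. c i * cis (s i * x))) \<le> 1 / 2"
    by (rule high_frequency_approximation_of_one[OF pos, folded m_def]) (rule that, assumption+)
  \<comment> \<open>Any coordinate direction will do.\<close>
  obtain k :: 'n where True by blast
  define v where "v = (\<lambda>i. galilean_boost (s i) k u)"
  define w where "w = (\<lambda>t x. u t x - (\<Sum>i\<in>I. c i * v i t x))"
  have v: "weak_solution (v i)" for i unfolding v_def by (rule weak_solution_galilean_boost[OF u])
  have w: "weak_solution w" unfolding w_def by (rule weak_solution_diff_sum[OF u v])
  have T0: "0 \<le> T" using pos by simp
  have sq: "square_integrable lborel (u t)" "square_integrable lborel (v i t)" "square_integrable lborel (w t)"
    if "0 \<le> t" for t i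
    using u v[of i] w that by (simp_all add: weak_solution_def)
  define q where "q = L2norm lborel (u 0)"
  define a where "a = L2norm lborel (\<lambda>x. indicator (cball 0 r) x * u T x)"
  define b where "b = L2norm lborel (\<lambda>x. indicator (- cball 0 r) x * u T x)"
  have nonneg: "0 \<le> q" "0 \<le> a" "0 \<le> b" by (auto simp: q_def a_def b_def)
  define S where "S = (\<Sum>i\<in>I. cmod (c i))"
  have S0: "0 \<le> S" unfolding S_def by (intro sum_nonneg) simp

  have w0: "L2norm lborel (w 0) \<le> 1 / 2 * q"
  proof -
    define P where "P = (\<lambda>x :: real ^ 'n. 1 - (\<Sum>i\<in>I. c i * cis (s i * x $ k)))"
    have [measurable]: "u 0 \<in> borel_measurable borel" "w 0 \<in> borel_measurable borel"
      using sq[of 0] by (auto simp: square_integrable_def)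
    have [measurable]: "P \<in> borel_measurable borel" unfolding P_def by measurable
    have [measurable]: "cball (0::real^'n) N \<in> sets borel" by simp
    have ax0: "axis k 0 = (0 :: real ^ 'n)" by (simp add: axis_def vec_eq_iff)
    have m: "(\<lambda>x. P x * (indicator (cball 0 N) x * u 0 x)) \<in> borel_measurable borel"
      by measurable
    have wP: "w 0 x = P x * u 0 x" for x
      by (simp add: w_def v_def galilean_boost_def P_def ax0 left_diff_distrib sum_distrib_right mult.assoc)
    have "L2norm lborel (w 0) = L2norm lborel (\<lambda>x. P x * (indicator (cball 0 N) x * u 0 x))"
      by (rule L2norm_cong_AE) (measurable, use supp in \<open>eventually_elim, auto simp: wP indicator_def\<close>)
    also have "\<dots> \<le> 1 / 2 * q"
      unfolding q_def
    proof (rule L2norm_dominated[OF sq(1)])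
      fix x :: "real ^ 'n"
      show "cmod (P x * (indicator (cball 0 N) x * u 0 x)) \<le> 1 / 2 * cmod (u 0 x)"
      proof (cases "norm x \<le> N")
        case True
        then have "\<bar>x $ k\<bar> \<le> N" using component_le_norm_cart[of x k] by linarith
        then have "cmod (P x) \<le> 1 / 2" unfolding P_def by (rule one)
        then have "cmod (P x) * cmod (u 0 x) \<le> 1 / 2 * cmod (u 0 x)" by (rule mult_right_mono) simp
        with True show ?thesis by (simp add: norm_mult indicator_def)
      qed (simp add: indicator_def)
    qed (use m in auto)
    finally show ?thesis .
  qed

  have "a \<le> q / 2 + S * b"
  proof -
    have [measurable]: "cball (0::real^'n) r \<in> sets lborel" by simp
    let ?J = "\<lambda>f x. indicator (cball (0 :: real ^ 'n) r) x * f x :: complex"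
    have sqJ: "square_integrable lborel (?J f)" if "square_integrable lborel f" for f
      by (rule square_integrable_indicator[OF that]) simp
    have "?J (u T) x = ?J (w T) x + (\<Sum>i\<in>I. c i * ?J (v i T) x)" for x
      by (simp add: w_def algebra_simps sum_distrib_left)
    then have "a = L2norm lborel (\<lambda>x. ?J (w T) x + (\<Sum>i\<in>I. c i * ?J (v i T) x))"
      by (simp add: a_def)
    also have "\<dots> \<le> L2norm lborel (?J (w T)) + L2norm lborel (\<lambda>x. \<Sum>i\<in>I. c i * ?J (v i T) x)"
      by (intro L2norm_triangle square_integrable_sum square_integrable_mult_left sqJ sq T0)
    also have "L2norm lborel (\<lambda>x. \<Sum>i\<in>I. c i * ?J (v i T) x) \<le> (\<Sum>i\<in>I. L2norm lborel (\<lambda>x. c i * ?J (v i T) x))"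
      by (intro L2norm_sum square_integrable_mult_left sqJ sq T0)
    also have "\<dots> \<le> (\<Sum>i\<in>I. cmod (c i) * b)"
      unfolding L2norm_mult_left b_def v_def
      by (intro sum_mono mult_left_mono L2norm_boost_ball_le sq T0 s) auto
    also have "\<dots> = S * b" by (simp add: S_def sum_distrib_right)
    also have "L2norm lborel (?J (w T)) \<le> 1 * L2norm lborel (w T)"
      using sqJ[OF sq(3)[OF T0]]
      by (intro L2norm_dominated[OF sq(3)[OF T0]]) (auto simp: square_integrable_def indicator_def)
    also have "L2norm lborel (w T) = L2norm lborel (w 0)" by (rule mass_conservation[OF w T0])
    also note w0
    finally show ?thesis by simp
  qed
  moreover have "q \<le> a + b"
  proof -
    have "q\<^sup>2 = a\<^sup>2 + b\<^sup>2"
      unfolding q_def mass_conservation[OF u T0, symmetric] a_def b_def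
      by (rule L2norm_indicator_split[OF sq(1)[OF T0]]) simp
    also have "\<dots> \<le> (a + b)\<^sup>2" using nonneg by (simp add: power2_eq_square algebra_simps)
    finally show ?thesis by (rule power2_le_imp_le) (use nonneg in simp)
  qed
  ultimately have "q \<le> 2 * (S + 1) * b" by (simp add: algebra_simps)
  also have "\<dots> \<le> (4 * 9 ^ m) * b"
  proof -
    have "(1::real) \<le> 9 ^ m" by simp
    with c have "S + 1 \<le> 9 ^ m + 9 ^ m" unfolding S_def by (rule add_mono)
    then have "2 * (S + 1) \<le> 2 * (9 ^ m + 9 ^ m)" by (rule mult_left_mono) simp
    then have "2 * (S + 1) * b \<le> 2 * (9 ^ m + 9 ^ m) * b" using nonneg(3) by (rule mult_right_mono)
    then show ?thesis by simp
  qed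
  finally have "q\<^sup>2 \<le> ((4 * 9 ^ m) * b)\<^sup>2" using nonneg by (intro power_mono) auto
  also have "\<dots> = (16 * 81 ^ m) * b\<^sup>2"
    by (simp add: power_mult_distrib power_mult[symmetric] mult.commute[of m 2]) (simp add: power_mult)
  also have "\<dots> \<le> exp (112 * (1 + r * N / T)) * b\<^sup>2"
  proof (rule mult_right_mono)
    have e2: "(2::real) \<le> exp 1" using exp_ge_add_one_self[of 1] by simp
    \<comment> \<open>The exponent is \<open>4 + 7 m \<le> 11 + 112 r N / T\<close>.\<close>
    have "(16 * 81 ^ m :: real) \<le> 2 ^ 4 * (2 ^ 7) ^ m"
      by (intro mult_mono power_mono) auto
    also have "\<dots> = 2 ^ (4 + 7 * m)" by (simp add: power_add power_mult)
    also have "\<dots> \<le> exp 1 ^ (4 + 7 * m)" by (intro power_mono e2) simp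
    also have "\<dots> = exp (real (4 + 7 * m))" by (simp add: exp_of_nat_mult[symmetric])
    also have "\<dots> \<le> exp (112 * (1 + r * N / T))"
    proof -
      have "0 < r * N / T" using pos by simp
      then have "real m \<le> 16 * (r * N / T) + 1" unfolding m_def by linarith
      then show ?thesis by simp
    qed
    finally show "16 * 81 ^ m \<le> exp (112 * (1 + r * N / T))" .
  qed simp
  finally show ?thesis by (simp add: q_def b_def)
qed

section \<open>From Lebesgue to Borel functions\<close>

text \<open>
  For a Lebesgue measurable \<open>f\<close> the function \<open>(h, z) \<mapsto> f(h + z)\<close> need not be measurable for the
  product of the Lebesgue \<open>\<sigma>\<close>-algebras, which Fubini's theorem requires. With Borel representatives
  the difficulty disappears.
\<close>

lemma lebesgue_borel_representative:
  fixes f :: "'a::euclidean_space \<Rightarrow> complex"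
  assumes "f \<in> borel_measurable lebesgue"
  obtains g where "g \<in> borel_measurable borel" "AE x in lebesgue. f x = g x"
proof -
  have "(\<lambda>x. Re (f x)) \<in> borel_measurable lebesgue" "(\<lambda>x. Im (f x)) \<in> borel_measurable lebesgue"
    using assms by measurable
  note this[THEN completion_ex_borel_measurable_real]
  then obtain g h where g: "g \<in> borel_measurable lborel" "AE x in lborel. Re (f x) = g x"
    and h: "h \<in> borel_measurable lborel" "AE x in lborel. Im (f x) = h x"
    by blast
  have "(\<lambda>x. Complex (g x) (h x)) = (\<lambda>x. of_real (g x) + \<i> * of_real (h x))"
    by (simp add: Complex_eq)
  then have "(\<lambda>x. Complex (g x) (h x)) \<in> borel_measurable borel"
    using g(1) h(1) by simp
  moreover have "AE x in lborel. f x = Complex (g x) (h x)"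
    using g(2) h(2) by eventually_elim (simp add: complex_eq_iff)
  ultimately show ?thesis using that AE_completion by blast
qed

lemma integral_lebesgue_representative:
  fixes f g :: "'a::euclidean_space \<Rightarrow> 'b::{banach, second_countable_topology}"
  assumes f: "f \<in> borel_measurable lebesgue" and g: "g \<in> borel_measurable borel"
    and eq: "AE x in lebesgue. f x = g x"
  shows "integral\<^sup>L lebesgue f = integral\<^sup>L lborel g"
    and "integrable lebesgue f \<longleftrightarrow> integrable lborel g"
proof -
  have g': "g \<in> borel_measurable lebesgue" using g by (simp add: measurable_completion)
  show "integral\<^sup>L lebesgue f = integral\<^sup>L lborel g"
    using integral_cong_AE[OF f g' eq] integral_completion[of g lborel] g by simp
  show "integrable lebesgue f \<longleftrightarrow> integrable lborel g"
    using integrable_cong_AE[OF f g' eq] integrable_completion[of g lborel] g by simp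
qed

text \<open>
  The union in the definition of the support is uncountable; the Lindeloef property reduces it
  to a countable one.
\<close>

lemma ess_supp_AE:
  fixes f :: "real ^ 'n \<Rightarrow> complex"
  assumes "ess_supp f \<subseteq> S"
  shows "AE x in lebesgue. x \<notin> S \<longrightarrow> f x = 0"
proof -
  define \<F> where "\<F> = {U. open U \<and> (AE x in lebesgue. x \<in> U \<longrightarrow> f x = 0)}"
  have "open U" if "U \<in> \<F>" for U using that by (simp add: \<F>_def)
  from Lindelof[OF this]
  obtain \<G> where \<G>: "\<G> \<subseteq> \<F>" "countable \<G>" "\<Union>\<G> = \<Union>\<F>" .
  have "\<forall>U\<in>\<G>. AE x in lebesgue. x \<in> U \<longrightarrow> f x = 0"
    using \<G>(1) by (auto simp: \<F>_def)
  then have "AE x in lebesgue. \<forall>U\<in>\<G>. x \<in> U \<longrightarrow> f x = 0"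
    by (rule iffD2[OF AE_ball_countable[OF \<G>(2)]])
  then show ?thesis
  proof eventually_elim
    case (elim x)
    have "- S \<subseteq> \<Union>\<G>"
      using assms unfolding \<G>(3) ess_supp_def \<F>_def[symmetric] by blast
    with elim show ?case by blast
  qed
qed

text \<open>
  A Borel representative is chosen separately for each time; time enters the argument only
  through norms and pairings of the states.
\<close>

lemma schrodinger_solution_weak_solution:
  fixes u :: "real ^ 'n \<Rightarrow> real \<Rightarrow> complex"
  assumes u: "schrodinger_solution u0 u"
  obtains v where "weak_solution v" "\<And>t. 0 \<le> t \<Longrightarrow> AE x in lebesgue. u x t = v t x"
proof -
  have L2: "in_L2 (\<lambda>x. u x t)" if "0 \<le> t" for t
    using u that by (simp add: schrodinger_solution_def)
  have um: "(\<lambda>x. u x t) \<in> borel_measurable lebesgue" if "0 \<le> t" for t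
    using L2[OF that] by (simp add: in_L2_def)
  have "\<exists>g. g \<in> borel_measurable borel \<and> (AE x in lebesgue. u x t = g x)" if "0 \<le> t" for t
    using lebesgue_borel_representative[OF um[OF that]] by blast
  then obtain v where vm: "\<And>t. 0 \<le> t \<Longrightarrow> v t \<in> borel_measurable borel"
    and v: "\<And>t. 0 \<le> t \<Longrightarrow> AE x in lebesgue. u x t = v t x"
    by metis
  have pair: "(LINT x|lebesgue. u x s * g x) = (LINT x|lborel. v s x * g x)"
    if s: "0 \<le> s" and g: "g \<in> borel_measurable borel" for s g
  proof (rule integral_lebesgue_representative(1))
    have "g \<in> borel_measurable lebesgue" using g by (simp add: measurable_completion)
    then show "(\<lambda>x. u x s * g x) \<in> borel_measurable lebesgue"
      using um[OF s] by (rule borel_measurable_times[rotated])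
    show "(\<lambda>x. v s x * g x) \<in> borel_measurable borel"
      using vm[OF s] g by (rule borel_measurable_times)
    show "AE x in lebesgue. u x s * g x = v s x * g x"
      using v[OF s] by eventually_elim simp
  qed
  have "weak_solution v"
    unfolding weak_solution_def
  proof (intro conjI allI impI)
    show "square_integrable lborel (v t)" if t: "0 \<le> t" for t
    proof -
      have "integrable lebesgue (\<lambda>x. (cmod (u x t))\<^sup>2) \<longleftrightarrow> integrable lborel (\<lambda>x. (cmod (v t x))\<^sup>2)"
      proof (rule integral_lebesgue_representative(2))
        show "(\<lambda>x. (cmod (u x t))\<^sup>2) \<in> borel_measurable lebesgue" using um[OF t] by measurable
        show "(\<lambda>x. (cmod (v t x))\<^sup>2) \<in> borel_measurable borel" using vm[OF t] by measurable
        show "AE x in lebesgue. (cmod (u x t))\<^sup>2 = (cmod (v t x))\<^sup>2" using v[OF t] by eventually_elim simp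
      qed
      then show ?thesis using L2[OF t] vm[OF t] by (simp add: in_L2_def square_integrable_def)
    qed
    show "((\<lambda>t. L2norm lborel (\<lambda>x. v t x - v s x)) \<longlongrightarrow> 0) (at s within {0..})" if s: "0 \<le> s" for s
    proof -
      have "((\<lambda>t. sqrt (LINT x|lebesgue. (cmod (u x t - u x s))\<^sup>2)) \<longlongrightarrow> sqrt 0) (at s within {0..})"
        using u s by (intro tendsto_real_sqrt) (simp add: schrodinger_solution_def)
      moreover have "sqrt (LINT x|lebesgue. (cmod (u x t - u x s))\<^sup>2) = L2norm lborel (\<lambda>x. v t x - v s x)"
        if t: "0 \<le> t" for t
      proof -
        have "(LINT x|lebesgue. (cmod (u x t - u x s))\<^sup>2) = (LINT x|lborel. (cmod (v t x - v s x))\<^sup>2)"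
        proof (rule integral_lebesgue_representative(1))
          show "(\<lambda>x. (cmod (u x t - u x s))\<^sup>2) \<in> borel_measurable lebesgue" using um[OF t] um[OF s] by measurable
          show "(\<lambda>x. (cmod (v t x - v s x))\<^sup>2) \<in> borel_measurable borel" using vm[OF t] vm[OF s] by measurable
          show "AE x in lebesgue. (cmod (u x t - u x s))\<^sup>2 = (cmod (v t x - v s x))\<^sup>2"
            using v[OF t] v[OF s] by eventually_elim simp
        qed
        then show ?thesis by (simp add: L2norm_def)
      qed
      then have "\<forall>\<^sub>F t in at s within {0..}. sqrt (LINT x|lebesgue. (cmod (u x t - u x s))\<^sup>2)
          = L2norm lborel (\<lambda>x. v t x - v s x)"
        by (simp add: eventually_at_filter)
      ultimately show ?thesis
        using Lim_transform_eventually by fastforce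
    qed
    fix F :: "'n \<Rightarrow> nat \<Rightarrow> real \<Rightarrow> complex" and t :: real
    assume "\<forall>i. jet (F i)" and t: "0 < t"
    then have F: "jet (F i)" for i by blast
    have Tm: "tensor F (\<lambda>_. 0) \<in> borel_measurable borel"
      by (intro borel_measurable_continuous_onI tensor_continuous F)
    have Lm: "laplacian (tensor F (\<lambda>_. 0)) \<in> borel_measurable borel"
      using square_integrable_laplacian_tensor[of F "\<lambda>_. 0", OF F] by (simp add: square_integrable_def)
    have "test_function (tensor F (\<lambda>_. 0))" by (rule test_function_tensor[OF F])
    then obtain D where D: "((\<lambda>s. LINT x|lebesgue. u x s * tensor F (\<lambda>_. 0) x) has_vector_derivative D) (at t)"
        and eq: "\<i> * D + (LINT x|lebesgue. u x t * laplacian (tensor F (\<lambda>_. 0)) x) = 0"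
      using u t unfolding schrodinger_solution_def by blast
    have "D = \<i> * (LINT x|lebesgue. u x t * laplacian (tensor F (\<lambda>_. 0)) x)"
      using arg_cong[OF eq, of "\<lambda>z. \<i> * z"] by (simp add: algebra_simps)
    then have "D = \<i> * (LINT x|lborel. v t x * laplacian (tensor F (\<lambda>_. 0)) x)"
      using pair[OF _ Lm, of t] t by simp
    moreover have "((\<lambda>s. LINT x|lborel. v s x * tensor F (\<lambda>_. 0) x) has_vector_derivative D) (at t)"
      using D by (rule has_vector_derivative_transform_within_open[where S="{0<..}"])
        (use t pair[OF _ Tm] in auto)
    ultimately show "((\<lambda>s. LINT x|lborel. v s x * tensor F (\<lambda>_. 0) x) has_vector_derivative
      \<i> * (LINT x|lborel. v t x * laplacian (tensor F (\<lambda>_. 0)) x)) (at t)" by simp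
  qed
  with v that show ?thesis by blast
qed

theorem theorem1p4:
  "\<exists>C::real. C > 0 \<and>
     (\<forall>r T N :: real. \<forall>(u0 :: real ^ 'n \<Rightarrow> complex) u.
        r > 0 \<longrightarrow> T > 0 \<longrightarrow> N > 0 \<longrightarrow>
        in_L2 u0 \<longrightarrow> ess_supp u0 \<subseteq> cball 0 N \<longrightarrow> schrodinger_solution u0 u \<longrightarrow>
        (LINT x|lebesgue. (cmod (u0 x))\<^sup>2)
          \<le> exp (C * (1 + r * N / T)) * (LINT x:- cball 0 r|lebesgue. (cmod (u x T))\<^sup>2))"
proof (intro exI[of _ 112] conjI allI impI)
  fix r T N :: real and u0 :: "real ^ 'n \<Rightarrow> complex" and u
  assume pos: "r > 0" "T > 0" "N > 0" and u0: "in_L2 u0" and supp: "ess_supp u0 \<subseteq> cball 0 N"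
    and u: "schrodinger_solution u0 u"
  obtain v where v: "weak_solution v" and uv: "\<And>t. 0 \<le> t \<Longrightarrow> AE x in lebesgue. u x t = v t x"
    by (rule schrodinger_solution_weak_solution[OF u]) (rule that, assumption+)
  have T0: "0 \<le> T" using pos by simp
  have vm: "v t \<in> borel_measurable borel" if "0 \<le> t" for t
    using v that by (simp add: weak_solution_def square_integrable_def)
  have um: "(\<lambda>x. u x t) \<in> borel_measurable lebesgue" if "0 \<le> t" for t
    using u that by (simp add: schrodinger_solution_def in_L2_def)
  have u0m: "u0 \<in> borel_measurable lebesgue" using u0 by (simp add: in_L2_def)
  have init: "AE x in lebesgue. u x 0 = u0 x" using u by (simp add: schrodinger_solution_def)
  have "AE x in lebesgue. x \<notin> cball 0 N \<longrightarrow> v 0 x = 0"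
    using ess_supp_AE[OF supp] init uv[OF order_refl] by eventually_elim simp
  then have v0: "AE x in lborel. x \<notin> cball 0 N \<longrightarrow> v 0 x = 0"
    by (simp only: AE_completion_iff)
  have lhs: "(LINT x|lebesgue. (cmod (u0 x))\<^sup>2) = (L2norm lborel (v 0))\<^sup>2"
    unfolding L2norm_power2
  proof (rule integral_lebesgue_representative(1))
    show "(\<lambda>x. (cmod (u0 x))\<^sup>2) \<in> borel_measurable lebesgue" using u0m by measurable
    show "(\<lambda>x. (cmod (v 0 x))\<^sup>2) \<in> borel_measurable borel" using vm[OF order_refl] by measurable
    show "AE x in lebesgue. (cmod (u0 x))\<^sup>2 = (cmod (v 0 x))\<^sup>2"
      using init uv[OF order_refl] by eventually_elim simp
  qed
  have rhs: "(LINT x:- cball 0 r|lebesgue. (cmod (u x T))\<^sup>2) = (L2norm lborel (\<lambda>x. indicator (- cball 0 r) x * v T x))\<^sup>2"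
    unfolding L2norm_power2 set_lebesgue_integral_def
  proof (rule integral_lebesgue_representative(1))
    have B: "- cball (0 :: real ^ 'n) r \<in> sets lebesgue" "- cball (0 :: real ^ 'n) r \<in> sets borel" by auto
    show "(\<lambda>x. indicat_real (- cball 0 r) x *\<^sub>R (cmod (u x T))\<^sup>2) \<in> borel_measurable lebesgue"
      using um[OF T0] B(1) by measurable
    show "(\<lambda>x. (cmod (indicator (- cball 0 r) x * v T x))\<^sup>2) \<in> borel_measurable borel"
      using vm[OF T0] B(2) by measurable
    show "AE x in lebesgue. indicat_real (- cball 0 r) x *\<^sub>R (cmod (u x T))\<^sup>2
        = (cmod (indicator (- cball 0 r) x * v T x))\<^sup>2"
      using uv[OF T0] by eventually_elim (simp add: indicator_def)
  qed
  show "(LINT x|lebesgue. (cmod (u0 x))\<^sup>2)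
      \<le> exp (112 * (1 + r * N / T)) * (LINT x:- cball 0 r|lebesgue. (cmod (u x T))\<^sup>2)"
    unfolding lhs rhs by (rule observability_weak_solution[OF v pos v0])
qed simp

end
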